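(* Let $n \geq 2$ and, for each $j = 1,\dots,n$, let $\Omega_j$ be a hyperrectangle in $\mathbb{R}^{d_j}$, $d_j \in \mathbb{N}$, and let $\mathcal{H}_j = H_{\mathrm{per}}^1(\Omega_j)$ be the closure of $C_{\mathrm{per}}^\infty(\Omega_j)$ in $H^1(\Omega_j)$. Put $\Omega = \Omega_1 \times \dots \times \Omega_n \subset \mathbb{R}^d$ with $d = d_1 + \dots + d_n$, and let $T$ be the self-adjoint operator on $L^2(\Omega)$ associated with $\mathcal{H}_1,\dots,\mathcal{H}_n$ (as defined in the context). Then $T = -\Delta_\Omega^{\mathrm{per}}$, where $\Delta_\Omega^{\mathrm{per}}$ is the Laplacian on the hyperrectangle $\Omega$ with periodic boundary conditions. In particular, $H_{\mathrm{per}}^1(\Omega) = \bigotimes_{j=1}^n H_{\mathrm{per}}^1(\Omega_j)$.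
   Context: All function spaces consist of complex-valued functions, and inner products are linear in the first argument. $H^1$ is the $L^2$-based first-order Sobolev space. A hyperrectangle in $\mathbb{R}^m$ is a product $Q = \prod_{i=1}^m (a_i,b_i)$ of bounded nonempty open intervals. $C_{\mathrm{per}}^\infty(Q)$ is the space of restrictions to $Q$ of functions $u \in C^\infty(\mathbb{R}^m)$ that are $(b_i-a_i)$-periodic in the $i$-th coordinate for every $i$; $H_{\mathrm{per}}^1(Q)$ is the closure of $C_{\mathrm{per}}^\infty(Q)$ in $H^1(Q)$. For each $j$ let $\mathcal{H}_j$ be a closed subspace of $H^1(\Omega_j)$ that is dense in $L^2(\Omega_j)$. For $f_j \in \mathcal{H}_j$, the elementary tensor $\bigotimes_{j=1}^n f_j \in H^1(\Omega)$ is the function $(x_1,\dots,x_n) \mapsto \prod_{j=1}^n f_j(x_j)$, $x_j \in \Omega_j$. Let $\mathcal{K} = \operatorname{span}_{\mathbb{C}}\{ \bigotimes_{j=1}^n f_j : f_j \in \mathcal{H}_j \} \subset H^1(\Omega)$, and define $\mathcal{H} = \bigotimes_{j=1}^n \mathcal{H}_j$ to be the closure of $\mathcal{K}$ in $H^1(\Omega)$ (with respect to the $H^1(\Omega)$-norm). The form $\mathfrak{t}[f,g] = \sum_{k=1}^d \langle \partial_k f, \partial_k g \rangle_{L^2(\Omega)}$, $f,g \in \mathcal{H}$, is closed, nonnegative, and densely defined on $L^2(\Omega)$. $T$ denotes the unique nonnegative self-adjoint operator on $L^2(\Omega)$ with $\operatorname{Dom}(T) \subset \mathcal{H}$ and $\mathfrak{t}[f,g]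 = \langle Tf, g\rangle_{L^2(\Omega)}$ for all $f \in \operatorname{Dom}(T)$, $g \in \mathcal{H}$. The Laplacian $\Delta_\Omega^{\mathrm{per}}$ with periodic boundary conditions is the Laplacian with form domain $H_{\mathrm{per}}^1(\Omega)$, i.e. $-\Delta_\Omega^{\mathrm{per}}$ is the unique nonnegative self-adjoint operator on $L^2(\Omega)$ with domain contained in $H_{\mathrm{per}}^1(\Omega)$ and $\sum_{k=1}^d \langle \partial_k f, \partial_k g \rangle_{L^2(\Omega)} = \langle -\Delta_\Omega^{\mathrm{per}} f, g\rangle_{L^2(\Omega)}$ for all $f \in \operatorname{Dom}(\Delta_\Omega^{\mathrm{per}})$, $g \in H_{\mathrm{per}}^1(\Omega)$. Equality of unbounded operators includes equality of domains. *)

theory Defs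
  imports "HOL-Analysis.Analysis"
begin

text \<open>
  The space of m-tuples of reals is the set of functions \<open>nat \<Rightarrow> real\<close> that are extensional on
  \<open>{..<m}\<close>, so that the dimension may vary inside a formula. It carries the topology of
  \<open>nat \<Rightarrow> real\<close> (the product topology) and the product Lebesgue measure.

  A function on a set Q is represented by a function on the whole type; its values
  off Q are irrelevant. An element of a space such as \<open>L2_space\<close>, \<open>H1_space\<close> is a representative
  of a class modulo equality almost everywhere on Q. The sets \<open>L2_space\<close>, \<open>H1_space\<close>, every
  \<open>H1_closure\<close> and the graph of every operator contain all measurable representatives of each
  of their classes, hence equality of such sets is equality of the corresponding sets of classes.
\<close>

type_synonym point = "nat \<Rightarrow> real"
type_synonym cfun = "point \<Rightarrow> complex"

abbreviation real_space :: "nat \<Rightarrow> point set" where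
  "real_space m \<equiv> (\<Pi>\<^sub>E i\<in>{..<m}. UNIV)"

definition leb :: "nat \<Rightarrow> point set \<Rightarrow> point measure" where
  "leb m Q = restrict_space (\<Pi>\<^sub>M i\<in>{..<m}. lborel) Q"

definition hyperrectangle :: "nat \<Rightarrow> point set \<Rightarrow> bool" where
  "hyperrectangle m Q \<longleftrightarrow>
     (\<exists>a b. (\<forall>i<m. a i < b i) \<and> Q = (\<Pi>\<^sub>E i\<in>{..<m}. {a i<..<b i}))"


subsection \<open>Smooth functions\<close>

definition partial_deriv :: "nat \<Rightarrow> cfun \<Rightarrow> cfun" where
  "partial_deriv k u x = vector_derivative (\<lambda>t. u (x(k := t))) (at (x k))"

fun iterated_partial :: "nat list \<Rightarrow> cfun \<Rightarrow> cfun" where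
  "iterated_partial [] u = u"
| "iterated_partial (k # ks) u = partial_deriv k (iterated_partial ks u)"

definition smooth_fun :: "nat \<Rightarrow> cfun \<Rightarrow> bool" where
  "smooth_fun m u \<longleftrightarrow>
     (\<forall>ks\<in>lists {..<m}.
        continuous_on (real_space m) (iterated_partial ks u) \<and>
        (\<forall>k<m. \<forall>x\<in>real_space m.
           (\<lambda>t. iterated_partial ks u (x(k := t))) differentiable (at (x k))))"

definition test_fun :: "nat \<Rightarrow> point set \<Rightarrow> cfun \<Rightarrow> bool" where
  "test_fun m Q \<phi> \<longleftrightarrow>
     smooth_fun m \<phi> \<and>
     (\<exists>K. compact K \<and> K \<subseteq> Q \<and> (\<forall>x \<in> real_space m - K. \<phi> x = 0))"

text \<open>The numbers \<open>a i\<close>, \<open>b i\<close> for \<open>i < m\<close> are determined by the hyperrectangle Q.\<close>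

definition smooth_per :: "nat \<Rightarrow> point set \<Rightarrow> cfun set" where
  "smooth_per m Q =
     {restrict u Q | u a b.
        (\<forall>i<m. a i < b i) \<and> Q = (\<Pi>\<^sub>E i\<in>{..<m}. {a i<..<b i}) \<and>
        smooth_fun m u \<and>
        (\<forall>x\<in>real_space m. \<forall>i<m. u (x(i := x i + (b i - a i))) = u x)}"


subsection \<open>The spaces of square-integrable and of Sobolev functions\<close>

definition L2_space :: "nat \<Rightarrow> point set \<Rightarrow> cfun set" where
  "L2_space m Q =
     {f \<in> borel_measurable (leb m Q). integrable (leb m Q) (\<lambda>x. (cmod (f x))\<^sup>2)}"

definition L2_inner :: "nat \<Rightarrow> point set \<Rightarrow> cfun \<Rightarrow> cfun \<Rightarrow> complex" where
  "L2_inner m Q f g = (\<integral>x. f x * cnj (g x) \<partial>leb m Q)"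

definition L2_norm :: "nat \<Rightarrow> point set \<Rightarrow> cfun \<Rightarrow> real" where
  "L2_norm m Q f = sqrt (\<integral>x. (cmod (f x))\<^sup>2 \<partial>leb m Q)"

definition has_weak_deriv :: "nat \<Rightarrow> point set \<Rightarrow> nat \<Rightarrow> cfun \<Rightarrow> cfun \<Rightarrow> bool" where
  "has_weak_deriv m Q k f g \<longleftrightarrow>
     (\<forall>\<phi>. test_fun m Q \<phi> \<longrightarrow>
        (\<integral>x. f x * partial_deriv k \<phi> x \<partial>leb m Q) = - (\<integral>x. g x * \<phi> x \<partial>leb m Q))"

definition H1_space :: "nat \<Rightarrow> point set \<Rightarrow> cfun set" where
  "H1_space m Q =
     {f \<in> L2_space m Q. \<forall>k<m. \<exists>g\<in>L2_space m Q. has_weak_deriv m Q k f g}"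

text \<open>The weak derivative is unique up to a null set, so the choice is immaterial.\<close>

definition weak_deriv :: "nat \<Rightarrow> point set \<Rightarrow> nat \<Rightarrow> cfun \<Rightarrow> cfun" where
  "weak_deriv m Q k f = (SOME g. g \<in> L2_space m Q \<and> has_weak_deriv m Q k f g)"

definition H1_norm :: "nat \<Rightarrow> point set \<Rightarrow> cfun \<Rightarrow> real" where
  "H1_norm m Q f =
     sqrt ((L2_norm m Q f)\<^sup>2 + (\<Sum>k<m. (L2_norm m Q (weak_deriv m Q k f))\<^sup>2))"

text \<open>
  In every use below \<open>K \<subseteq> H1_space m Q\<close> holds; the intersection only guards against \<open>H1_norm\<close>
  being evaluated at functions without weak derivatives.
\<close>

definition H1_closure :: "nat \<Rightarrow> point set \<Rightarrow> cfun set \<Rightarrow> cfun set" where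
  "H1_closure m Q K =
     {f \<in> H1_space m Q. \<forall>\<epsilon>>0. \<exists>g \<in> K \<inter> H1_space m Q. H1_norm m Q (\<lambda>x. f x - g x) < \<epsilon>}"

definition H1_per :: "nat \<Rightarrow> point set \<Rightarrow> cfun set" where
  "H1_per m Q = H1_closure m Q (smooth_per m Q)"


subsection \<open>Product domains and tensor products\<close>

definition total_dim :: "(nat \<Rightarrow> nat) \<Rightarrow> nat \<Rightarrow> nat" where
  "total_dim d n = (\<Sum>j<n. d j)"

text \<open>
  The factors are numbered \<open>0, \<dots>, n - 1\<close>. The j-th block of \<open>x = (x\<^sub>0, \<dots>, x\<^sub>n\<^sub>-\<^sub>1)\<close> consists of the
  \<open>d j\<close> coordinates that follow the first \<open>d 0 + \<dots> + d (j - 1)\<close> ones.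
\<close>

definition block :: "(nat \<Rightarrow> nat) \<Rightarrow> nat \<Rightarrow> point \<Rightarrow> point" where
  "block d j x = (\<lambda>i\<in>{..<d j}. x (total_dim d j + i))"

definition product_domain :: "(nat \<Rightarrow> nat) \<Rightarrow> nat \<Rightarrow> (nat \<Rightarrow> point set) \<Rightarrow> point set" where
  "product_domain d n \<Omega> = {x \<in> real_space (total_dim d n). \<forall>j<n. block d j x \<in> \<Omega> j}"

definition elementary_tensor :: "(nat \<Rightarrow> nat) \<Rightarrow> nat \<Rightarrow> (nat \<Rightarrow> cfun) \<Rightarrow> cfun" where
  "elementary_tensor d n f x = (\<Prod>j<n. f j (block d j x))"

definition complex_span :: "cfun set \<Rightarrow> cfun set" where
  "complex_span S =
     {(\<lambda>x. \<Sum>l<N. c l * v l x) | (N :: nat) c v. \<forall>l<N. v l \<in> S}"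

definition tensor_space ::
    "(nat \<Rightarrow> nat) \<Rightarrow> nat \<Rightarrow> (nat \<Rightarrow> point set) \<Rightarrow> (nat \<Rightarrow> cfun set) \<Rightarrow> cfun set" where
  "tensor_space d n \<Omega> H =
     H1_closure (total_dim d n) (product_domain d n \<Omega>)
       (complex_span {elementary_tensor d n f | f. \<forall>j<n. f j \<in> H j})"


subsection \<open>Unbounded operators on the space of square-integrable functions\<close>

text \<open>
  An operator is given by its graph, closed under changing both components on null sets and
  single-valued up to null sets; \<open>Domain T\<close> is its domain.
\<close>

type_synonym operator = "(cfun \<times> cfun) set"

definition linear_operator :: "nat \<Rightarrow> point set \<Rightarrow> operator \<Rightarrow> bool" where
  "linear_operator m Q T \<longleftrightarrow>
     T \<subseteq> L2_space m Q \<times> L2_space m Q \<and>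
     (\<forall>(f, h)\<in>T. \<forall>f'\<in>L2_space m Q. \<forall>h'\<in>L2_space m Q.
        (AE x in leb m Q. f' x = f x) \<and> (AE x in leb m Q. h' x = h x) \<longrightarrow> (f', h') \<in> T) \<and>
     (\<forall>f h h'. (f, h) \<in> T \<and> (f, h') \<in> T \<longrightarrow> (AE x in leb m Q. h x = h' x)) \<and>
     (\<lambda>x. 0, \<lambda>x. 0) \<in> T \<and>
     (\<forall>(f, h)\<in>T. \<forall>(f', h')\<in>T. (\<lambda>x. f x + f' x, \<lambda>x. h x + h' x) \<in> T) \<and>
     (\<forall>c. \<forall>(f, h)\<in>T. (\<lambda>x. c * f x, \<lambda>x. c * h x) \<in> T)"

definition L2_dense :: "nat \<Rightarrow> point set \<Rightarrow> cfun set \<Rightarrow> bool" where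
  "L2_dense m Q D \<longleftrightarrow>
     (\<forall>f\<in>L2_space m Q. \<forall>\<epsilon>>0. \<exists>g\<in>D. L2_norm m Q (\<lambda>x. f x - g x) < \<epsilon>)"

definition adjoint_op :: "nat \<Rightarrow> point set \<Rightarrow> operator \<Rightarrow> operator" where
  "adjoint_op m Q T =
     {(g, h) \<in> L2_space m Q \<times> L2_space m Q. \<forall>(f, k)\<in>T. L2_inner m Q k g = L2_inner m Q f h}"

definition self_adjoint_op :: "nat \<Rightarrow> point set \<Rightarrow> operator \<Rightarrow> bool" where
  "self_adjoint_op m Q T \<longleftrightarrow>
     linear_operator m Q T \<and> L2_dense m Q (Domain T) \<and> T = adjoint_op m Q T"

definition nonneg_op :: "nat \<Rightarrow> point set \<Rightarrow> operator \<Rightarrow> bool" where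
  "nonneg_op m Q T \<longleftrightarrow>
     (\<forall>(f, h)\<in>T. L2_inner m Q h f \<in> \<real> \<and> 0 \<le> Re (L2_inner m Q h f))"

definition uminus_op :: "operator \<Rightarrow> operator" where
  "uminus_op T = {(f, \<lambda>x. - h x) | f h. (f, h) \<in> T}"

definition dirichlet_form :: "nat \<Rightarrow> point set \<Rightarrow> cfun \<Rightarrow> cfun \<Rightarrow> complex" where
  "dirichlet_form m Q f g =
     (\<Sum>k<m. L2_inner m Q (weak_deriv m Q k f) (weak_deriv m Q k g))"

text \<open>\<open>T\<close> is the operator associated with the Dirichlet form with form domain \<open>V\<close>.\<close>

definition form_operator :: "nat \<Rightarrow> point set \<Rightarrow> cfun set \<Rightarrow> operator \<Rightarrow> bool" where
  "form_operator m Q V T \<longleftrightarrow>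
     self_adjoint_op m Q T \<and> nonneg_op m Q T \<and> Domain T \<subseteq> V \<and>
     (\<forall>(f, h)\<in>T. \<forall>g\<in>V. dirichlet_form m Q f g = L2_inner m Q h g)"

definition periodic_laplacian :: "nat \<Rightarrow> point set \<Rightarrow> operator \<Rightarrow> bool" where
  "periodic_laplacian m Q \<Delta> \<longleftrightarrow> form_operator m Q (H1_per m Q) (uminus_op \<Delta>)"

end

theory Submission
  imports Defs
begin

text \<open>
  The form determines the operator, since two self-adjoint operators with the same form domain and
  form are contained in each other's adjoint; so it suffices to show that the two form domains
  coincide. An elementary tensor of \<open>H\<^sup>1\<^sub>p\<^sub>e\<^sub>r\<close> functions is the limit of tensors of smooth periodic
  functions, because the \<open>L\<^sup>2\<close> norm of a tensor is the product of the \<open>L\<^sup>2\<close> norms and a derivative of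
  a tensor differentiates a single factor. Conversely, a smooth periodic function on the product is
  approximated in \<open>H\<^sup>1\<close> by its partial Fourier sums, and every exponential is an elementary tensor.
\<close>

subsection \<open>Smooth functions\<close>

text \<open>Stone-Weierstrass yields trigonometric polynomials uniformly close to a periodic
  function, but without control of derivatives. Passing to L2 repairs this: a partial Fourier sum is
  the best L2 approximation from the span of its waves, hence at least as good as such a polynomial,
  and integration by parts, free of boundary terms by periodicity, turns differentiation into
  multiplication of Fourier coefficients. A second obstacle is that \<open>weak_deriv\<close> is a
  choice, which respects sums and limits only up to null sets. Estimates are therefore made for
  explicit pairs of a function and its candidate derivatives, and the fundamental lemma of the
  calculus of variations leads back to \<open>H1_norm\<close>. That a tensor of
  \<open>H1_per\<close> functions has weak derivatives at all is not known in advance. It comes out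
  of the approximation by smooth tensors, because weak derivatives survive L2 limits.\<close>

definition has_partial :: "nat \<Rightarrow> nat \<Rightarrow> cfun \<Rightarrow> cfun \<Rightarrow> bool" where
  "has_partial m k v v' \<longleftrightarrow>
     (\<forall>x\<in>real_space m. ((\<lambda>t. v (x(k := t))) has_vector_derivative v' x) (at (x k)))"

lemma fun_upd_real_space: "x \<in> real_space m \<Longrightarrow> k < m \<Longrightarrow> x(k := t) \<in> real_space m"
  by (auto simp: PiE_iff extensional_def)

text \<open>Moving the base point to \<open>x(k := s)\<close> leaves the slice through it unchanged,
  so the definition gives the derivative along the whole line and not only at
  \<open>x k\<close>.\<close>

lemma has_partialD:
  assumes "has_partial m k v v'" "x \<in> real_space m" "k < m"
  shows "((\<lambda>t. v (x(k := t))) has_vector_derivative v' (x(k := s))) (at s)"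
proof -
  have "x(k := s) \<in> real_space m" using assms by (intro fun_upd_real_space)
  then show ?thesis using assms(1) unfolding has_partial_def by fastforce
qed

lemma has_partial_imp_partial_deriv:
  "has_partial m k v v' \<Longrightarrow> x \<in> real_space m \<Longrightarrow> partial_deriv k v x = v' x"
  unfolding has_partial_def partial_deriv_def by (auto intro: vector_derivative_at)

lemma has_partial_cong:
  assumes "\<And>x. x \<in> real_space m \<Longrightarrow> v x = w x" "k < m"
    and "\<And>x. x \<in> real_space m \<Longrightarrow> v' x = w' x"
  shows "has_partial m k v v' \<longleftrightarrow> has_partial m k w w'"
proof -
  have "(\<lambda>t. v (x(k := t))) = (\<lambda>t. w (x(k := t)))" if "x \<in> real_space m" for x
    using assms fun_upd_real_space[OF that] by blast
  then show ?thesis unfolding has_partial_def using assms(3) by simp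
qed

text \<open>Instead of following all iterated partials, it is enough to exhibit a set of continuous
  functions in which every member has its partials. The induction keeps only agreement on
  \<open>real_space m\<close>, since nothing is known about \<open>partial_deriv\<close>
  elsewhere.\<close>

lemma smooth_fun_coinduct:
  assumes u: "u \<in> S"
    and cont: "\<And>v. v \<in> S \<Longrightarrow> continuous_on (real_space m) v"
    and deriv: "\<And>v k. v \<in> S \<Longrightarrow> k < m \<Longrightarrow> \<exists>v'\<in>S. has_partial m k v v'"
  shows "smooth_fun m u"
proof -
  have *: "\<exists>v\<in>S. \<forall>x\<in>real_space m. iterated_partial ks u x = v x" if "ks \<in> lists {..<m}" for ks
    using that
  proof (induction ks)
    case (Cons k ks)
    then obtain v where v: "v \<in> S" "\<And>x. x \<in> real_space m \<Longrightarrow> iterated_partial ks u x = v x"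
      by auto
    have k: "k < m" using Cons by auto
    obtain v' where v': "v' \<in> S" "has_partial m k v v'" using deriv[OF v(1) k] by auto
    then have "has_partial m k (iterated_partial ks u) v'"
      using has_partial_cong[of m "iterated_partial ks u" v k v' v'] v(2) k by auto
    then show ?case using v' has_partial_imp_partial_deriv by auto
  qed (use u in auto)
  show ?thesis unfolding smooth_fun_def
  proof (intro ballI conjI allI impI)
    fix ks assume ks: "ks \<in> lists {..<m}"
    obtain v where v: "v \<in> S" "\<And>x. x \<in> real_space m \<Longrightarrow> iterated_partial ks u x = v x"
      using *[OF ks] by auto
    show "continuous_on (real_space m) (iterated_partial ks u)"
      using cont[OF v(1)] v(2) by (metis (no_types, lifting) continuous_on_cong)
    fix k x assume k: "k < m" and x: "x \<in> real_space m"
    obtain v' where "has_partial m k v v'" using deriv[OF v(1) k] by auto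
    then have "has_partial m k (iterated_partial ks u) v'"
      using has_partial_cong[of m "iterated_partial ks u" v k v' v'] v(2) k by auto
    then show "(\<lambda>t. iterated_partial ks u (x(k := t))) differentiable at (x k)"
      using x unfolding has_partial_def by (auto intro: differentiableI_vector)
  qed
qed

text \<open>The recursion peels derivatives off the outside, whereas smoothness of
  \<open>partial_deriv k u\<close> needs one split off at the inside.\<close>

lemma iterated_partial_snoc: "iterated_partial (ks @ [k]) u = iterated_partial ks (partial_deriv k u)"
  by (induction ks) auto

lemma smooth_fun_continuous: "smooth_fun m u \<Longrightarrow> continuous_on (real_space m) u"
  unfolding smooth_fun_def by (metis iterated_partial.simps(1) lists.Nil)

lemma smooth_fun_has_partial:
  assumes "smooth_fun m u" "k < m" shows "has_partial m k u (partial_deriv k u)"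
proof -
  have "\<forall>x\<in>real_space m. (\<lambda>t. u (x(k := t))) differentiable (at (x k))"
    using assms unfolding smooth_fun_def by (metis iterated_partial.simps(1) lists.Nil)
  then show ?thesis unfolding has_partial_def partial_deriv_def
    by (auto simp: vector_derivative_works)
qed

lemma smooth_fun_partial_deriv:
  assumes "smooth_fun m u" "k < m" shows "smooth_fun m (partial_deriv k u)"
proof -
  have "ks @ [k] \<in> lists {..<m}" if "ks \<in> lists {..<m}" for ks using that assms(2) by auto
  then show ?thesis using assms(1) unfolding smooth_fun_def
    by (metis iterated_partial_snoc)
qed

section \<open>Closure properties of smooth functions\<close>

lemma smooth_fun_const: "smooth_fun m (\<lambda>x. c)"
proof (rule smooth_fun_coinduct[where S = "range (\<lambda>c x. c)"])
  fix v :: cfun and k assume "v \<in> range (\<lambda>c x. c)"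
  then obtain c where "v = (\<lambda>x. c)" by blast
  then have "has_partial m k v (\<lambda>x. 0)" unfolding has_partial_def by simp
  then show "\<exists>v'\<in>range (\<lambda>c x. c). has_partial m k v v'" by (intro bexI[of _ "\<lambda>x. 0"]) auto
qed auto

lemma has_partial_add:
  "has_partial m k u u' \<Longrightarrow> has_partial m k v v' \<Longrightarrow> has_partial m k (\<lambda>x. u x + v x) (\<lambda>x. u' x + v' x)"
  unfolding has_partial_def by (auto intro!: derivative_intros)

lemma has_partial_mult:
  "has_partial m k u u' \<Longrightarrow> has_partial m k v v' \<Longrightarrow>
     has_partial m k (\<lambda>x. u x * v x) (\<lambda>x. u x * v' x + u' x * v x)"
  unfolding has_partial_def
  by (auto intro!: has_vector_derivative_eq_rhs[OF has_vector_derivative_mult])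

lemma has_partial_cmult:
  "has_partial m k u u' \<Longrightarrow> has_partial m k (\<lambda>x. c * u x) (\<lambda>x. c * u' x)"
  unfolding has_partial_def by (auto intro!: has_vector_derivative_mult_right)

lemma has_partial_cnj:
  "has_partial m k u u' \<Longrightarrow> has_partial m k (\<lambda>x. cnj (u x)) (\<lambda>x. cnj (u' x))"
  unfolding has_partial_def by (auto intro!: has_vector_derivative_cnj)

text \<open>The Leibniz rule leads from one product to a sum of two, so products alone are not
  closed under partials. Finite sums of products of two smooth functions are, and one coinduction
  then covers both sums and products.\<close>

inductive_set smooth_alg :: "nat \<Rightarrow> cfun set" for m where
  mult: "smooth_fun m u \<Longrightarrow> smooth_fun m v \<Longrightarrow> (\<lambda>x. u x * v x) \<in> smooth_alg m"
| add: "u \<in> smooth_alg m \<Longrightarrow> v \<in> smooth_alg m \<Longrightarrow> (\<lambda>x. u x + v x) \<in> smooth_alg m"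

lemma smooth_alg_smooth: assumes "u \<in> smooth_alg m" shows "smooth_fun m u"
  using assms
proof (rule smooth_fun_coinduct)
  show "continuous_on (real_space m) v" if "v \<in> smooth_alg m" for v
    using that by induction (auto intro!: continuous_intros dest: smooth_fun_continuous)
  show "\<exists>v'\<in>smooth_alg m. has_partial m k v v'" if "v \<in> smooth_alg m" "k < m" for v k
    using that(1)
  proof induction
    case (mult u v)
    have "has_partial m k (\<lambda>x. u x * v x) (\<lambda>x. u x * partial_deriv k v x + partial_deriv k u x * v x)"
      using mult that(2) by (intro has_partial_mult smooth_fun_has_partial)
    moreover have "(\<lambda>x. u x * partial_deriv k v x + partial_deriv k u x * v x) \<in> smooth_alg m"
      using mult that(2) by (intro smooth_alg.add smooth_alg.mult smooth_fun_partial_deriv)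
    ultimately show ?case by blast
  next
    case (add u v)
    then obtain u' v' where "u' \<in> smooth_alg m" "has_partial m k u u'"
      and "v' \<in> smooth_alg m" "has_partial m k v v'" by blast
    then show ?case
      by (intro bexI[of _ "\<lambda>x. u' x + v' x"] has_partial_add smooth_alg.add)
  qed
qed

lemma smooth_fun_mult: "smooth_fun m u \<Longrightarrow> smooth_fun m v \<Longrightarrow> smooth_fun m (\<lambda>x. u x * v x)"
  by (rule smooth_alg_smooth[OF smooth_alg.mult])

lemma smooth_fun_add:
  assumes "smooth_fun m u" "smooth_fun m v" shows "smooth_fun m (\<lambda>x. u x + v x)"
  \<comment> \<open>Each summand is written as a product with 1, because products are the generators
    of \<open>smooth_alg\<close>.\<close>
  using smooth_alg.add[OF smooth_alg.mult[OF smooth_fun_const[of m 1] assms(1)]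
      smooth_alg.mult[OF smooth_fun_const[of m 1] assms(2)]]
  by (auto dest: smooth_alg_smooth)

lemma smooth_fun_cmult: "smooth_fun m u \<Longrightarrow> smooth_fun m (\<lambda>x. c * u x)"
  by (intro smooth_fun_mult smooth_fun_const)

lemma smooth_fun_prod: "(\<And>i. i \<in> I \<Longrightarrow> smooth_fun m (u i)) \<Longrightarrow> smooth_fun m (\<lambda>x. \<Prod>i\<in>I. u i x)"
  by (induction I rule: infinite_finite_induct) (auto intro!: smooth_fun_const smooth_fun_mult)

text \<open>The family of all such pullbacks is closed under partials: a coordinate inside the block
  differentiates \<open>u\<close>, and one outside gives zero, the pullback of the constant
  0.\<close>

lemma smooth_fun_block:
  assumes "smooth_fun b u" "off + b \<le> m"
  shows "smooth_fun m (\<lambda>x. u (\<lambda>i\<in>{..<b}. x (off + i)))"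
proof (rule smooth_fun_coinduct[where S = "{\<lambda>x. u (\<lambda>i\<in>{..<b}. x (off + i)) |u. smooth_fun b u}"])
  show "(\<lambda>x. u (\<lambda>i\<in>{..<b}. x (off + i))) \<in> {\<lambda>x. u (\<lambda>i\<in>{..<b}. x (off + i)) |u. smooth_fun b u}"
    using assms by auto
next
  fix v assume "v \<in> {\<lambda>x. u (\<lambda>i\<in>{..<b}. x (off + i)) |u. smooth_fun b u}"
  then obtain u where u: "smooth_fun b u" and v: "v = (\<lambda>x. u (\<lambda>i\<in>{..<b}. x (off + i)))" by auto
  have c: "continuous_on (real_space m) (\<lambda>x. (\<lambda>i\<in>{..<b}. x (off + i)) :: point)"
  proof (rule continuous_on_coordinatewise_then_product)
    show "continuous_on (real_space m) (\<lambda>x. (\<lambda>i\<in>{..<b}. x (off + i)) i)" for i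
      using continuous_on_product_then_coordinatewise[OF continuous_on_id, of "real_space m" "off + i"]
      by (cases "i < b") auto
  qed
  show "continuous_on (real_space m) v" unfolding v
    by (rule continuous_on_compose2[OF smooth_fun_continuous[OF u] c]) auto
  fix k assume k: "k < m"
  show "\<exists>v'\<in>{\<lambda>x. u (\<lambda>i\<in>{..<b}. x (off + i)) |u. smooth_fun b u}. has_partial m k v v'"
  proof (cases "off \<le> k \<and> k < off + b")
    case True
    then have k': "k - off < b" by auto
    have "has_partial m k v (\<lambda>x. partial_deriv (k - off) u (\<lambda>i\<in>{..<b}. x (off + i)))"
      unfolding has_partial_def
    proof
      fix x assume x: "x \<in> real_space m"
      let ?y = "\<lambda>i\<in>{..<b}. x (off + i)"
      have "(\<lambda>t. v (x(k := t))) = (\<lambda>t. u (?y(k - off := t)))"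
        unfolding v using True by (intro ext arg_cong[of _ _ u]) (auto simp: fun_eq_iff)
      moreover have "x k = ?y (k - off)" using True by auto
      moreover have "?y \<in> real_space b" by auto
      then have "((\<lambda>t. u (?y(k - off := t))) has_vector_derivative partial_deriv (k - off) u ?y)
          (at (?y (k - off)))"
        using smooth_fun_has_partial[OF u k'] unfolding has_partial_def by blast
      ultimately show "((\<lambda>t. v (x(k := t))) has_vector_derivative partial_deriv (k - off) u ?y) (at (x k))"
        by (simp only:)
    qed
    then show ?thesis using smooth_fun_partial_deriv[OF u k'] by blast
  next
    case False
    have "has_partial m k v (\<lambda>x. 0)" unfolding has_partial_def
    proof
      fix x :: point
      have "(\<lambda>t. v (x(k := t))) = (\<lambda>t. v x)"
        unfolding v using False by (intro ext arg_cong[of _ _ u]) (auto simp: fun_eq_iff)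
      then show "((\<lambda>t. v (x(k := t))) has_vector_derivative 0) (at (x k))" by simp
    qed
    then show ?thesis using smooth_fun_const[of b 0] by (auto intro!: exI[of _ "\<lambda>x. 0"])
  qed
qed

subsection \<open>Integration over boxes\<close>

text \<open>The Borel sets of the full function space are those of the countable product, so
  measurability is checked coordinatewise; the coordinates from \<open>m\<close> on are constantly
  \<open>undefined\<close>.\<close>

lemma measurable_id_PiM_borel:
  "(\<lambda>x. x) \<in> measurable (\<Pi>\<^sub>M i\<in>{..<m}. lborel :: real measure) (borel :: point measure)"
proof -
  have "(\<lambda>x i. x i) \<in> measurable (\<Pi>\<^sub>M i\<in>{..<m}. lborel :: real measure) (\<Pi>\<^sub>M i\<in>UNIV. borel :: real measure)"
  proof (rule measurable_PiM_single')
    fix i :: nat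
    show "(\<lambda>x. x i) \<in> borel_measurable (\<Pi>\<^sub>M i\<in>{..<m}. lborel :: real measure)"
    proof (cases "i < m")
      case True
      then show ?thesis
        using measurable_component_singleton[of i "{..<m}" "\<lambda>_. lborel :: real measure"] by simp
    next
      case False
      then have "x i = undefined" if "x \<in> space (\<Pi>\<^sub>M i\<in>{..<m}. lborel :: real measure)" for x
        using that by (auto simp: space_PiM PiE_iff extensional_def)
      then show ?thesis using measurable_cong by (metis borel_measurable_const)
    qed
  qed (auto simp: space_PiM)
  then show ?thesis using measurable_cong_sets[OF refl sets_PiM_equal_borel] by blast
qed

lemma borel_measurable_continuous_real_space:
  fixes f :: "point \<Rightarrow> 'b::topological_space"
  assumes "continuous_on (real_space m) f"
  shows "f \<in> borel_measurable (\<Pi>\<^sub>M i\<in>{..<m}. lborel)"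
proof -
  have "(\<lambda>x. x) \<in> measurable (\<Pi>\<^sub>M i\<in>{..<m}. lborel) (restrict_space borel (real_space m))"
    by (rule measurable_restrict_space2[OF _ measurable_id_PiM_borel]) (auto simp: space_PiM)
  from measurable_compose[OF this borel_measurable_continuous_on_restrict[OF assms]]
  show ?thesis by simp
qed

text \<open>An extensional product is a full product whose factors from \<open>m\<close> on are the
  singleton of \<open>undefined\<close>; Tychonoff's theorem applies in that form.\<close>

lemma compact_PiE_interval: "compact (\<Pi>\<^sub>E i\<in>{..<m}. {c i..d i :: real})"
proof -
  have "(\<Pi>\<^sub>E i\<in>{..<m}. {c i..d i}) = (\<Pi>\<^sub>E i\<in>UNIV. if i < m then {c i..d i} else {undefined})"
    by (auto simp: PiE_def Pi_def extensional_def split: if_splits)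
  moreover have "compactin (product_topology (\<lambda>i. euclidean) UNIV)
      (\<Pi>\<^sub>E i\<in>UNIV. if i < m then {c i..d i} else {undefined})"
    by (subst compactin_PiE) auto
  ultimately show ?thesis by (simp add: euclidean_product_topology)
qed

abbreviation open_box :: "nat \<Rightarrow> (nat \<Rightarrow> real) \<Rightarrow> (nat \<Rightarrow> real) \<Rightarrow> point set" where
  "open_box m a b \<equiv> (\<Pi>\<^sub>E i\<in>{..<m}. {a i<..<b i})"

interpretation lborel_product: product_sigma_finite "\<lambda>_::nat. lborel :: real measure"
  by standard

lemma sets_open_box: "open_box m a b \<in> sets (\<Pi>\<^sub>M i\<in>{..<m}. lborel)"
  by (intro sets_PiM_I_finite) auto

lemma space_leb: "Q \<subseteq> real_space m \<Longrightarrow> space (leb m Q) = Q"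
  by (auto simp: leb_def space_restrict_space space_PiM)

lemma open_box_subset: "open_box m a b \<subseteq> real_space m" by auto

lemma space_leb_open_box [simp]: "space (leb m (open_box m a b)) = open_box m a b"
  by (intro space_leb open_box_subset)

lemma borel_measurable_leb:
  assumes "continuous_on (real_space m) (f :: point \<Rightarrow> 'b::topological_space)"
  shows "f \<in> borel_measurable (leb m Q)"
  unfolding leb_def
  by (intro measurable_restrict_space1 borel_measurable_continuous_real_space assms)

lemma finite_measure_leb: "finite_measure (leb m (open_box m a b))"
proof
  have "emeasure (leb m (open_box m a b)) (open_box m a b) =
      (\<Prod>i<m. emeasure lborel {a i<..<b i})"
    unfolding leb_def by (subst emeasure_restrict_space)
      (auto intro: sets.Int sets_open_box simp: lborel_product.emeasure_PiM)
  also have "\<dots> \<noteq> \<infinity>"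
    using emeasure_bounded_finite[of "{a i<..<b i}" for i] by (auto simp: ennreal_prod_eq_top less_top)
  finally show "emeasure (leb m (open_box m a b)) (space (leb m (open_box m a b))) \<noteq> \<infinity>"
    by simp
qed

lemma bounded_on_open_box:
  fixes f :: "point \<Rightarrow> 'b::real_normed_vector"
  assumes "continuous_on (real_space m) f"
  obtains C where "C > 0" "\<And>x. x \<in> open_box m a b \<Longrightarrow> norm (f x) \<le> C"
proof -
  have "compact (f ` (\<Pi>\<^sub>E i\<in>{..<m}. {a i..b i}))"
    by (intro compact_continuous_image compact_PiE_interval continuous_on_subset[OF assms]) auto
  then obtain C where C: "C > 0" "\<And>y. y \<in> f ` (\<Pi>\<^sub>E i\<in>{..<m}. {a i..b i}) \<Longrightarrow> norm y \<le> C"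
    using compact_imp_bounded bounded_pos by metis
  have "norm (f x) \<le> C" if "x \<in> open_box m a b" for x
  proof -
    have "x \<in> (\<Pi>\<^sub>E i\<in>{..<m}. {a i..b i})"
      using that by (force simp: PiE_iff)
    then show ?thesis using C(2) by blast
  qed
  with C(1) that show thesis by blast
qed

lemma integrable_leb_bounded:
  fixes f :: "point \<Rightarrow> 'b::{banach, second_countable_topology}"
  assumes "f \<in> borel_measurable (leb m (open_box m a b))"
    and "\<And>x. x \<in> open_box m a b \<Longrightarrow> norm (f x) \<le> C"
  shows "integrable (leb m (open_box m a b)) f"
  using assms by (intro finite_measure.integrable_const_bound[OF finite_measure_leb, where B = C]) auto

lemma integrable_leb_continuous:
  fixes f :: "point \<Rightarrow> 'b::{banach, second_countable_topology}"
  assumes "continuous_on (real_space m) f"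
  shows "integrable (leb m (open_box m a b)) f"
  using bounded_on_open_box[OF assms, of a b] integrable_leb_bounded[OF borel_measurable_leb[OF assms]]
  by metis

lemma continuous_on_slice:
  assumes "continuous_on (real_space m) f" "k < m" "x \<in> real_space m"
  shows "continuous_on S (\<lambda>t. f (x(k := t)))"
proof (rule continuous_on_compose2[OF assms(1)])
  show "continuous_on S (\<lambda>t. x(k := t))"
  proof (rule continuous_on_coordinatewise_then_product)
    show "continuous_on S (\<lambda>t. (x(k := t)) i)" for i
      by (cases "i = k") (auto intro: continuous_intros)
  qed
qed (use assms fun_upd_real_space in auto)

text \<open>Fubini and the fundamental theorem of calculus in the \<open>k\<close>-th coordinate.\<close>

lemma integral_partial_eq_0:
  assumes k: "k < m" and ab: "a k \<le> b k"
    and cont: "continuous_on (real_space m) v'"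
    and deriv: "has_partial m k v v'"
    and faces: "\<And>x. x \<in> real_space m \<Longrightarrow> v (x(k := a k)) = v (x(k := b k))"
  shows "(\<integral>x. v' x \<partial>leb m (open_box m a b)) = 0"
proof -
  let ?Q = "open_box m a b" and ?I = "{..<m} - {k}"
  let ?f = "\<lambda>x. indicator ?Q x *\<^sub>R v' x"
  have Q: "?Q \<inter> space (\<Pi>\<^sub>M i\<in>{..<m}. lborel) \<in> sets (\<Pi>\<^sub>M i\<in>{..<m}. lborel :: real measure)"
    by (intro sets.Int sets_open_box) auto
  have ins: "insert k ?I = {..<m}" using k by auto
  have int: "integrable (\<Pi>\<^sub>M i\<in>insert k ?I. lborel) ?f"
    using integrable_leb_continuous[OF cont, of a b] unfolding leb_def ins
    by (subst (asm) integrable_restrict_space[OF Q])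
  have "(\<integral>x. v' x \<partial>leb m ?Q) = (\<integral>x. ?f x \<partial>(\<Pi>\<^sub>M i\<in>insert k ?I. lborel))"
    unfolding leb_def ins by (rule integral_restrict_space[OF Q])
  also have "\<dots> = (\<integral>x. (\<integral>t. ?f (x(k := t)) \<partial>lborel) \<partial>(\<Pi>\<^sub>M i\<in>?I. lborel))"
    by (rule lborel_product.product_integral_insert[OF _ _ int]) auto
  also have "\<dots> = (\<integral>x. 0 \<partial>(\<Pi>\<^sub>M i\<in>?I. lborel :: real measure))"
  proof (rule Bochner_Integration.integral_cong[OF refl])
    fix x :: point assume x: "x \<in> space (\<Pi>\<^sub>M i\<in>?I. lborel :: real measure)"
    then have x': "x(k := 0) \<in> real_space m"
      using k by (auto simp: space_PiM PiE_iff extensional_def)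
    have eq: "x(k := t) = (x(k := 0))(k := t)" for t by simp
    show "(\<integral>t. ?f (x(k := t)) \<partial>lborel) = 0"
    proof (cases "\<forall>i\<in>?I. x i \<in> {a i<..<b i}")
      case True
      have ind: "indicator ?Q (x(k := t)) = (indicator {a k<..<b k} t :: real)" for t
        using True x k by (auto simp: indicator_def space_PiM PiE_iff extensional_def)
      have "(\<integral>t. ?f (x(k := t)) \<partial>lborel) = (\<integral>t. indicator {a k<..<b k} t *\<^sub>R v' (x(k := t)) \<partial>lborel)"
        by (simp add: ind)
      \<comment> \<open>The fundamental theorem of calculus is stated for the closed interval, and
        the two endpoints are null sets.\<close>
      also have "\<dots> = (\<integral>t. indicator {a k..b k} t *\<^sub>R v' (x(k := t)) \<partial>lborel)"
      proof (rule integral_cong_AE)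
        have c: "continuous_on UNIV (\<lambda>t. v' (x(k := t)))"
          using continuous_on_slice[OF cont k x'] by simp
        then have [measurable]: "(\<lambda>t. v' (x(k := t))) \<in> borel_measurable borel"
          by (rule borel_measurable_continuous_onI)
        show "(\<lambda>t. indicator {a k<..<b k} t *\<^sub>R v' (x(k := t))) \<in> borel_measurable lborel"
          "(\<lambda>t. indicator {a k..b k} t *\<^sub>R v' (x(k := t))) \<in> borel_measurable lborel"
          by measurable
        have "AE t in lborel. t \<noteq> a k" "AE t in lborel. t \<noteq> b k" by (rule AE_lborel_singleton)+
        then show "AE t in lborel. indicator {a k<..<b k} t *\<^sub>R v' (x(k := t)) =
            indicator {a k..b k} t *\<^sub>R v' (x(k := t))"
          by eventually_elim (auto simp: indicator_def)
      qed
      also have "\<dots> = v (x(k := b k)) - v (x(k := a k))"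
      proof (rule integral_FTC_Icc[OF ab])
        show "((\<lambda>t. v (x(k := t))) has_vector_derivative v' (x(k := t))) (at t within {a k..b k})" for t
          using has_partialD[OF deriv x' k, of t] by (auto intro: has_vector_derivative_at_within)
        show "continuous_on {a k..b k} (\<lambda>t. v' (x(k := t)))"
          using continuous_on_slice[OF cont k x'] by simp
      qed
      also have "\<dots> = 0" using faces[OF x'] by simp
      finally show ?thesis .
    next
      case False
      then have "x(k := t) \<notin> ?Q" for t by (auto simp: PiE_iff)
      then show ?thesis by simp
    qed
  qed
  finally show ?thesis by simp
qed

subsection \<open>Bump functions and the fundamental lemma of the calculus of variations\<close>

text \<open>The polynomial factor makes the family closed under differentiation: with s = 1 / t, the
  derivative of p(s) exp(-s) with respect to t is s^2 (p(s) - p'(s)) exp(-s).\<close>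

definition bump :: "real poly \<Rightarrow> real \<Rightarrow> real" where
  "bump p t = (if t > 0 then poly p (1 / t) * exp (- (1 / t)) else 0)"

lemma tendsto_poly_mult_exp_neg: "((\<lambda>s. poly p s * exp (- s)) \<longlongrightarrow> (0::real)) at_top"
proof -
  have "((\<lambda>s::real. \<Sum>i\<le>degree p. coeff p i * (s ^ i / exp s)) \<longlongrightarrow> (\<Sum>i\<le>degree p. coeff p i * 0)) at_top"
    by (intro tendsto_intros tendsto_power_div_exp_0)
  then show ?thesis
    by (simp add: poly_altdef exp_minus sum_distrib_left divide_inverse ac_simps)
qed

lemma bump_has_derivative:
  "(bump p has_real_derivative bump ([:0, 0, 1:] * (p - pderiv p)) t) (at t)"
proof -
  let ?q = "[:0, 0, 1:] * (p - pderiv p)"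
  consider "t > 0" | "t < 0" | "t = 0" by linarith
  then show ?thesis
  proof cases
    case 1
    have D: "((\<lambda>t. poly p (1 / t) * exp (- (1 / t))) has_real_derivative bump ?q t) (at t)"
    proof -
      have d: "((\<lambda>t. 1 / t) has_real_derivative - (1 / t\<^sup>2)) (at t)"
        using 1 by (auto intro!: derivative_eq_intros simp: power2_eq_square)
      have e: "((\<lambda>t. exp (- (1 / t))) has_real_derivative exp (- (1 / t)) * (1 / t\<^sup>2)) (at t)"
        using DERIV_fun_exp[OF DERIV_minus[OF d]] by simp
      have "((\<lambda>t. poly p (1 / t) * exp (- (1 / t))) has_real_derivative
          (poly (pderiv p) (1 / t) * - (1 / t\<^sup>2)) * exp (- (1 / t)) +
          (exp (- (1 / t)) * (1 / t\<^sup>2)) * poly p (1 / t)) (at t)"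
        by (rule DERIV_mult[OF DERIV_chain2[OF poly_DERIV d] e])
      moreover have "(poly (pderiv p) (1 / t) * - (1 / t\<^sup>2)) * exp (- (1 / t)) +
          (exp (- (1 / t)) * (1 / t\<^sup>2)) * poly p (1 / t) = bump ?q t"
        using 1 by (simp add: bump_def algebra_simps power2_eq_square)
      ultimately show ?thesis by simp
    qed
    have "eventually (\<lambda>s. s > 0) (nhds t)" using 1 by (rule order_tendstoD[OF filterlim_ident])
    then have "eventually (\<lambda>s. bump p s = poly p (1 / s) * exp (- (1 / s))) (nhds t)"
      by eventually_elim (auto simp: bump_def)
    from DERIV_cong_ev[OF refl this refl] D show ?thesis by blast
  next
    case 2
    then have "eventually (\<lambda>s. s < 0) (nhds t)" by (rule order_tendstoD[OF filterlim_ident])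
    then have "eventually (\<lambda>s. bump p s = 0) (nhds t)"
      by eventually_elim (auto simp: bump_def)
    from DERIV_cong_ev[OF refl this refl] have "(bump p has_real_derivative 0) (at t)" by simp
    then show ?thesis using 2 by (simp add: bump_def)
  next
    case 3
    \<comment> \<open>From the right, the difference quotient at 0 is s p(s) exp(-s) with s = 1 / h,
      and \<open>pCons 0 p\<close> is the polynomial s p(s). The exponential wins as s tends to
      infinity.\<close>
    have "((\<lambda>h. bump p h / h) \<longlongrightarrow> 0) (at_right 0)"
    proof -
      have "((\<lambda>h. poly (pCons 0 p) (inverse h) * exp (- inverse h)) \<longlongrightarrow> (0::real)) (at_right 0)"
        by (rule filterlim_compose[OF tendsto_poly_mult_exp_neg filterlim_inverse_at_top_right])
      moreover have "eventually (\<lambda>h::real. h > 0) (at_right 0)" by (rule eventually_at_right_less)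
      then have "eventually (\<lambda>h. poly (pCons 0 p) (inverse h) * exp (- inverse h) = bump p h / h) (at_right 0)"
        by eventually_elim (auto simp: bump_def field_simps)
      ultimately show ?thesis by (simp cong: filterlim_cong)
    qed
    moreover have "((\<lambda>h. bump p h / h) \<longlongrightarrow> 0) (at_left 0)"
    proof -
      have "eventually (\<lambda>h::real. h < 0) (at_left 0)"
        by (simp add: eventually_at_filter)
      then have "eventually (\<lambda>h. 0 = bump p h / h) (at_left 0)"
        by eventually_elim (auto simp: bump_def)
      from tendsto_cong[OF this, of 0] show ?thesis by simp
    qed
    ultimately have "((\<lambda>h. bump p h / h) \<longlongrightarrow> 0) (at 0)" by (simp add: filterlim_split_at)
    then show ?thesis using 3 by (simp add: DERIV_def bump_def)
  qed
qed

text \<open>The scalar \<open>c\<close> in the invariant absorbs the factor \<alpha> from the chain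
  rule, and takes the value 0 for derivatives in coordinates other than \<open>i\<close>.\<close>

lemma smooth_fun_bump:
  assumes "i < m" shows "smooth_fun m (\<lambda>x. of_real (bump p (\<alpha> * x i + \<beta>)))"
proof (rule smooth_fun_coinduct[where S = "{\<lambda>x. of_real (c * bump p (\<alpha> * x i + \<beta>)) |c p. True}"])
  show "(\<lambda>x. of_real (bump p (\<alpha> * x i + \<beta>))) \<in> {\<lambda>x. of_real (c * bump p (\<alpha> * x i + \<beta>)) |c p. True}"
    by (intro CollectI exI[of _ 1] exI[of _ p]) auto
next
  fix v :: cfun and k
  assume "v \<in> {\<lambda>x. of_real (c * bump p (\<alpha> * x i + \<beta>)) |c p. True}"
  then obtain c p where v: "v = (\<lambda>x. of_real (c * bump p (\<alpha> * x i + \<beta>)))" by auto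
  have "continuous_on UNIV (bump p)"
    using bump_has_derivative by (intro continuous_at_imp_continuous_on ballI DERIV_isCont)
  moreover have "continuous_on (real_space m) (\<lambda>x. x i)"
    using continuous_on_product_then_coordinatewise[OF continuous_on_id] .
  ultimately show "continuous_on (real_space m) v" unfolding v
    by (intro continuous_intros) (auto intro!: continuous_intros elim: continuous_on_compose2)
  define w where "w = (\<lambda>x::point. complex_of_real
    ((if k = i then c * \<alpha> else 0) * bump ([:0, 0, 1:] * (p - pderiv p)) (\<alpha> * x i + \<beta>)))"
  have "has_partial m k v w" unfolding has_partial_def
  proof
    fix x :: point
    show "((\<lambda>t. v (x(k := t))) has_vector_derivative w x) (at (x k))"
    proof (cases "k = i")
      case True
      have "((\<lambda>t. c * bump p (\<alpha> * t + \<beta>)) has_real_derivative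
          (c * \<alpha>) * bump ([:0, 0, 1:] * (p - pderiv p)) (\<alpha> * x i + \<beta>)) (at (x k))"
        using True by (auto intro!: derivative_eq_intros DERIV_chain2[OF bump_has_derivative])
      then show ?thesis using True unfolding v w_def
        by (auto dest: bounded_linear.has_vector_derivative[OF bounded_linear_of_real]
            simp: has_real_derivative_iff_has_vector_derivative simp del: of_real_mult mult_pCons_left)
    qed (simp add: v w_def)
  qed
  moreover have "w \<in> {\<lambda>x. of_real (c * bump p (\<alpha> * x i + \<beta>)) |c p. True}"
    unfolding w_def by blast
  ultimately show "\<exists>w\<in>{\<lambda>x. of_real (c * bump p (\<alpha> * x i + \<beta>)) |c p. True}. has_partial m k v w" by blast
qed

text \<open>Subtracting 1 makes the \<open>i\<close>-th factor vanish unless \<open>x i\<close> lies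
  more than 1 / (N + 1) inside both ends of its interval, which gives a compact support. Inside the
  box the arguments tend to infinity with N, so the product tends to the indicator.\<close>

definition box_bump :: "nat \<Rightarrow> (nat \<Rightarrow> real) \<Rightarrow> (nat \<Rightarrow> real) \<Rightarrow> nat \<Rightarrow> point \<Rightarrow> real" where
  "box_bump m c d N x =
     (\<Prod>i<m. bump 1 (real (Suc N) * (x i - c i) - 1) * bump 1 (real (Suc N) * (d i - x i) - 1))"

lemma bump_bounds: "0 \<le> bump 1 t" "bump 1 t \<le> 1" by (auto simp: bump_def)

lemma box_bump_bounds: "0 \<le> box_bump m c d N x" "box_bump m c d N x \<le> 1"
  unfolding box_bump_def
  by (auto intro!: prod_nonneg prod_le_1 mult_nonneg_nonneg mult_le_one bump_bounds)

text \<open>For s > 0 the argument r tends to infinity and exp(-1 / r) tends to 1; for s \<le> 0 it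
  stays at most -1, where the bump is 0.\<close>

lemma bump_tendsto_indicator:
  "(\<lambda>N. bump 1 (real (Suc N) * s - 1)) \<longlonglongrightarrow> (if s > 0 then 1 else 0)"
proof (cases "s > 0")
  case True
  have "LIM N sequentially. real (Suc N) :> at_top"
    by (rule filterlim_compose[OF filterlim_real_sequentially filterlim_Suc])
  then have l: "LIM N sequentially. real (Suc N) * s + (- 1) :> at_top"
    using filterlim_tendsto_add_at_top[OF tendsto_const filterlim_at_top_mult_tendsto_pos[OF tendsto_const True], of _ _ "- 1"]
    by (simp add: add.commute)
  have "(\<lambda>N. exp (- inverse (real (Suc N) * s + (- 1)))) \<longlonglongrightarrow> exp (- 0)"
    by (intro tendsto_intros tendsto_inverse_0_at_top l)
  moreover have "eventually (\<lambda>N. real (Suc N) * s + (- 1) > 0) sequentially"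
    using l unfolding filterlim_at_top_dense by blast
  then have "eventually (\<lambda>N. exp (- inverse (real (Suc N) * s + (- 1))) = bump 1 (real (Suc N) * s - 1)) sequentially"
    by eventually_elim (auto simp: bump_def field_simps)
  ultimately show ?thesis using True tendsto_cong by fastforce
next
  case False
  then have "real (Suc N) * s \<le> 0" for N by (intro mult_nonneg_nonpos) auto
  then have "bump 1 (real (Suc N) * s - 1) = 0" for N unfolding bump_def by (smt (verit))
  then show ?thesis using False by simp
qed

lemma box_bump_tendsto:
  assumes "x \<in> real_space m"
  shows "(\<lambda>N. box_bump m c d N x) \<longlonglongrightarrow> indicator (open_box m c d) x"
proof -
  have "(\<lambda>N. box_bump m c d N x) \<longlonglongrightarrow>
      (\<Prod>i<m. (if x i - c i > 0 then 1 else 0) * (if d i - x i > 0 then 1 else 0))"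
    unfolding box_bump_def by (intro tendsto_intros bump_tendsto_indicator)
  also have "(\<Prod>i<m. (if x i - c i > 0 then 1 else 0) * (if d i - x i > 0 then 1 else 0 :: real)) =
      indicator (open_box m c d) x"
    using assms by (auto simp: indicator_def PiE_iff intro!: prod.neutral prod_zero)
  finally show ?thesis .
qed

lemma test_fun_box_bump:
  assumes "\<And>i. i < m \<Longrightarrow> a i \<le> c i \<and> d i \<le> b i"
  shows "test_fun m (open_box m a b) (\<lambda>x. of_real (box_bump m c d N x))"
  unfolding test_fun_def
proof
  have "smooth_fun m (\<lambda>x. \<Prod>i<m. of_real (bump 1 (real (Suc N) * x i + (- real (Suc N) * c i - 1))) *
      of_real (bump 1 (- real (Suc N) * x i + (real (Suc N) * d i - 1))))"
    by (intro smooth_fun_prod smooth_fun_mult smooth_fun_bump) auto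
  then show "smooth_fun m (\<lambda>x. of_real (box_bump m c d N x))"
    by (simp add: box_bump_def algebra_simps)
  \<comment> \<open>The closed box shrunk by 1 / (N + 1) on every side; it may be empty.\<close>
  let ?K = "\<Pi>\<^sub>E i\<in>{..<m}. {c i + 1 / real (Suc N)..d i - 1 / real (Suc N)}"
  have "?K \<subseteq> open_box m a b"
  proof (rule PiE_mono)
    fix i assume "i \<in> {..<m}"
    then have "a i \<le> c i" "d i \<le> b i" using assms by auto
    moreover have "0 < 1 / real (Suc N)" by simp
    ultimately show "{c i + 1 / real (Suc N)..d i - 1 / real (Suc N)} \<subseteq> {a i<..<b i}"
      by (intro subsetI) (simp only: atLeastAtMost_iff greaterThanLessThan_iff, linarith)
  qed
  moreover have "box_bump m c d N x = 0" if x: "x \<in> real_space m - ?K" for x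
  proof -
    obtain i where i: "i < m" "x i < c i + 1 / real (Suc N) \<or> x i > d i - 1 / real (Suc N)"
      using x by (force simp: PiE_iff)
    have "real (Suc N) * (x i - c i) - 1 \<le> 0 \<or> real (Suc N) * (d i - x i) - 1 \<le> 0"
      using i(2) by (auto simp: field_simps simp del: of_nat_Suc)
    then have "bump 1 (real (Suc N) * (x i - c i) - 1) * bump 1 (real (Suc N) * (d i - x i) - 1) = 0"
      by (auto simp: bump_def)
    then show ?thesis using i(1) unfolding box_bump_def by (intro prod_zero) auto
  qed
  ultimately show "\<exists>K. compact K \<and> K \<subseteq> open_box m a b \<and>
      (\<forall>x\<in>real_space m - K. complex_of_real (box_bump m c d N x) = 0)"
    by (intro exI[of _ ?K]) (auto simp: compact_PiE_interval)
qed

text \<open>Since \<open>ennreal\<close> truncates at 0, \<open>ennreal (R x)\<close> and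
  \<open>ennreal (- R x)\<close> are the positive and negative parts of R. As densities they define
  two measures that agree on open boxes, an intersection-stable generator. Hence the measures
  coincide, and so do the densities almost everywhere.\<close>

lemma AE_eq_0_if_box_integrals_eq_0:
  fixes R :: "point \<Rightarrow> real" and m :: nat
  defines "P \<equiv> (\<Pi>\<^sub>M i\<in>{..<m}. lborel)"
  assumes int: "integrable P R"
    and zero: "\<And>c d. (\<integral>x. R x * indicator (open_box m c d) x \<partial>P) = 0"
  shows "AE x in P. R x = 0"
proof -
  have [measurable]: "R \<in> borel_measurable P" using int by auto
  let ?E = "range (\<lambda>(c, d). {c<..<d :: real})"
  let ?B = "{Pi\<^sub>E {..<m} F |F. \<forall>i\<in>{..<m}. F i \<in> ?E}"
  have box: "\<exists>c d. X = open_box m c d" if "X \<in> ?B" for X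
  proof -
    obtain F where F: "X = Pi\<^sub>E {..<m} F" "\<forall>i\<in>{..<m}. F i \<in> ?E" using \<open>X \<in> ?B\<close> by auto
    have "\<exists>cd. F i = {fst cd<..<snd cd}" if "i < m" for i
    proof -
      have "F i \<in> range (\<lambda>cd. {fst cd<..<snd cd})" using F(2) that by (auto simp: split_beta)
      then show ?thesis by auto
    qed
    then have "\<forall>i. \<exists>cd. i < m \<longrightarrow> F i = {fst cd<..<snd cd}" by blast
    from choice[OF this] obtain cd where "\<And>i. i < m \<Longrightarrow> F i = {fst (cd i)<..<snd (cd i)}" by blast
    then have "X = open_box m (\<lambda>i. fst (cd i)) (\<lambda>i. snd (cd i))"
      unfolding F(1) by (intro PiE_cong) auto
    then show ?thesis by (intro exI)
  qed
  have box': "open_box m c d \<in> ?B" for c d by auto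
  have gen: "sets P = sigma_sets (space P) ?B"
  proof -
    let ?P = "{{f\<in>(\<Pi>\<^sub>E i\<in>{..<m}. UNIV). \<forall>i\<in>j. f i \<in> A i} | A j. j \<in> {{..<m}} \<and> A \<in> Pi j (\<lambda>_. ?E)}"
    have eq: "?P = ?B"
    proof -
      have "{f\<in>(\<Pi>\<^sub>E i\<in>{..<m}. UNIV). \<forall>i\<in>{..<m}. f i \<in> A i} = Pi\<^sub>E {..<m} A" for A :: "nat \<Rightarrow> real set"
        by (rule set_eqI) (simp only: mem_Collect_eq PiE_iff UNIV_I, blast)
      then have "?P = {Pi\<^sub>E {..<m} A |A. A \<in> Pi {..<m} (\<lambda>_. ?E)}" by simp
      then show ?thesis by (simp only: Pi_iff)
    qed
    \<comment> \<open>\<open>sets_PiM_sigma\<close> requires every factor to be covered by countably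
      many generating intervals.\<close>
    have cover: "\<exists>S\<subseteq>?E. countable S \<and> UNIV = \<Union>S"
    proof (intro exI conjI)
      have "\<exists>n. x \<in> {- real n<..<real n}" for x
        using reals_Archimedean2[of "\<bar>x\<bar>"] by (simp add: abs_less_iff) (metis minus_less_iff)
      then show "UNIV = (\<Union>n. {- real n<..<real n})" by auto
    qed auto
    have "sets P = sets (\<Pi>\<^sub>M i\<in>{..<m}. sigma UNIV ?E)"
      unfolding P_def by (rule sets_PiM_cong) (simp_all add: borel_eq_box box_real)
    also have "\<dots> = sets (sigma (\<Pi>\<^sub>E i\<in>{..<m}. UNIV) ?P)"
      by (rule sets_PiM_sigma) (use cover in auto)
    also have "\<dots> = sigma_sets (space P) ?B"
      unfolding eq P_def space_PiM by (subst sets_measure_of) auto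
    finally show ?thesis .
  qed
  \<comment> \<open>Finiteness allows equality to be lifted from \<open>enn2real\<close> back to
    \<open>ennreal\<close>, and makes the exhausting boxes and the total mass finite, as the two
    uniqueness results demand.\<close>
  have fin: "(\<integral>\<^sup>+x. ennreal (R x) * indicator A x \<partial>P) < \<infinity>" "(\<integral>\<^sup>+x. ennreal (- R x) * indicator A x \<partial>P) < \<infinity>"
    if [measurable]: "A \<in> sets P" for A
  proof -
    have "(\<integral>\<^sup>+x. ennreal (R x) * indicator A x \<partial>P) \<le> (\<integral>\<^sup>+x. norm (R x) \<partial>P)"
      "(\<integral>\<^sup>+x. ennreal (- R x) * indicator A x \<partial>P) \<le> (\<integral>\<^sup>+x. norm (R x) \<partial>P)"
      by (auto intro!: nn_integral_mono ennreal_leI split: split_indicator)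
    moreover have "(\<integral>\<^sup>+x. norm (R x) \<partial>P) < \<infinity>" using int unfolding integrable_iff_bounded by auto
    ultimately show "(\<integral>\<^sup>+x. ennreal (R x) * indicator A x \<partial>P) < \<infinity>"
        "(\<integral>\<^sup>+x. ennreal (- R x) * indicator A x \<partial>P) < \<infinity>" by auto
  qed
  have sp: "space P \<in> sets P" by simp
  have "density P (\<lambda>x. ennreal (R x)) = density P (\<lambda>x. ennreal (- R x))"
  proof (rule measure_eqI_generator_eq[where E = ?B and \<Omega> = "space P"
        and A = "\<lambda>n. open_box m (\<lambda>_. - real n) (\<lambda>_. real n)"])
    show "Int_stable ?B"
    proof (rule Int_stableI)
      fix X Y assume "X \<in> ?B" "Y \<in> ?B"
      then obtain c d c' d' where "X = open_box m c d" "Y = open_box m c' d'"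
        using box[OF \<open>X \<in> ?B\<close>] box[OF \<open>Y \<in> ?B\<close>] by (elim exE)
      then have "X \<inter> Y = open_box m (\<lambda>i. max (c i) (c' i)) (\<lambda>i. min (d i) (d' i))"
        by (simp only: PiE_Int Int_greaterThanLessThan)
      then show "X \<inter> Y \<in> ?B" using box' by simp
    qed
    show "?B \<subseteq> Pow (space P)"
      using box open_box_subset unfolding P_def space_PiM by fastforce
    show "emeasure (density P (\<lambda>x. ennreal (R x))) X = emeasure (density P (\<lambda>x. ennreal (- R x))) X"
      if X: "X \<in> ?B" for X
    proof -
      obtain c d where X: "X = open_box m c d" using box[OF X] by auto
      have [measurable]: "X \<in> sets P" unfolding X P_def by (rule sets_open_box)
      have *: "(\<integral>\<^sup>+x. ennreal (s * R x) * indicator X x \<partial>P) = (\<integral>\<^sup>+x. ennreal (s * (R x * indicator X x)) \<partial>P)" for s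
        by (intro nn_integral_cong) (auto split: split_indicator)
      have "integrable P (\<lambda>x. R x * indicator X x)"
        using integrable_mult_indicator[OF _ int, of X] by (simp add: mult.commute)
      from real_lebesgue_integral_def[OF this] zero[of c d]
      have "enn2real (\<integral>\<^sup>+x. ennreal (R x * indicator X x) \<partial>P) = enn2real (\<integral>\<^sup>+x. ennreal (- (R x * indicator X x)) \<partial>P)"
        by (simp add: X)
      then have "enn2real (\<integral>\<^sup>+x. ennreal (R x) * indicator X x \<partial>P) = enn2real (\<integral>\<^sup>+x. ennreal (- R x) * indicator X x \<partial>P)"
        using *[of 1] *[of "- 1"] by simp
      then have "(\<integral>\<^sup>+x. ennreal (R x) * indicator X x \<partial>P) = (\<integral>\<^sup>+x. ennreal (- R x) * indicator X x \<partial>P)"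
        using fin[of X] by (metis \<open>X \<in> sets P\<close> ennreal_enn2real infinity_ennreal_def)
      then show ?thesis by (simp add: emeasure_density)
    qed
    show "sets (density P (\<lambda>x. ennreal (R x))) = sigma_sets (space P) ?B" using gen by simp
    show "sets (density P (\<lambda>x. ennreal (- R x))) = sigma_sets (space P) ?B" using gen by simp
    show "range (\<lambda>n. open_box m (\<lambda>_. - real n) (\<lambda>_. real n)) \<subseteq> ?B" using box' by auto
    show "(\<Union>n. open_box m (\<lambda>_. - real n) (\<lambda>_. real n)) = space P"
    proof
      show "space P \<subseteq> (\<Union>n. open_box m (\<lambda>_. - real n) (\<lambda>_. real n))"
      proof
        fix x assume x: "x \<in> space P"
        \<comment> \<open>Bounding the sum bounds all coordinates at once, also when m = 0.\<close>
        obtain n where n: "(\<Sum>i<m. \<bar>x i\<bar>) < real n" using reals_Archimedean2 by auto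
        have "\<bar>x i\<bar> < real n" if "i < m" for i
        proof -
          have "\<bar>x i\<bar> \<le> (\<Sum>i<m. \<bar>x i\<bar>)" using that by (intro member_le_sum) auto
          with n show ?thesis by linarith
        qed
        then have "- real n < x i \<and> x i < real n" if "i < m" for i
          using that by (simp add: abs_less_iff) (metis minus_less_iff)
        then have "x \<in> open_box m (\<lambda>_. - real n) (\<lambda>_. real n)"
          using x unfolding P_def space_PiM PiE_iff by simp
        then show "x \<in> (\<Union>n. open_box m (\<lambda>_. - real n) (\<lambda>_. real n))" by blast
      qed
    qed (auto simp: P_def space_PiM)
    show "emeasure (density P (\<lambda>x. ennreal (R x))) (open_box m (\<lambda>_. - real n) (\<lambda>_. real n)) \<noteq> \<infinity>" for n
    proof -
      have S: "open_box m (\<lambda>_. - real n) (\<lambda>_. real n) \<in> sets P" unfolding P_def by (rule sets_open_box)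
      then show ?thesis using fin(1)[OF S] by (simp add: emeasure_density less_top)
    qed
  qed
  moreover have "integral\<^sup>N P (\<lambda>x. ennreal (R x)) \<noteq> \<infinity>"
  proof -
    have "integral\<^sup>N P (\<lambda>x. ennreal (R x)) = (\<integral>\<^sup>+x. ennreal (R x) * indicator (space P) x \<partial>P)"
      by (intro nn_integral_cong) simp
    then show ?thesis using fin(1)[OF sp] by simp
  qed
  ultimately have "AE x in P. ennreal (R x) = ennreal (- R x)"
    using finite_density_unique[of "\<lambda>x. ennreal (R x)" P "\<lambda>x. ennreal (- R x)"] by simp
  then show ?thesis
    proof eventually_elim
    case (elim x)
    then show ?case by (cases "R x \<ge> 0") (simp_all add: ennreal_neg)
  qed
qed

lemma borel_measurable_indicator_open_box:
  "(\<lambda>x. indicator (open_box m c d) x :: real) \<in> borel_measurable (leb m Q)"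
  unfolding leb_def by (intro measurable_restrict_space1 borel_measurable_indicator sets_open_box)

text \<open>The functions \<open>box_bump\<close> are test functions with values in [0, 1], so
  dominated convergence with majorant |h| turns the hypothesis into vanishing integrals over boxes
  inside Q. An arbitrary box is cut down to Q, and the real and imaginary parts of \<open>h\<close>
  are treated separately.\<close>

lemma AE_eq_0_if_test_integrals_eq_0:
  assumes int: "integrable (leb m (open_box m a b)) h"
    and zero: "\<And>\<phi>. test_fun m (open_box m a b) \<phi> \<Longrightarrow> (\<integral>x. h x * \<phi> x \<partial>leb m (open_box m a b)) = 0"
  shows "AE x in leb m (open_box m a b). h x = 0"
proof -
  let ?Q = "open_box m a b" and ?P = "\<Pi>\<^sub>M i\<in>{..<m}. lborel :: real measure"
  have Q: "?Q \<inter> space ?P \<in> sets ?P" by (intro sets.Int sets_open_box) auto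
  have [measurable]: "h \<in> borel_measurable (leb m ?Q)" using int by auto
  have sub: "(\<integral>x. h x * of_real (indicator (open_box m c d) x) \<partial>leb m ?Q) = 0"
    if "\<And>i. i < m \<Longrightarrow> a i \<le> c i \<and> d i \<le> b i" for c d
  proof -
    have [measurable]: "(\<lambda>x. complex_of_real (box_bump m c d N x)) \<in> borel_measurable (leb m ?Q)" for N
      using test_fun_box_bump[of m a c d b N] that
      by (intro borel_measurable_leb smooth_fun_continuous) (auto simp: test_fun_def)
    note i = borel_measurable_indicator_open_box[of m c d ?Q]
    have "(\<lambda>N. \<integral>x. h x * of_real (box_bump m c d N x) \<partial>leb m ?Q) \<longlonglongrightarrow>
        (\<integral>x. h x * of_real (indicator (open_box m c d) x) \<partial>leb m ?Q)"
    proof (rule integral_dominated_convergence[where w = "\<lambda>x. norm (h x)"])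
      show "AE x in leb m ?Q. (\<lambda>N. h x * of_real (box_bump m c d N x)) \<longlonglongrightarrow>
          h x * of_real (indicator (open_box m c d) x)"
        by (rule AE_I2, intro tendsto_intros box_bump_tendsto) auto
      show "AE x in leb m ?Q. norm (h x * of_real (box_bump m c d N x)) \<le> norm (h x)" for N
        using box_bump_bounds[of m c d N] by (auto simp: norm_mult intro!: AE_I2 mult_left_le)
      show "(\<lambda>x. h x * of_real (indicator (open_box m c d) x)) \<in> borel_measurable (leb m ?Q)"
        using i by measurable
    qed (use int in auto)
    then show ?thesis
      using zero[OF test_fun_box_bump[of m a c d b]] that by (simp add: LIMSEQ_const_iff)
  qed
  have all: "(\<integral>x. h x * of_real (indicator (open_box m c d) x) \<partial>leb m ?Q) = 0" for c d
  proof -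
    have "(\<integral>x. h x * of_real (indicator (open_box m c d) x) \<partial>leb m ?Q) =
      (\<integral>x. h x * of_real (indicator (open_box m (\<lambda>i. max (a i) (c i)) (\<lambda>i. min (b i) (d i))) x) \<partial>leb m ?Q)"
      by (intro Bochner_Integration.integral_cong[OF refl]) (auto simp: indicator_def PiE_iff)
    then show ?thesis using sub[of "\<lambda>i. max (a i) (c i)" "\<lambda>i. min (b i) (d i)"] by simp
  qed
  have *: "AE x in leb m ?Q. r (h x) = 0" if r: "bounded_linear r" for r :: "complex \<Rightarrow> real"
  proof -
    interpret bounded_linear r by fact
    let ?R = "\<lambda>x. indicator ?Q x *\<^sub>R r (h x)"
    have int': "integrable ?P ?R"
      using integrable_bounded_linear[OF r int] unfolding leb_def
      by (subst (asm) integrable_restrict_space[OF Q])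
    have "(\<integral>x. ?R x * indicator (open_box m c d) x \<partial>?P) = 0" for c d
    proof -
      note i = borel_measurable_indicator_open_box[of m c d ?Q]
      have "(\<lambda>x. h x * complex_of_real (indicator (open_box m c d) x)) \<in> borel_measurable (leb m ?Q)"
        using i by measurable
      then have ii: "integrable (leb m ?Q) (\<lambda>x. h x * of_real (indicator (open_box m c d) x))"
        by (rule Bochner_Integration.integrable_bound[OF int]) (auto intro!: AE_I2 simp: norm_mult indicator_def)
      have "0 = r (\<integral>x. h x * of_real (indicator (open_box m c d) x) \<partial>leb m ?Q)"
        by (simp add: all zero)
      also have "\<dots> = (\<integral>x. r (h x * of_real (indicator (open_box m c d) x)) \<partial>leb m ?Q)"
        by (rule integral_bounded_linear[OF r ii, symmetric])
      also have "\<dots> = (\<integral>x. r (h x) * indicator (open_box m c d) x \<partial>leb m ?Q)"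
        by (intro Bochner_Integration.integral_cong[OF refl]) (auto simp: indicator_def zero)
      also have "\<dots> = (\<integral>x. ?R x * indicator (open_box m c d) x \<partial>?P)"
        unfolding leb_def by (subst integral_restrict_space[OF Q]) (simp add: mult.assoc)
      finally show ?thesis by simp
    qed
    from AE_eq_0_if_box_integrals_eq_0[OF int' this]
    have "AE x in ?P. x \<in> ?Q \<longrightarrow> r (h x) = 0" by eventually_elim (simp only: indicator_def, simp)
    then show ?thesis unfolding leb_def by (subst AE_restrict_space_iff[OF Q])
  qed
  from *[OF bounded_linear_Re] *[OF bounded_linear_Im] show ?thesis
    by eventually_elim (simp add: complex_eq_iff)
qed

subsection \<open>Weak derivatives and closures in the Sobolev norm\<close>

text \<open>The squared norm adds up to the energy, obeys Pythagoras and keeps square roots out of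
  the limits.\<close>

definition sq :: "nat \<Rightarrow> point set \<Rightarrow> cfun \<Rightarrow> real" where
  "sq m Q f = (\<integral>x. (cmod (f x))\<^sup>2 \<partial>leb m Q)"

lemma sq_nonneg: "0 \<le> sq m Q f" unfolding sq_def by simp

lemma L2_norm_sq: "(L2_norm m Q f)\<^sup>2 = sq m Q f"
  unfolding L2_norm_def sq_def by simp

lemma L2_spaceD:
  assumes "f \<in> L2_space m Q"
  shows "f \<in> borel_measurable (leb m Q)" "integrable (leb m Q) (\<lambda>x. (cmod (f x))\<^sup>2)"
  using assms unfolding L2_space_def by auto

text \<open>A substitute for the triangle inequality that survives integration term by term, at the
  price of a factor 2; it expresses (|x| - |y|)^2 \<ge> 0.\<close>

lemma norm_add_power2_le:
  fixes x y :: "'a::real_normed_vector"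
  shows "(norm (x + y))\<^sup>2 \<le> 2 * (norm x)\<^sup>2 + 2 * (norm y)\<^sup>2"
proof -
  have "(norm (x + y))\<^sup>2 \<le> (norm x + norm y)\<^sup>2" by (intro power_mono norm_triangle_ineq) auto
  also have "\<dots> \<le> 2 * (norm x)\<^sup>2 + 2 * (norm y)\<^sup>2"
    using zero_le_power2[of "norm x - norm y"] by (simp add: power2_eq_square algebra_simps)
  finally show ?thesis .
qed

lemma L2_space_add:
  assumes f: "f \<in> L2_space m Q" and g: "g \<in> L2_space m Q"
  shows "(\<lambda>x. f x + g x) \<in> L2_space m Q"
proof -
  note [measurable] = L2_spaceD(1)[OF f] L2_spaceD(1)[OF g]
  have "integrable (leb m Q) (\<lambda>x. (cmod (f x + g x))\<^sup>2)"
  proof (rule Bochner_Integration.integrable_bound)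
    show "integrable (leb m Q) (\<lambda>x. 2 * (cmod (f x))\<^sup>2 + 2 * (cmod (g x))\<^sup>2)"
      using L2_spaceD(2)[OF f] L2_spaceD(2)[OF g] by auto
  qed (use norm_add_power2_le in auto)
  then show ?thesis unfolding L2_space_def by auto
qed

lemma L2_space_cmult:
  assumes f: "f \<in> L2_space m Q" shows "(\<lambda>x. c * f x) \<in> L2_space m Q"
  using L2_spaceD[OF f] unfolding L2_space_def by (auto simp: norm_mult power_mult_distrib)

lemma L2_space_diff:
  assumes f: "f \<in> L2_space m Q" and g: "g \<in> L2_space m Q"
  shows "(\<lambda>x. f x - g x) \<in> L2_space m Q"
  using L2_space_add[OF f L2_space_cmult[OF g, of "- 1"]] by simp

lemma L2_space_cong:
  assumes "f \<in> L2_space m Q" "\<And>x. x \<in> space (leb m Q) \<Longrightarrow> f x = g x"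
  shows "g \<in> L2_space m Q"
proof -
  have "g \<in> borel_measurable (leb m Q)"
    using L2_spaceD(1)[OF assms(1)] assms(2) measurable_cong[of "leb m Q" f g borel] by simp
  moreover have "integrable (leb m Q) (\<lambda>x. (cmod (g x))\<^sup>2)"
    using L2_spaceD(2)[OF assms(1)] assms(2)
      Bochner_Integration.integrable_cong[of "leb m Q" "leb m Q" "\<lambda>x. (cmod (f x))\<^sup>2" "\<lambda>x. (cmod (g x))\<^sup>2"] by simp
  ultimately show ?thesis unfolding L2_space_def by simp
qed

lemma sq_add_le:
  assumes f: "f \<in> L2_space m Q" and g: "g \<in> L2_space m Q"
  shows "sq m Q (\<lambda>x. f x + g x) \<le> 2 * sq m Q f + 2 * sq m Q g"
proof -
  note i = L2_spaceD(2)[OF f] L2_spaceD(2)[OF g] L2_spaceD(2)[OF L2_space_add[OF f g]]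
  have "sq m Q (\<lambda>x. f x + g x) \<le> (\<integral>x. 2 * (cmod (f x))\<^sup>2 + 2 * (cmod (g x))\<^sup>2 \<partial>leb m Q)"
    unfolding sq_def using i norm_add_power2_le by (intro integral_mono) auto
  also have "\<dots> = 2 * sq m Q f + 2 * sq m Q g"
    unfolding sq_def using i by simp
  finally show ?thesis .
qed

lemma sq_cmult: "sq m Q (\<lambda>x. c * f x) = (cmod c)\<^sup>2 * sq m Q f"
  unfolding sq_def by (simp add: norm_mult power_mult_distrib)

lemma sq_AE_cong:
  assumes "f \<in> L2_space m Q" "g \<in> L2_space m Q" "AE x in leb m Q. f x = g x"
  shows "sq m Q f = sq m Q g"
proof -
  note [measurable] = L2_spaceD(1)[OF assms(1)] L2_spaceD(1)[OF assms(2)]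
  show ?thesis unfolding sq_def using assms(3) by (intro integral_cong_AE) auto
qed

lemma sq_cong: "(\<And>x. x \<in> space (leb m Q) \<Longrightarrow> f x = g x) \<Longrightarrow> sq m Q f = sq m Q g"
  unfolding sq_def by (intro Bochner_Integration.integral_cong) auto

lemma L2_space_continuous:
  assumes "continuous_on (real_space m) f" shows "f \<in> L2_space m (open_box m a b)"
proof -
  have "continuous_on (real_space m) (\<lambda>x. (cmod (f x))\<^sup>2)" by (intro continuous_intros assms)
  from integrable_leb_continuous[OF this] borel_measurable_leb[OF assms] show ?thesis
    unfolding L2_space_def by blast
qed

text \<open>A box has finite measure, so t \<le> 1 + t^2 supplies an integrable majorant.\<close>

lemma integrable_L2:
  assumes f: "f \<in> L2_space m (open_box m a b)"
  shows "integrable (leb m (open_box m a b)) f"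
proof (rule Bochner_Integration.integrable_bound)
  show "integrable (leb m (open_box m a b)) (\<lambda>x. 1 + (cmod (f x))\<^sup>2)"
    by (intro Bochner_Integration.integrable_add L2_spaceD(2)[OF f]
        finite_measure.integrable_const[OF finite_measure_leb])
  have "t \<le> 1 + t\<^sup>2" for t :: real
    using power2_diff[of t 1] zero_le_power2[of "t - 1"] zero_le_power2[of t] by (smt (verit) mult_cancel_left2 one_power2)
  then show "AE x in leb m (open_box m a b). norm (f x) \<le> norm (1 + (cmod (f x))\<^sup>2)" by simp
qed (use L2_spaceD[OF f] in auto)

lemma integrable_L2_mult_continuous:
  assumes f: "f \<in> L2_space m (open_box m a b)" and \<phi>: "continuous_on (real_space m) \<phi>"
  shows "integrable (leb m (open_box m a b)) (\<lambda>x. f x * \<phi> x)"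
proof -
  note [measurable] = L2_spaceD(1)[OF f] borel_measurable_leb[OF \<phi>]
  obtain C where C: "C > 0" "\<And>x. x \<in> open_box m a b \<Longrightarrow> norm (\<phi> x) \<le> C"
    using bounded_on_open_box[OF \<phi>] by metis
  show ?thesis
  proof (rule Bochner_Integration.integrable_bound)
    show "integrable (leb m (open_box m a b)) (\<lambda>x. C * norm (f x))"
      using integrable_L2[OF f] by auto
    show "AE x in leb m (open_box m a b). norm (f x * \<phi> x) \<le> norm (C * norm (f x))"
      using C by (intro AE_I2) (auto simp: norm_mult mult.commute[of C] intro!: mult_left_mono)
  qed measurable
qed

text \<open>Expand \<open>0 \<le> \<integral>(\<bar>h\<bar> - t)\<^sup>2\<close> and choose \<open>t\<close> to be the mean of \<open>\<bar>h\<bar>\<close>.\<close>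

lemma integral_norm_power2_le:
  assumes h: "h \<in> L2_space m (open_box m a b)"
  defines "M \<equiv> leb m (open_box m a b)"
  shows "(\<integral>x. cmod (h x) \<partial>M)\<^sup>2 \<le> measure M (space M) * sq m (open_box m a b) h"
proof -
  interpret finite_measure M unfolding M_def by (rule finite_measure_leb)
  let ?I = "\<integral>x. cmod (h x) \<partial>M" and ?V = "measure M (space M)"
  have i: "integrable M (\<lambda>x. cmod (h x))" "integrable M (\<lambda>x. (cmod (h x))\<^sup>2)"
    using integrable_L2[OF h] L2_spaceD(2)[OF h] unfolding M_def by auto
  have *: "0 \<le> sq m (open_box m a b) h - 2 * t * ?I + t\<^sup>2 * ?V" for t
  proof -
    have "0 \<le> (\<integral>x. (cmod (h x) - t)\<^sup>2 \<partial>M)" by simp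
    also have "(\<integral>x. (cmod (h x) - t)\<^sup>2 \<partial>M) = (\<integral>x. ((cmod (h x))\<^sup>2 - 2 * t * cmod (h x)) + t\<^sup>2 \<partial>M)"
      by (intro Bochner_Integration.integral_cong) (auto simp: power2_diff)
    also have "\<dots> = sq m (open_box m a b) h - 2 * t * ?I + t\<^sup>2 * ?V"
      using i unfolding sq_def M_def[symmetric] by (simp add: mult.commute)
    finally show ?thesis .
  qed
  show ?thesis
  proof (cases "?V = 0")
    case True
    have "?I = 0"
    proof (rule ccontr)
      assume I: "?I \<noteq> 0"
      \<comment> \<open>Measure zero leaves an affine function of \<open>t\<close>. The value chosen
        here makes it -1, so a nonzero slope is impossible.\<close>
      have "0 \<le> sq m (open_box m a b) h - 2 * ((sq m (open_box m a b) h + 1) / (2 * ?I)) * ?I"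
        using *[of "(sq m (open_box m a b) h + 1) / (2 * ?I)"] True by simp
      then show False using I by simp
    qed
    then show ?thesis using True by simp
  next
    case False
    then have V: "?V > 0" by (simp add: less_le)
    have "0 \<le> sq m (open_box m a b) h - ?I\<^sup>2 / ?V"
      using *[of "?I / ?V"] V by (simp add: power2_eq_square)
    then show ?thesis using V by (simp add: field_simps)
  qed
qed

text \<open>On the box \<phi> is bounded, so the integral is at most a constant times the L1 norm of
  \<open>h \<nu>\<close>, and the Cauchy-Schwarz inequality against a constant function bounds that
  by the L2 norm.\<close>

lemma integral_mult_tendsto_0:
  assumes h: "\<And>\<nu>. h \<nu> \<in> L2_space m (open_box m a b)"
    and lim: "(\<lambda>\<nu>. sq m (open_box m a b) (h \<nu>)) \<longlonglongrightarrow> 0"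
    and \<phi>: "continuous_on (real_space m) \<phi>"
  shows "(\<lambda>\<nu>. \<integral>x. h \<nu> x * \<phi> x \<partial>leb m (open_box m a b)) \<longlonglongrightarrow> 0"
proof -
  let ?M = "leb m (open_box m a b)"
  obtain C where C: "C > 0" "\<And>x. x \<in> open_box m a b \<Longrightarrow> norm (\<phi> x) \<le> C"
    using bounded_on_open_box[OF \<phi>] by metis
  let ?V = "measure ?M (space ?M)"
  have b: "norm (\<integral>x. h \<nu> x * \<phi> x \<partial>?M) \<le> C * sqrt (?V * sq m (open_box m a b) (h \<nu>))" for \<nu>
  proof -
    have "norm (\<integral>x. h \<nu> x * \<phi> x \<partial>?M) \<le> (\<integral>x. norm (h \<nu> x * \<phi> x) \<partial>?M)"
      by (rule integral_norm_bound)
    also have "\<dots> \<le> (\<integral>x. C * cmod (h \<nu> x) \<partial>?M)"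
    proof (rule integral_mono)
      show "integrable ?M (\<lambda>x. norm (h \<nu> x * \<phi> x))"
        by (rule integrable_norm[OF integrable_L2_mult_continuous[OF h \<phi>]])
      show "integrable ?M (\<lambda>x. C * cmod (h \<nu> x))"
        using integrable_L2[OF h[of \<nu>]] by simp
    qed (use C in \<open>auto simp: norm_mult mult.commute[of C] intro!: mult_left_mono\<close>)
    also have "\<dots> = C * (\<integral>x. cmod (h \<nu> x) \<partial>?M)" by simp
    also have "\<dots> \<le> C * sqrt (?V * sq m (open_box m a b) (h \<nu>))"
      using integral_norm_power2_le[OF h[of \<nu>]] C(1) by (intro mult_left_mono real_le_rsqrt) auto
    finally show ?thesis .
  qed
  have "(\<lambda>\<nu>. C * sqrt (?V * sq m (open_box m a b) (h \<nu>))) \<longlonglongrightarrow> C * sqrt (?V * 0)"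
    by (intro tendsto_intros lim)
  then show ?thesis by (intro Lim_null_comparison[OF always_eventually[OF allI[OF b]]]) simp
qed

lemma test_funD:
  assumes "test_fun m Q \<phi>"
  shows "continuous_on (real_space m) \<phi>"
    and "k < m \<Longrightarrow> continuous_on (real_space m) (partial_deriv k \<phi>)"
    and "k < m \<Longrightarrow> has_partial m k \<phi> (partial_deriv k \<phi>)"
    and "x \<in> real_space m - Q \<Longrightarrow> \<phi> x = 0"
  using assms smooth_fun_partial_deriv[of m \<phi> k] smooth_fun_continuous smooth_fun_has_partial
  unfolding test_fun_def by blast+

lemma has_weak_deriv_add:
  assumes "f \<in> L2_space m (open_box m a b)" "f' \<in> L2_space m (open_box m a b)"
    and "g \<in> L2_space m (open_box m a b)" "g' \<in> L2_space m (open_box m a b)" "k < m"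
    and "has_weak_deriv m (open_box m a b) k f f'" "has_weak_deriv m (open_box m a b) k g g'"
  shows "has_weak_deriv m (open_box m a b) k (\<lambda>x. f x + g x) (\<lambda>x. f' x + g' x)"
  unfolding has_weak_deriv_def
proof (intro allI impI)
  fix \<phi> assume \<phi>: "test_fun m (open_box m a b) \<phi>"
  note c = test_funD(1)[OF \<phi>] test_funD(2)[OF \<phi> \<open>k < m\<close>]
  note i = assms(1-4)[THEN integrable_L2_mult_continuous[OF _ c(1)]]
    assms(1-4)[THEN integrable_L2_mult_continuous[OF _ c(2)]]
  show "(\<integral>x. (f x + g x) * partial_deriv k \<phi> x \<partial>leb m (open_box m a b)) =
      - (\<integral>x. (f' x + g' x) * \<phi> x \<partial>leb m (open_box m a b))"
    using assms(6,7) \<phi> i unfolding has_weak_deriv_def by (simp add: distrib_right)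
qed

lemma has_weak_deriv_cmult:
  assumes "has_weak_deriv m Q k f f'"
  shows "has_weak_deriv m Q k (\<lambda>x. c * f x) (\<lambda>x. c * f' x)"
  using assms unfolding has_weak_deriv_def by (simp add: mult.assoc)

lemma has_weak_deriv_cong:
  assumes "has_weak_deriv m Q k f g" "\<And>x. x \<in> space (leb m Q) \<Longrightarrow> f x = f' x"
    "\<And>x. x \<in> space (leb m Q) \<Longrightarrow> g x = g' x"
  shows "has_weak_deriv m Q k f' g'"
  unfolding has_weak_deriv_def
proof (intro allI impI)
  fix \<phi> assume "test_fun m Q \<phi>"
  moreover have "(\<integral>x. f x * partial_deriv k \<phi> x \<partial>leb m Q) = (\<integral>x. f' x * partial_deriv k \<phi> x \<partial>leb m Q)"
    "(\<integral>x. g x * \<phi> x \<partial>leb m Q) = (\<integral>x. g' x * \<phi> x \<partial>leb m Q)"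
    using assms(2,3) by (auto intro!: Bochner_Integration.integral_cong)
  ultimately show "(\<integral>x. f' x * partial_deriv k \<phi> x \<partial>leb m Q) = - (\<integral>x. g' x * \<phi> x \<partial>leb m Q)"
    using assms(1) unfolding has_weak_deriv_def by simp
qed

text \<open>The two integrals with the errors f - u and g - v have a sum that tends to 0. The
  contributions of u and v cancel by \<open>d\<close>, so this sum does not depend on the index and
  equals the defect of the identity for f and g.\<close>

lemma has_weak_deriv_limit:
  assumes f: "f \<in> L2_space m (open_box m a b)" and g: "g \<in> L2_space m (open_box m a b)"
    and u: "\<And>\<nu>. u \<nu> \<in> L2_space m (open_box m a b)" and v: "\<And>\<nu>. v \<nu> \<in> L2_space m (open_box m a b)"
    and k: "k < m" and d: "\<And>\<nu>. has_weak_deriv m (open_box m a b) k (u \<nu>) (v \<nu>)"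
    and lu: "(\<lambda>\<nu>. sq m (open_box m a b) (\<lambda>x. f x - u \<nu> x)) \<longlonglongrightarrow> 0"
    and lv: "(\<lambda>\<nu>. sq m (open_box m a b) (\<lambda>x. g x - v \<nu> x)) \<longlonglongrightarrow> 0"
  shows "has_weak_deriv m (open_box m a b) k f g"
  unfolding has_weak_deriv_def
proof (intro allI impI)
  let ?M = "leb m (open_box m a b)"
  fix \<phi> assume \<phi>: "test_fun m (open_box m a b) \<phi>"
  note c = test_funD(1)[OF \<phi>] test_funD(2)[OF \<phi> k]
  have "(\<lambda>\<nu>. (\<integral>x. (f x - u \<nu> x) * partial_deriv k \<phi> x \<partial>?M) + (\<integral>x. (g x - v \<nu> x) * \<phi> x \<partial>?M)) \<longlonglongrightarrow> 0 + 0"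
    by (intro tendsto_add integral_mult_tendsto_0 L2_space_diff f g u v lu lv c)
  moreover have "(\<integral>x. (f x - u \<nu> x) * partial_deriv k \<phi> x \<partial>?M) + (\<integral>x. (g x - v \<nu> x) * \<phi> x \<partial>?M) =
     (\<integral>x. f x * partial_deriv k \<phi> x \<partial>?M) + (\<integral>x. g x * \<phi> x \<partial>?M)" for \<nu>
    using d[of \<nu>] \<phi> integrable_L2_mult_continuous[OF f c(2)] integrable_L2_mult_continuous[OF u c(2), of \<nu>]
      integrable_L2_mult_continuous[OF g c(1)] integrable_L2_mult_continuous[OF v c(1), of \<nu>]
    unfolding has_weak_deriv_def by (simp add: left_diff_distrib)
  ultimately have "(\<integral>x. f x * partial_deriv k \<phi> x \<partial>?M) + (\<integral>x. g x * \<phi> x \<partial>?M) = 0"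
    by (simp add: LIMSEQ_const_iff)
  then show "(\<integral>x. f x * partial_deriv k \<phi> x \<partial>?M) = - (\<integral>x. g x * \<phi> x \<partial>?M)"
    by (simp add: eq_neg_iff_add_eq_0)
qed

text \<open>The support of \<phi> lies inside the open box, so \<open>u x * \<phi> x\<close> is zero
  on all faces and integrating its \<open>k\<close>-th partial leaves no boundary term.\<close>

lemma has_weak_deriv_partial:
  assumes k: "k < m" and ab: "\<And>i. i < m \<Longrightarrow> a i < b i"
    and c: "continuous_on (real_space m) u" "continuous_on (real_space m) u'" and d: "has_partial m k u u'"
  shows "has_weak_deriv m (open_box m a b) k u u'"
  unfolding has_weak_deriv_def
proof (intro allI impI)
  let ?M = "leb m (open_box m a b)"
  fix \<phi> assume \<phi>: "test_fun m (open_box m a b) \<phi>"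
  note c' = test_funD(1)[OF \<phi>] test_funD(2)[OF \<phi> k]
  have "(\<integral>x. u x * partial_deriv k \<phi> x + u' x * \<phi> x \<partial>?M) = 0"
  proof (rule integral_partial_eq_0[OF k])
    show "a k \<le> b k" using ab[OF k] by simp
    show "continuous_on (real_space m) (\<lambda>x. u x * partial_deriv k \<phi> x + u' x * \<phi> x)"
      by (intro continuous_intros c c')
    show "has_partial m k (\<lambda>x. u x * \<phi> x) (\<lambda>x. u x * partial_deriv k \<phi> x + u' x * \<phi> x)"
      by (intro has_partial_mult d test_funD(3)[OF \<phi> k])
    fix x assume x: "x \<in> real_space m"
    have "x(k := s) \<in> real_space m - open_box m a b" if "s = a k \<or> s = b k" for s
      using fun_upd_real_space[OF x k, of s] k that by (simp add: PiE_iff) (use k in fastforce)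
    then show "u (x(k := a k)) * \<phi> (x(k := a k)) = u (x(k := b k)) * \<phi> (x(k := b k))"
      using test_funD(4)[OF \<phi>] by simp
  qed
  then show "(\<integral>x. u x * partial_deriv k \<phi> x \<partial>?M) = - (\<integral>x. u' x * \<phi> x \<partial>?M)"
    using integrable_leb_continuous[of m "\<lambda>x. u x * partial_deriv k \<phi> x" a b]
      integrable_leb_continuous[of m "\<lambda>x. u' x * \<phi> x" a b] c c'
    by (simp add: continuous_on_mult eq_neg_iff_add_eq_0)
qed

text \<open>The difference of two weak derivatives has vanishing integrals against all test
  functions, so the fundamental lemma applies.\<close>

lemma has_weak_deriv_unique:
  assumes "g \<in> L2_space m (open_box m a b)" "g' \<in> L2_space m (open_box m a b)"
    and "has_weak_deriv m (open_box m a b) k f g" "has_weak_deriv m (open_box m a b) k f g'"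
  shows "AE x in leb m (open_box m a b). g x = g' x"
proof -
  have "AE x in leb m (open_box m a b). g x - g' x = 0"
  proof (rule AE_eq_0_if_test_integrals_eq_0)
    show "integrable (leb m (open_box m a b)) (\<lambda>x. g x - g' x)"
      using assms by (intro integrable_L2 L2_space_diff)
    fix \<phi> assume \<phi>: "test_fun m (open_box m a b) \<phi>"
    show "(\<integral>x. (g x - g' x) * \<phi> x \<partial>leb m (open_box m a b)) = 0"
      using assms(3,4) \<phi> integrable_L2_mult_continuous[OF assms(1) test_funD(1)[OF \<phi>]]
       integrable_L2_mult_continuous[OF assms(2) test_funD(1)[OF \<phi>]]
      unfolding has_weak_deriv_def by (simp add: left_diff_distrib)
  qed
  then show ?thesis by simp
qed

text \<open>With the derivatives carried along as an explicit family, sums and multiples become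
  literal operations on pairs, which \<open>weak_deriv\<close> does not allow. Only the members
  \<open>F k\<close> with k < m matter.\<close>

definition sobolev_pair :: "nat \<Rightarrow> point set \<Rightarrow> cfun \<Rightarrow> (nat \<Rightarrow> cfun) \<Rightarrow> bool" where
  "sobolev_pair m Q f F \<longleftrightarrow>
     f \<in> L2_space m Q \<and> (\<forall>k<m. F k \<in> L2_space m Q \<and> has_weak_deriv m Q k f (F k))"

definition energy :: "nat \<Rightarrow> point set \<Rightarrow> cfun \<Rightarrow> (nat \<Rightarrow> cfun) \<Rightarrow> real" where
  "energy m Q f F = sq m Q f + (\<Sum>k<m. sq m Q (F k))"

lemma energy_nonneg: "0 \<le> energy m Q f F"
  unfolding energy_def by (intro add_nonneg_nonneg sum_nonneg sq_nonneg)

lemma sobolev_pair_add: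
  assumes "sobolev_pair m (open_box m a b) f F" "sobolev_pair m (open_box m a b) g G"
  shows "sobolev_pair m (open_box m a b) (\<lambda>x. f x + g x) (\<lambda>k x. F k x + G k x)"
  using assms unfolding sobolev_pair_def by (auto intro!: L2_space_add has_weak_deriv_add)

lemma sobolev_pair_cmult:
  "sobolev_pair m Q f F \<Longrightarrow> sobolev_pair m Q (\<lambda>x. c * f x) (\<lambda>k x. c * F k x)"
  unfolding sobolev_pair_def by (auto intro!: L2_space_cmult has_weak_deriv_cmult)

lemma sobolev_pair_diff:
  assumes "sobolev_pair m (open_box m a b) f F" "sobolev_pair m (open_box m a b) g G"
  shows "sobolev_pair m (open_box m a b) (\<lambda>x. f x - g x) (\<lambda>k x. F k x - G k x)"
  using sobolev_pair_add[OF assms(1) sobolev_pair_cmult[OF assms(2), of "- 1"]] by simp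

lemma sobolev_pair_cong:
  assumes "sobolev_pair m Q f F" "\<And>x. x \<in> space (leb m Q) \<Longrightarrow> f x = g x"
    "\<And>x k. k < m \<Longrightarrow> x \<in> space (leb m Q) \<Longrightarrow> F k x = G k x"
  shows "sobolev_pair m Q g G"
  using assms unfolding sobolev_pair_def by (auto intro: L2_space_cong has_weak_deriv_cong)

lemma sobolev_pair_partial:
  assumes "\<And>i. i < m \<Longrightarrow> a i < b i" "continuous_on (real_space m) u"
    and "\<And>k. k < m \<Longrightarrow> continuous_on (real_space m) (U k)"
    and "\<And>k. k < m \<Longrightarrow> has_partial m k u (U k)"
  shows "sobolev_pair m (open_box m a b) u U"
  unfolding sobolev_pair_def using assms
  by (auto intro!: L2_space_continuous has_weak_deriv_partial)

lemma sobolev_pair_smooth: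
  assumes "\<And>i. i < m \<Longrightarrow> a i < b i" "smooth_fun m u"
  shows "sobolev_pair m (open_box m a b) u (\<lambda>k. partial_deriv k u)"
  using assms smooth_fun_partial_deriv[OF assms(2)]
  by (intro sobolev_pair_partial) (auto intro: smooth_fun_continuous smooth_fun_has_partial)

lemma energy_add_le:
  assumes f: "sobolev_pair m Q f F" and g: "sobolev_pair m Q g G"
  shows "energy m Q (\<lambda>x. f x + g x) (\<lambda>k x. F k x + G k x) \<le> 2 * energy m Q f F + 2 * energy m Q g G"
proof -
  have "(\<Sum>k<m. sq m Q (\<lambda>x. F k x + G k x)) \<le> (\<Sum>k<m. 2 * sq m Q (F k) + 2 * sq m Q (G k))"
    using f g unfolding sobolev_pair_def by (intro sum_mono sq_add_le) auto
  moreover have "sq m Q (\<lambda>x. f x + g x) \<le> 2 * sq m Q f + 2 * sq m Q g"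
    using f g unfolding sobolev_pair_def by (intro sq_add_le) auto
  ultimately show ?thesis unfolding energy_def by (simp add: sum.distrib sum_distrib_left distrib_left)
qed

lemma energy_cmult: "energy m Q (\<lambda>x. c * f x) (\<lambda>k x. c * F k x) = (cmod c)\<^sup>2 * energy m Q f F"
  unfolding energy_def by (simp add: sq_cmult sum_distrib_left distrib_left)

lemma energy_cong:
  assumes "\<And>x. x \<in> space (leb m Q) \<Longrightarrow> f x = g x"
    "\<And>x k. k < m \<Longrightarrow> x \<in> space (leb m Q) \<Longrightarrow> F k x = G k x"
  shows "energy m Q f F = energy m Q g G"
  unfolding energy_def using assms by (auto intro!: arg_cong2[of _ _ _ _ "(+)"] sum.cong sq_cong)

text \<open>Weak derivatives agree up to null sets, so the energy depends on the function alone.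
  This identifies it with the square of \<open>H1_norm\<close>, whatever choice
  \<open>weak_deriv\<close> makes.\<close>

lemma energy_unique:
  assumes "sobolev_pair m (open_box m a b) f F" "sobolev_pair m (open_box m a b) f G"
  shows "energy m (open_box m a b) f F = energy m (open_box m a b) f G"
proof -
  have "sq m (open_box m a b) (F k) = sq m (open_box m a b) (G k)" if "k < m" for k
    using assms that unfolding sobolev_pair_def
    by (intro sq_AE_cong has_weak_deriv_unique[of "F k" m a b "G k" k f]) auto
  then show ?thesis unfolding energy_def by simp
qed

lemma H1_space_iff: "f \<in> H1_space m Q \<longleftrightarrow> (\<exists>F. sobolev_pair m Q f F)"
proof
  assume "f \<in> H1_space m Q"
  then have "f \<in> L2_space m Q" and "\<forall>k. \<exists>g. k < m \<longrightarrow> g \<in> L2_space m Q \<and> has_weak_deriv m Q k f g"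
    unfolding H1_space_def by auto
  from this(1) choice[OF this(2)] show "\<exists>F. sobolev_pair m Q f F" unfolding sobolev_pair_def by blast
qed (auto simp: H1_space_def sobolev_pair_def)

lemma sobolev_pair_weak_deriv:
  assumes "f \<in> H1_space m Q" shows "sobolev_pair m Q f (\<lambda>k. weak_deriv m Q k f)"
proof -
  have "weak_deriv m Q k f \<in> L2_space m Q \<and> has_weak_deriv m Q k f (weak_deriv m Q k f)" if "k < m" for k
  proof -
    have "\<exists>g. g \<in> L2_space m Q \<and> has_weak_deriv m Q k f g"
      using assms that unfolding H1_space_def by blast
    from someI_ex[OF this] show ?thesis unfolding weak_deriv_def .
  qed
  with assms show ?thesis unfolding sobolev_pair_def H1_space_def by auto
qed

lemma H1_norm_energy:
  assumes "sobolev_pair m (open_box m a b) f F"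
  shows "H1_norm m (open_box m a b) f = sqrt (energy m (open_box m a b) f F)"
proof -
  have "sobolev_pair m (open_box m a b) f (\<lambda>k. weak_deriv m (open_box m a b) k f)"
    using assms by (intro sobolev_pair_weak_deriv) (auto simp: H1_space_iff)
  from energy_unique[OF assms this] show ?thesis
    unfolding H1_norm_def L2_norm_sq by (simp add: energy_def)
qed

section \<open>Closures in the Sobolev norm, by errors and by sequences\<close>

lemma H1_closureI:
  assumes f: "sobolev_pair m (open_box m a b) f F"
    and approx: "\<And>\<epsilon>. \<epsilon> > 0 \<Longrightarrow> \<exists>g\<in>K. \<exists>G. sobolev_pair m (open_box m a b) g G \<and>
       energy m (open_box m a b) (\<lambda>x. f x - g x) (\<lambda>k x. F k x - G k x) < \<epsilon>"
  shows "f \<in> H1_closure m (open_box m a b) K"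
  unfolding H1_closure_def
proof (intro CollectI conjI allI impI)
  show "f \<in> H1_space m (open_box m a b)" using f by (auto simp: H1_space_iff)
  fix \<epsilon> :: real assume "\<epsilon> > 0"
  then have "\<epsilon>\<^sup>2 > 0" by simp
  from approx[OF this] obtain g G where g: "g \<in> K" "sobolev_pair m (open_box m a b) g G"
    "energy m (open_box m a b) (\<lambda>x. f x - g x) (\<lambda>k x. F k x - G k x) < \<epsilon>\<^sup>2" by blast
  have "H1_norm m (open_box m a b) (\<lambda>x. f x - g x) < \<epsilon>"
    using g(3) \<open>\<epsilon> > 0\<close> unfolding H1_norm_energy[OF sobolev_pair_diff[OF f g(2)]]
    by (intro real_less_lsqrt) (auto intro: energy_nonneg)
  then show "\<exists>g\<in>K \<inter> H1_space m (open_box m a b). H1_norm m (open_box m a b) (\<lambda>x. f x - g x) < \<epsilon>"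
    using g(1,2) unfolding H1_space_iff[symmetric] by (intro bexI[of _ g] IntI) (auto simp: H1_space_iff)
qed

lemma H1_closureD:
  assumes "f \<in> H1_closure m (open_box m a b) K" "\<epsilon> > 0" "sobolev_pair m (open_box m a b) f F"
  obtains g G where "g \<in> K" "sobolev_pair m (open_box m a b) g G"
    "energy m (open_box m a b) (\<lambda>x. f x - g x) (\<lambda>k x. F k x - G k x) < \<epsilon>"
proof -
  have "sqrt \<epsilon> > 0" using assms(2) by simp
  then obtain g where g: "g \<in> K" "g \<in> H1_space m (open_box m a b)"
    "H1_norm m (open_box m a b) (\<lambda>x. f x - g x) < sqrt \<epsilon>"
    using assms(1) unfolding H1_closure_def by blast
  from g(2) obtain G where G: "sobolev_pair m (open_box m a b) g G" by (auto simp: H1_space_iff)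
  have "energy m (open_box m a b) (\<lambda>x. f x - g x) (\<lambda>k x. F k x - G k x) < \<epsilon>"
    using g(3) unfolding H1_norm_energy[OF sobolev_pair_diff[OF assms(3) G]] by simp
  with g(1) G that show thesis by blast
qed

lemma H1_closure_subset_H1_space: "H1_closure m Q K \<subseteq> H1_space m Q"
  unfolding H1_closure_def by auto

text \<open>Closures are idempotent. Approximating first from S and then from K doubles each of the
  two errors, hence the bounds \<epsilon> / 4.\<close>

lemma H1_closure_mono_closure:
  assumes "S \<inter> H1_space m (open_box m a b) \<subseteq> H1_closure m (open_box m a b) K"
  shows "H1_closure m (open_box m a b) S \<subseteq> H1_closure m (open_box m a b) K"
proof
  let ?Q = "open_box m a b"
  fix f assume f: "f \<in> H1_closure m ?Q S"
  then obtain F where F: "sobolev_pair m ?Q f F"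
    using H1_closure_subset_H1_space H1_space_iff by blast
  show "f \<in> H1_closure m ?Q K"
  proof (rule H1_closureI[OF F])
    fix \<epsilon> :: real assume "\<epsilon> > 0"
    then have e: "\<epsilon> / 4 > 0" by simp
    obtain g G where g: "g \<in> S" "sobolev_pair m ?Q g G"
      "energy m ?Q (\<lambda>x. f x - g x) (\<lambda>k x. F k x - G k x) < \<epsilon> / 4" by (rule H1_closureD[OF f e F])
    have "g \<in> H1_closure m ?Q K" using g(1,2) assms H1_space_iff by blast
    then obtain h H where h: "h \<in> K" "sobolev_pair m ?Q h H"
      "energy m ?Q (\<lambda>x. g x - h x) (\<lambda>k x. G k x - H k x) < \<epsilon> / 4" by (rule H1_closureD[OF _ e g(2)])
    have "energy m ?Q (\<lambda>x. f x - h x) (\<lambda>k x. F k x - H k x) < \<epsilon>"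
      using energy_add_le[OF sobolev_pair_diff[OF F g(2)] sobolev_pair_diff[OF g(2) h(2)]] g(3) h(3) by simp
    then show "\<exists>g\<in>K. \<exists>G. sobolev_pair m ?Q g G \<and> energy m ?Q (\<lambda>x. f x - g x) (\<lambda>k x. F k x - G k x) < \<epsilon>"
      using h(1,2) by blast
  qed
qed

text \<open>Membership of \<open>f\<close> in \<open>H1_space\<close> is part of what is proved: the
  limits \<open>F k\<close> are assumed to be square integrable only, and
  \<open>has_weak_deriv_limit\<close> identifies them as weak derivatives of
  \<open>f\<close>.\<close>

lemma H1_closure_seqI:
  assumes f: "f \<in> L2_space m (open_box m a b)"
    and F: "\<And>k. k < m \<Longrightarrow> F k \<in> L2_space m (open_box m a b)"
    and u: "\<And>\<nu>. u \<nu> \<in> K" "\<And>\<nu>. sobolev_pair m (open_box m a b) (u \<nu>) (U \<nu>)"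
    and lim: "(\<lambda>\<nu>. sq m (open_box m a b) (\<lambda>x. f x - u \<nu> x)) \<longlonglongrightarrow> 0"
    "\<And>k. k < m \<Longrightarrow> (\<lambda>\<nu>. sq m (open_box m a b) (\<lambda>x. F k x - U \<nu> k x)) \<longlonglongrightarrow> 0"
  shows "f \<in> H1_closure m (open_box m a b) K"
proof (rule H1_closureI)
  let ?Q = "open_box m a b"
  show "sobolev_pair m ?Q f F"
    unfolding sobolev_pair_def
  proof (intro conjI allI impI f F)
    show "has_weak_deriv m ?Q k f (F k)" if "k < m" for k
      by (rule has_weak_deriv_limit[of f m a b "F k" u "\<lambda>\<nu>. U \<nu> k"])
        (use f F u(2) lim that in \<open>auto simp: sobolev_pair_def\<close>)
  qed
  fix \<epsilon> :: real assume "\<epsilon> > 0"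
  have "(\<lambda>\<nu>. energy m ?Q (\<lambda>x. f x - u \<nu> x) (\<lambda>k x. F k x - U \<nu> k x)) \<longlonglongrightarrow> 0 + (\<Sum>k<m. 0)"
    unfolding energy_def by (intro tendsto_add tendsto_sum lim) auto
  then have "eventually (\<lambda>\<nu>. energy m ?Q (\<lambda>x. f x - u \<nu> x) (\<lambda>k x. F k x - U \<nu> k x) < \<epsilon>) sequentially"
    using \<open>\<epsilon> > 0\<close> by (intro order_tendstoD) auto
  then obtain \<nu> where "energy m ?Q (\<lambda>x. f x - u \<nu> x) (\<lambda>k x. F k x - U \<nu> k x) < \<epsilon>"
    by (auto simp: eventually_sequentially)
  then show "\<exists>g\<in>K. \<exists>G. sobolev_pair m ?Q g G \<and> energy m ?Q (\<lambda>x. f x - g x) (\<lambda>k x. F k x - G k x) < \<epsilon>"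
    using u by blast
qed

text \<open>Sequences, rather than errors, allow all factors of a tensor to be approximated along
  one common index.\<close>

lemma H1_closure_seqD:
  assumes f: "f \<in> H1_closure m (open_box m a b) K" "sobolev_pair m (open_box m a b) f F"
  obtains u U where "\<And>\<nu>. u \<nu> \<in> K" "\<And>\<nu>. sobolev_pair m (open_box m a b) (u \<nu>) (U \<nu>)"
    "(\<lambda>\<nu>. sq m (open_box m a b) (\<lambda>x. f x - u \<nu> x)) \<longlonglongrightarrow> 0"
    "\<And>k. k < m \<Longrightarrow> (\<lambda>\<nu>. sq m (open_box m a b) (\<lambda>x. F k x - U \<nu> k x)) \<longlonglongrightarrow> 0"
proof -
  let ?Q = "open_box m a b"
  have "\<exists>gG. fst gG \<in> K \<and> sobolev_pair m ?Q (fst gG) (snd gG) \<and>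
      energy m ?Q (\<lambda>x. f x - fst gG x) (\<lambda>k x. F k x - snd gG k x) < inverse (real (Suc \<nu>))" for \<nu>
  proof -
    have "inverse (real (Suc \<nu>)) > 0" by simp
    then obtain g G where "g \<in> K" "sobolev_pair m ?Q g G"
      "energy m ?Q (\<lambda>x. f x - g x) (\<lambda>k x. F k x - G k x) < inverse (real (Suc \<nu>))"
      by (rule H1_closureD[OF f(1) _ f(2)])
    then show ?thesis by (intro exI[of _ "(g, G)"]) simp
  qed
  from choice[OF allI[OF this]] obtain w where "\<forall>\<nu>. fst (w \<nu>) \<in> K \<and> sobolev_pair m ?Q (fst (w \<nu>)) (snd (w \<nu>)) \<and>
      energy m ?Q (\<lambda>x. f x - fst (w \<nu>) x) (\<lambda>k x. F k x - snd (w \<nu>) k x) < inverse (real (Suc \<nu>))" ..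
  then have w: "\<And>\<nu>. fst (w \<nu>) \<in> K" "\<And>\<nu>. sobolev_pair m ?Q (fst (w \<nu>)) (snd (w \<nu>))"
    "\<And>\<nu>. energy m ?Q (\<lambda>x. f x - fst (w \<nu>) x) (\<lambda>k x. F k x - snd (w \<nu>) k x) < inverse (real (Suc \<nu>))"
    by simp_all
  have e: "(\<lambda>\<nu>. energy m ?Q (\<lambda>x. f x - fst (w \<nu>) x) (\<lambda>k x. F k x - snd (w \<nu>) k x)) \<longlonglongrightarrow> 0"
    by (rule tendsto_sandwich[OF _ _ tendsto_const LIMSEQ_inverse_real_of_nat])
      (use w(3) in \<open>auto simp: energy_nonneg intro!: always_eventually less_imp_le simp del: of_nat_Suc\<close>)
  have "(\<lambda>\<nu>. sq m ?Q (\<lambda>x. f x - fst (w \<nu>) x)) \<longlonglongrightarrow> 0"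
    by (rule tendsto_sandwich[OF _ _ tendsto_const e])
      (auto simp: energy_def sq_nonneg intro!: always_eventually sum_nonneg)
  moreover have "(\<lambda>\<nu>. sq m ?Q (\<lambda>x. F k x - snd (w \<nu>) k x)) \<longlonglongrightarrow> 0" if k: "k < m" for k
  proof (rule tendsto_sandwich[OF _ _ tendsto_const e])
    have "sq m ?Q (\<lambda>x. F k x - snd (w \<nu>) k x) \<le> (\<Sum>k<m. sq m ?Q (\<lambda>x. F k x - snd (w \<nu>) k x))" for \<nu>
      using k by (intro member_le_sum) (auto simp: sq_nonneg)
    then show "\<forall>\<^sub>F \<nu> in sequentially. sq m ?Q (\<lambda>x. F k x - snd (w \<nu>) k x) \<le>
        energy m ?Q (\<lambda>x. f x - fst (w \<nu>) x) (\<lambda>k x. F k x - snd (w \<nu>) k x)"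
      unfolding energy_def by (intro always_eventually allI) (smt (verit) sq_nonneg)
  qed (auto simp: sq_nonneg)
  ultimately show thesis using that[of "\<lambda>\<nu>. fst (w \<nu>)" "\<lambda>\<nu>. snd (w \<nu>)"] w(1,2) by blast
qed

subsection \<open>Trigonometric polynomials\<close>

text \<open>The frequencies \<omega> are kept general so that the restriction of a wave to a block
  of coordinates is a wave again. Entries of \<open>n\<close> from \<open>m\<close> on have no
  effect; multi-indices are later required to vanish there, so that distinct ones give orthogonal
  waves.\<close>

definition wave :: "nat \<Rightarrow> (nat \<Rightarrow> real) \<Rightarrow> (nat \<Rightarrow> int) \<Rightarrow> cfun" where
  "wave m \<omega> n x = cis (\<Sum>k<m. \<omega> k * of_int (n k) * x k)"

lemma wave_mult: "wave m \<omega> n x * wave m \<omega> n' x = wave m \<omega> (\<lambda>k. n k + n' k) x"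
  unfolding wave_def cis_mult by (simp add: sum.distrib algebra_simps)

lemma cnj_wave: "cnj (wave m \<omega> n x) = wave m \<omega> (\<lambda>k. - n k) x"
  unfolding wave_def cis_cnj by (simp add: sum_negf)

lemma wave_0: "wave m \<omega> (\<lambda>k. 0) x = 1" unfolding wave_def by simp

lemma continuous_on_wave: "continuous_on S (wave m \<omega> n)"
  unfolding wave_def[abs_def]
  by (intro continuous_intros continuous_on_product_then_coordinatewise[OF continuous_on_id])

lemma has_partial_wave:
  assumes "k < m"
  shows "has_partial m k (wave m \<omega> n) (\<lambda>x. \<i> * of_real (\<omega> k * of_int (n k)) * wave m \<omega> n x)"
  unfolding has_partial_def
proof
  fix x :: point
  \<comment> \<open>Along the \<open>k\<close>-th coordinate line the phase is affine, with constant
    term \<open>r\<close>.\<close>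
  define r where "r = (\<Sum>j\<in>{..<m} - {k}. \<omega> j * of_int (n j) * x j)"
  have *: "(\<Sum>j<m. \<omega> j * of_int (n j) * (x(k := t)) j) = r + \<omega> k * of_int (n k) * t" for t
    using assms by (subst sum.remove[of _ k]) (auto simp: r_def)
  have "((\<lambda>t. cis (r + \<omega> k * of_int (n k) * t)) has_vector_derivative
      (\<omega> k * of_int (n k)) *\<^sub>R (\<i> * cis (r + \<omega> k * of_int (n k) * x k))) (at (x k))"
  proof -
    have "((\<lambda>z. exp (\<i> * (of_real r + of_real (\<omega> k * of_int (n k)) * z))) has_field_derivative
        exp (\<i> * (of_real r + of_real (\<omega> k * of_int (n k)) * of_real (x k))) *
          (\<i> * of_real (\<omega> k * of_int (n k)))) (at (of_real (x k)))"
      by (auto intro!: derivative_eq_intros)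
    from has_vector_derivative_real_field[OF this] show ?thesis
      by (simp add: cis_conv_exp scaleR_conv_of_real mult_ac)
  qed
  then show "((\<lambda>t. wave m \<omega> n (x(k := t))) has_vector_derivative
      \<i> * of_real (\<omega> k * of_int (n k)) * wave m \<omega> n x) (at (x k))"
    unfolding wave_def * using *[of "x k"] by (simp add: scaleR_conv_of_real mult_ac)
qed

lemma smooth_fun_wave: "smooth_fun m (wave m \<omega> n)"
proof (rule smooth_fun_coinduct[where S = "range (\<lambda>c x. c * wave m \<omega> n x)"])
  show "wave m \<omega> n \<in> range (\<lambda>c x. c * wave m \<omega> n x)" by (rule range_eqI[of _ _ 1]) simp
next
  fix v :: cfun and k assume "v \<in> range (\<lambda>c x. c * wave m \<omega> n x)"
  then obtain c where v: "v = (\<lambda>x. c * wave m \<omega> n x)" by blast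
  show "continuous_on (real_space m) v" unfolding v by (intro continuous_intros continuous_on_wave)
  assume "k < m"
  from has_partial_cmult[OF has_partial_wave[OF this, of \<omega> n], of c]
  have "has_partial m k v (\<lambda>x. (c * (\<i> * of_real (\<omega> k * of_int (n k)))) * wave m \<omega> n x)"
    unfolding v by (simp only: mult.assoc)
  moreover have "(\<lambda>x. (c * (\<i> * of_real (\<omega> k * of_int (n k)))) * wave m \<omega> n x) \<in>
      range (\<lambda>c x. c * wave m \<omega> n x)"
    by (rule rangeI)
  ultimately show "\<exists>v'\<in>range (\<lambda>c x. c * wave m \<omega> n x). has_partial m k v v'"
    by (rule bexI)
qed

text \<open>This is the condition in \<open>smooth_per\<close> with the endpoints fixed. The value
  type is left open so that it also applies to real and imaginary parts.\<close>

definition periodic :: "nat \<Rightarrow> (nat \<Rightarrow> real) \<Rightarrow> (nat \<Rightarrow> real) \<Rightarrow> (point \<Rightarrow> 'b) \<Rightarrow> bool" where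
  "periodic m a b u \<longleftrightarrow> (\<forall>x\<in>real_space m. \<forall>i<m. u (x(i := x i + (b i - a i))) = u x)"

definition period_freq :: "(nat \<Rightarrow> real) \<Rightarrow> (nat \<Rightarrow> real) \<Rightarrow> nat \<Rightarrow> real" where
  "period_freq a b k = 2 * pi / (b k - a k)"

lemma periodic_wave:
  assumes "\<And>i. i < m \<Longrightarrow> a i < b i"
  shows "periodic m a b (wave m (period_freq a b) n)"
  unfolding periodic_def
proof (intro ballI allI impI)
  fix x :: point and i assume i: "i < m"
  let ?\<omega> = "period_freq a b"
  have "(\<Sum>k<m. ?\<omega> k * of_int (n k) * (x(i := x i + (b i - a i))) k) =
      (\<Sum>k<m. ?\<omega> k * of_int (n k) * x k + (if k = i then ?\<omega> i * of_int (n i) * (b i - a i) else 0))"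
    by (intro sum.cong) (auto simp: algebra_simps)
  also have "\<dots> = (\<Sum>k<m. ?\<omega> k * of_int (n k) * x k) + ?\<omega> i * of_int (n i) * (b i - a i)"
    using i by (simp add: sum.distrib)
  also have "?\<omega> i * of_int (n i) * (b i - a i) = 2 * pi * of_int (n i)"
    using assms[OF i] by (simp add: period_freq_def)
  finally have eq: "(\<Sum>k<m. ?\<omega> k * of_int (n k) * (x(i := x i + (b i - a i))) k) =
      (\<Sum>k<m. ?\<omega> k * of_int (n k) * x k) + 2 * pi * of_int (n i)" .
  show "wave m ?\<omega> n (x(i := x i + (b i - a i))) = wave m ?\<omega> n x"
    unfolding wave_def eq cis_mult[symmetric] by (simp add: cis_multiple_2pi)
qed

lemma periodic_faces:
  assumes "periodic m a b u" "x \<in> real_space m" "k < m"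
  shows "u (x(k := a k)) = u (x(k := b k))"
proof -
  have "u ((x(k := a k))(k := (x(k := a k)) k + (b k - a k))) = u (x(k := a k))"
    using assms(1,3) fun_upd_real_space[OF assms(2,3), of "a k"] unfolding periodic_def by blast
  then show ?thesis by simp
qed

lemma periodic_shift_int:
  assumes u: "periodic m a b u" and x: "x \<in> real_space m" and k: "k < m"
  shows "u (x(k := x k + of_int z * (b k - a k))) = u x"
proof -
  let ?h = "\<lambda>z::int. x(k := x k + of_int z * (b k - a k))"
  have step: "u (?h (z + 1)) = u (?h z)" for z
  proof -
    have "?h z \<in> real_space m" by (rule fun_upd_real_space[OF x k])
    then have "u ((?h z)(k := (?h z) k + (b k - a k))) = u (?h z)" using u k unfolding periodic_def by blast
    moreover have "(?h z)(k := (?h z) k + (b k - a k)) = ?h (z + 1)" by (simp add: algebra_simps)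
    ultimately show ?thesis by simp
  qed
  have "u (?h z) = u (?h 0)"
  proof (induction z rule: int_induct[where k = 0])
    case (step1 i)
    from step[of i] step1(2) show ?case by (rule trans)
  next
    case (step2 i)
    have "u (?h i) = u (?h (i - 1))" using step[of "i - 1"] by (simp only: diff_add_cancel)
    from trans[OF this[symmetric] step2(2)] show ?case .
  qed simp
  then show ?thesis by simp
qed

text \<open>The coordinates of \<open>x\<close> are exchanged for those of \<open>y\<close> one at a
  time, each exchange being a shift by a whole number of periods.\<close>

lemma periodic_eq:
  assumes u: "periodic m a b u" and x: "x \<in> real_space m" and y: "y \<in> real_space m"
    and shift: "\<And>k. k < m \<Longrightarrow> \<exists>z::int. y k = x k + of_int z * (b k - a k)"
  shows "u y = u x"
proof -
  have "u (\<lambda>i. if i < j then y i else x i) = u x" if "j \<le> m" for j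
    using that
  proof (induction j)
    case (Suc j)
    let ?w = "\<lambda>i. if i < j then y i else x i"
    from Suc obtain z :: int where "y j = x j + of_int z * (b j - a j)" using shift[of j] by auto
    then have "(\<lambda>i. if i < Suc j then y i else x i) = ?w(j := ?w j + of_int z * (b j - a j))"
      by (auto simp: fun_eq_iff less_Suc_eq)
    moreover have "?w \<in> real_space m" using x y Suc.prems by (auto simp: PiE_iff extensional_def)
    ultimately show ?case using periodic_shift_int[OF u, of ?w j z] Suc by simp
  qed simp
  moreover have "(\<lambda>i. if i < m then y i else x i) = y"
    using x y by (auto simp: fun_eq_iff PiE_iff extensional_def)
  ultimately show ?thesis by (metis order_refl)
qed

inductive_set trig_poly :: "nat \<Rightarrow> (nat \<Rightarrow> real) \<Rightarrow> cfun set" for m \<omega> where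
  wave: "(\<And>k. k \<ge> m \<Longrightarrow> n k = 0) \<Longrightarrow> wave m \<omega> n \<in> trig_poly m \<omega>"
| cmult: "p \<in> trig_poly m \<omega> \<Longrightarrow> (\<lambda>x. c * p x) \<in> trig_poly m \<omega>"
| add: "p \<in> trig_poly m \<omega> \<Longrightarrow> q \<in> trig_poly m \<omega> \<Longrightarrow> (\<lambda>x. p x + q x) \<in> trig_poly m \<omega>"

lemma trig_poly_mult:
  assumes "p \<in> trig_poly m \<omega>" "q \<in> trig_poly m \<omega>"
  shows "(\<lambda>x. p x * q x) \<in> trig_poly m \<omega>"
  using assms(1)
proof induction
  case (wave n)
  show ?case using assms(2)
  proof induction
    case (wave n')
    show ?case unfolding wave_mult
      by (rule trig_poly.wave) (simp add: wave.hyps \<open>\<And>k. m \<le> k \<Longrightarrow> n k = 0\<close>)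
  next
    case (cmult q c)
    from trig_poly.cmult[OF this(2), of c] show ?case by (simp only: mult_ac)
  next
    case (add q q')
    from trig_poly.add[OF this(3,4)] show ?case by (simp only: distrib_left)
  qed
next
  case (cmult p c)
  from trig_poly.cmult[OF this(2), of c] show ?case by (simp only: mult.assoc)
next
  case (add p p')
  from trig_poly.add[OF this(3,4)] show ?case by (simp only: distrib_right)
qed

lemma trig_poly_const: "(\<lambda>x. c) \<in> trig_poly m \<omega>"
  using trig_poly.cmult[OF trig_poly.wave[of m "\<lambda>k. 0"], of c] by (simp add: wave_0)

text \<open>The inductive form suits closure under products; the best-approximation argument needs a
  linear combination over a finite set of indices. Coefficients are extended by 0 to the union of
  two index sets.\<close>

lemma trig_poly_sum_waves:
  assumes "p \<in> trig_poly m \<omega>"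
  shows "\<exists>F c. finite F \<and> F \<subseteq> {n. \<forall>k\<ge>m. n k = 0} \<and> p = (\<lambda>x. \<Sum>n\<in>F. c n * wave m \<omega> n x)"
  using assms
proof induction
  case (wave n)
  then show ?case by (intro exI[of _ "{n}"] exI[of _ "\<lambda>_. 1"]) auto
next
  case (cmult p c)
  then obtain F d where "finite F" "F \<subseteq> {n. \<forall>k\<ge>m. n k = 0}" "p = (\<lambda>x. \<Sum>n\<in>F. d n * wave m \<omega> n x)" by blast
  then show ?case by (intro exI[of _ F] exI[of _ "\<lambda>n. c * d n"]) (auto simp: sum_distrib_left mult.assoc)
next
  case (add p q)
  then obtain F d G e where F: "finite F" "F \<subseteq> {n. \<forall>k\<ge>m. n k = 0}" "p = (\<lambda>x. \<Sum>n\<in>F. d n * wave m \<omega> n x)"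
    and G: "finite G" "G \<subseteq> {n. \<forall>k\<ge>m. n k = 0}" "q = (\<lambda>x. \<Sum>n\<in>G. e n * wave m \<omega> n x)" by blast
  have "p x + q x = (\<Sum>n\<in>F \<union> G. ((if n \<in> F then d n else 0) + (if n \<in> G then e n else 0)) * wave m \<omega> n x)" for x
  proof -
    have "p x = (\<Sum>n\<in>F \<union> G. (if n \<in> F then d n else 0) * wave m \<omega> n x)"
      unfolding F(3) using F(1) G(1) by (intro sum.mono_neutral_cong_left) auto
    moreover have "q x = (\<Sum>n\<in>F \<union> G. (if n \<in> G then e n else 0) * wave m \<omega> n x)"
      unfolding G(3) using F(1) G(1) by (intro sum.mono_neutral_cong_left) auto
    ultimately show ?thesis by (simp add: distrib_right sum.distrib)
  qed
  then show ?case
    using F(1,2) G(1,2)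
    by (intro exI[of _ "F \<union> G"] exI[of _ "\<lambda>n. (if n \<in> F then d n else 0) + (if n \<in> G then e n else 0)"]) auto
qed

text \<open>A continuous map from a compact space to a Hausdorff space is closed, hence a quotient
  map onto its image: the preimage of a closed set under \<open>W\<close> is the image of a compact
  set.\<close>

lemma continuous_on_factor:
  fixes E :: "'a::t2_space \<Rightarrow> 'b::t2_space" and w :: "'a \<Rightarrow> 'c::topological_space"
  assumes S: "compact S" and E: "continuous_on S E" and w: "continuous_on S w"
    and W: "\<And>x. x \<in> S \<Longrightarrow> W (E x) = w x"
  shows "continuous_on (E ` S) W"
proof -
  have "closed (E ` S)" by (intro compact_imp_closed compact_continuous_image E S)
  moreover have "closed (W -` B \<inter> E ` S)" if "closed B" for B
  proof -
    have "closedin (top_of_set S) (S \<inter> w -` B)" using continuous_closedin_preimage[OF w that] .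
    then have "compact (S \<inter> w -` B)" using S closedin_compact by blast
    then have "compact (E ` (S \<inter> w -` B))"
      by (intro compact_continuous_image continuous_on_subset[OF E]) auto
    moreover have "E ` (S \<inter> w -` B) = W -` B \<inter> E ` S" using W by auto
    ultimately show ?thesis by (metis compact_imp_closed)
  qed
  ultimately show ?thesis by (subst continuous_on_closed_vimage) auto
qed

text \<open>Stone--Weierstrass on the torus, which is the image of the closed box under \<open>E\<close>.\<close>

lemma trig_poly_dense_real:
  fixes w :: "point \<Rightarrow> real"
  assumes ab: "\<And>i. i < m \<Longrightarrow> a i < b i" and cont: "continuous_on (real_space m) w"
    and per: "periodic m a b w" and "\<epsilon> > 0"
  shows "\<exists>p\<in>trig_poly m (period_freq a b). \<forall>x\<in>open_box m a b. cmod (of_real (w x) - p x) < \<epsilon>"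
proof -
  let ?\<omega> = "period_freq a b"
  define C where "C = (\<Pi>\<^sub>E i\<in>{..<m}. {a i..b i})"
  \<comment> \<open>Each coordinate is wrapped once around the unit circle. The filler 0 from
    \<open>m\<close> on ensures that distinct image points differ in a coordinate below
    \<open>m\<close>.\<close>
  define E where "E x = (\<lambda>k. if k < m then cis (?\<omega> k * x k) else 0)" for x :: point
  have C: "compact C" "C \<subseteq> real_space m" unfolding C_def by (auto intro: compact_PiE_interval)
  have contE: "continuous_on C E" unfolding E_def[abs_def]
  proof (rule continuous_on_coordinatewise_then_product)
    show "continuous_on C (\<lambda>x. if k < m then cis (?\<omega> k * x k) else 0)" for k
      by (cases "k < m") (auto intro!: continuous_intros continuous_on_product_then_coordinatewise[OF continuous_on_id])
  qed
  \<comment> \<open>Equal phases mean that the coordinates differ by whole periods; points on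
    opposite faces are among those identified.\<close>
  have inj: "w x = w y" if "x \<in> C" "y \<in> C" "E x = E y" for x y
  proof (rule periodic_eq[OF per])
    show "x \<in> real_space m" "y \<in> real_space m" using that C(2) by auto
    fix k assume k: "k < m"
    have "cis (?\<omega> k * x k) = cis (?\<omega> k * y k)" using fun_cong[OF that(3), of k] k by (simp add: E_def)
    then have "sin (?\<omega> k * x k) = sin (?\<omega> k * y k) \<and> cos (?\<omega> k * x k) = cos (?\<omega> k * y k)"
      by (simp add: complex_eq_iff)
    then obtain z :: int where "?\<omega> k * x k = ?\<omega> k * y k + 2 * pi * of_int z"
      unfolding sin_cos_eq_iff by auto
    then have "2 * pi * (x k - y k) = 2 * pi * (of_int z * (b k - a k))"
      using ab[OF k] unfolding period_freq_def by (simp add: field_simps)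
    then have "x k = y k + of_int z * (b k - a k)" by simp
    then show "\<exists>z::int. x k = y k + of_int z * (b k - a k)" by blast
  qed
  \<comment> \<open>A preimage is chosen arbitrarily; by \<open>inj\<close> the value of
    \<open>w\<close> does not depend on the choice.\<close>
  define W where "W z = w (inv_into C E z)" for z
  have W: "W (E x) = w x" if "x \<in> C" for x
    unfolding W_def
    by (rule inj[OF inv_into_into[OF imageI[OF that]] that f_inv_into_f[OF imageI[OF that]]])
  \<comment> \<open>The continuous real functions on the torus whose pullbacks to the closed box are
    trigonometric polynomials. They form an algebra because products of waves are waves.\<close>
  define R where "R = {g :: (nat \<Rightarrow> complex) \<Rightarrow> real. continuous_on (E ` C) g \<and>
      (\<exists>p\<in>trig_poly m ?\<omega>. \<forall>x\<in>C. of_real (g (E x)) = p x)}"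
  have RI: "g \<in> R" if "p \<in> trig_poly m ?\<omega>" "\<And>x. of_real (g (E x)) = p x" "continuous_on (E ` C) g" for g p
    unfolding R_def using that by (intro CollectI conjI bexI[of _ p]) auto
  interpret function_ring_on R "E ` C"
  proof
    show "compact (E ` C)" by (intro compact_continuous_image contE C)
    show "continuous_on (E ` C) f" if "f \<in> R" for f using that unfolding R_def by auto
    fix f g assume "f \<in> R" "g \<in> R"
    then obtain p q where *: "continuous_on (E ` C) f" "continuous_on (E ` C) g"
      "p \<in> trig_poly m ?\<omega>" "q \<in> trig_poly m ?\<omega>"
      "\<And>x. x \<in> C \<Longrightarrow> of_real (f (E x)) = p x" "\<And>x. x \<in> C \<Longrightarrow> of_real (g (E x)) = q x"
      unfolding R_def by blast
    show "(\<lambda>x. f x + g x) \<in> R" unfolding R_def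
      using trig_poly.add[OF *(3,4)] *(1,2,5,6)
      by (auto intro!: continuous_intros bexI[of _ "\<lambda>x. p x + q x"])
    show "(\<lambda>x. f x * g x) \<in> R" unfolding R_def
      using trig_poly_mult[OF *(3,4)] *(1,2,5,6)
      by (auto intro!: continuous_intros bexI[of _ "\<lambda>x. p x * q x"])
  next
    show "(\<lambda>_. c) \<in> R" for c
      unfolding R_def using trig_poly_const[of "of_real c"] by (auto intro!: bexI[of _ "\<lambda>x. of_real c"])
  next
    fix z z' assume "z \<in> E ` C" "z' \<in> E ` C" "z \<noteq> z'"
    then obtain k where k: "z k \<noteq> z' k" "k < m" unfolding E_def by (auto simp: fun_eq_iff split: if_splits)
    define e where "e s = (\<lambda>j. if j = k then s else 0 :: int)" for s
    have e: "wave m ?\<omega> (e s) \<in> trig_poly m ?\<omega>" for s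
      by (rule trig_poly.wave) (use k in \<open>auto simp: e_def\<close>)
    have we: "wave m ?\<omega> (e s) x = cis (of_int s * (?\<omega> k * x k))" for s x
    proof -
      have "(\<Sum>j<m. ?\<omega> j * of_int (e s j) * x j) = (\<Sum>j<m. if j = k then ?\<omega> k * of_int s * x k else 0)"
        by (intro sum.cong) (auto simp: e_def)
      then show ?thesis unfolding wave_def using k(2) by (simp add: mult_ac)
    qed
    have c: "continuous_on (E ` C) (\<lambda>z. z k)"
      by (rule continuous_on_product_then_coordinatewise[OF continuous_on_id])
    \<comment> \<open>The real and imaginary parts of a torus coordinate are a cosine and a sine,
      combinations of the waves with index 1 and -1 in direction \<open>k\<close>. One of the two
      separates the given points.\<close>
    have "(\<lambda>x. (1/2) * wave m ?\<omega> (e 1) x + (1/2) * wave m ?\<omega> (e (- 1)) x) \<in> trig_poly m ?\<omega>"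
      by (intro trig_poly.add trig_poly.cmult e)
    moreover have "of_real (Re (E x k)) = (1/2) * wave m ?\<omega> (e 1) x + (1/2) * wave m ?\<omega> (e (- 1)) x" for x
      using k(2) by (simp add: we E_def complex_eq_iff)
    moreover have "continuous_on (E ` C) (\<lambda>z. Re (z k))" by (intro continuous_intros c)
    ultimately have R1: "(\<lambda>z. Re (z k)) \<in> R" by (rule RI)
    have "(\<lambda>x. (- \<i>/2) * wave m ?\<omega> (e 1) x + (\<i>/2) * wave m ?\<omega> (e (- 1)) x) \<in> trig_poly m ?\<omega>"
      by (intro trig_poly.add trig_poly.cmult e)
    moreover have "of_real (Im (E x k)) = (- \<i>/2) * wave m ?\<omega> (e 1) x + (\<i>/2) * wave m ?\<omega> (e (- 1)) x" for x
      using k(2) by (simp add: we E_def complex_eq_iff)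
    moreover have "continuous_on (E ` C) (\<lambda>z. Im (z k))" by (intro continuous_intros c)
    ultimately have "(\<lambda>z. Im (z k)) \<in> R" by (rule RI)
    moreover have "Re (z k) \<noteq> Re (z' k) \<or> Im (z k) \<noteq> Im (z' k)" using k(1) by (simp add: complex_eq_iff)
    ultimately show "\<exists>f\<in>R. f z \<noteq> f z'" using R1
      by (elim disjE) (rule bexI[of _ "\<lambda>z. Re (z k)"] bexI[of _ "\<lambda>z. Im (z k)"]; assumption)+
  qed
  have "continuous_on (E ` C) W"
    using continuous_on_factor[of C E w W, OF C(1) contE continuous_on_subset[OF cont C(2)]] W by simp
  from Stone_Weierstrass_basic[OF this \<open>\<epsilon> > 0\<close>]
  obtain g where g: "g \<in> R" "\<forall>z\<in>E ` C. \<bar>W z - g z\<bar> < \<epsilon>" by auto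
  then obtain p where p: "p \<in> trig_poly m ?\<omega>" "\<And>x. x \<in> C \<Longrightarrow> of_real (g (E x)) = p x"
    unfolding R_def by blast
  have "cmod (of_real (w x) - p x) < \<epsilon>" if "x \<in> open_box m a b" for x
  proof -
    have "x \<in> C" using that unfolding C_def by (simp add: PiE_iff less_imp_le)
    then have "\<bar>w x - g (E x)\<bar> < \<epsilon>" using g(2) W by fastforce
    then show ?thesis using p(2)[OF \<open>x \<in> C\<close>] by (metis norm_of_real of_real_diff)
  qed
  with p(1) show ?thesis by blast
qed

text \<open>The approximation of real functions is applied to the real and the imaginary part;
  complex coefficients allow the two approximants to be combined into one.\<close>

lemma trig_poly_dense:
  assumes ab: "\<And>i. i < m \<Longrightarrow> a i < b i" and cont: "continuous_on (real_space m) u"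
    and per: "periodic m a b u" and "\<epsilon> > 0"
  shows "\<exists>p\<in>trig_poly m (period_freq a b). \<forall>x\<in>open_box m a b. cmod (u x - p x) < \<epsilon>"
proof -
  have e: "\<epsilon> / 2 > 0" using \<open>\<epsilon> > 0\<close> by simp
  have "continuous_on (real_space m) (\<lambda>x. Re (u x))" "periodic m a b (\<lambda>x. Re (u x))"
    "continuous_on (real_space m) (\<lambda>x. Im (u x))" "periodic m a b (\<lambda>x. Im (u x))"
    using cont per by (auto intro!: continuous_intros simp: periodic_def)
  note uR = this
  obtain p where p: "p \<in> trig_poly m (period_freq a b)"
      "\<And>x. x \<in> open_box m a b \<Longrightarrow> cmod (of_real (Re (u x)) - p x) < \<epsilon> / 2"
    using trig_poly_dense_real[OF ab uR(1,2) e] by blast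
  obtain q where q: "q \<in> trig_poly m (period_freq a b)"
      "\<And>x. x \<in> open_box m a b \<Longrightarrow> cmod (of_real (Im (u x)) - q x) < \<epsilon> / 2"
    using trig_poly_dense_real[OF ab uR(3,4) e] by blast
  have "cmod (u x - (p x + \<i> * q x)) < \<epsilon>" if "x \<in> open_box m a b" for x
  proof -
    have "u x - (p x + \<i> * q x) = (of_real (Re (u x)) - p x) + \<i> * (of_real (Im (u x)) - q x)"
      by (subst complex_eq[of "u x"]) (simp add: algebra_simps)
    also have "cmod \<dots> \<le> cmod (of_real (Re (u x)) - p x) + cmod (\<i> * (of_real (Im (u x)) - q x))"
      by (rule norm_triangle_ineq)
    also have "\<dots> < \<epsilon>" using p(2)[OF that] q(2)[OF that] by (simp add: norm_mult)
    finally show ?thesis .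
  qed
  moreover have "(\<lambda>x. p x + \<i> * q x) \<in> trig_poly m (period_freq a b)"
    by (intro trig_poly.add trig_poly.cmult p q)
  ultimately show ?thesis by (intro bexI[of _ "\<lambda>x. p x + \<i> * q x"]) auto
qed

subsection \<open>Partial Fourier sums\<close>

lemma measure_open_box_pos:
  assumes "\<And>i. i < m \<Longrightarrow> a i < b i"
  shows "measure (leb m (open_box m a b)) (open_box m a b) > 0"
proof -
  have "emeasure (leb m (open_box m a b)) (open_box m a b) = (\<Prod>i<m. emeasure lborel {a i<..<b i})"
    unfolding leb_def by (subst emeasure_restrict_space)
      (auto intro: sets.Int sets_open_box simp: lborel_product.emeasure_PiM)
  also have "\<dots> = (\<Prod>i<m. ennreal (b i - a i))"
    using assms by (intro prod.cong) (auto intro!: emeasure_lborel_Ioo less_imp_le)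
  also have "\<dots> = ennreal (\<Prod>i<m. b i - a i)"
    using assms by (intro prod_ennreal) (auto intro: less_imp_le)
  finally have "emeasure (leb m (open_box m a b)) (open_box m a b) = ennreal (\<Prod>i<m. b i - a i)" .
  moreover have "(\<Prod>i<m. b i - a i) > 0" using assms by (intro prod_pos) simp
  ultimately show ?thesis by (simp add: measure_def)
qed

text \<open>Up to a nonzero constant the wave is its own \<open>k\<close>-th partial, and it takes
  equal values on opposite faces.\<close>

lemma integral_wave_eq_0:
  assumes ab: "\<And>i. i < m \<Longrightarrow> a i < b i" and k: "k < m" "n k \<noteq> 0"
  shows "(\<integral>x. wave m (period_freq a b) n x \<partial>leb m (open_box m a b)) = 0"
proof -
  let ?\<omega> = "period_freq a b"
  let ?c = "\<i> * of_real (?\<omega> k * of_int (n k))"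
  have "(\<integral>x. ?c * wave m ?\<omega> n x \<partial>leb m (open_box m a b)) = 0"
    using ab[OF k(1)]
    by (intro integral_partial_eq_0[OF k(1) _ _ has_partial_wave[OF k(1)]] periodic_faces[OF periodic_wave[OF ab]] k)
       (auto intro!: continuous_intros continuous_on_wave)
  then have "?c * (\<integral>x. wave m ?\<omega> n x \<partial>leb m (open_box m a b)) = 0" by simp
  moreover have "?c \<noteq> 0" using ab[OF k(1)] k(2) unfolding period_freq_def by simp
  ultimately show ?thesis using mult_eq_0_iff by blast
qed

lemma integral_wave_orthogonal:
  assumes ab: "\<And>i. i < m \<Longrightarrow> a i < b i"
    and n: "\<And>k. k \<ge> m \<Longrightarrow> n k = 0" and n': "\<And>k. k \<ge> m \<Longrightarrow> n' k = 0"
  shows "(\<integral>x. wave m (period_freq a b) n x * cnj (wave m (period_freq a b) n' x) \<partial>leb m (open_box m a b)) =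
    (if n = n' then of_real (measure (leb m (open_box m a b)) (open_box m a b)) else 0)"
proof (cases "n = n'")
  case True
  then show ?thesis
    by (simp add: cnj_wave wave_mult wave_0 scaleR_conv_of_real)
next
  case False
  then obtain k where "n k \<noteq> n' k" by blast
  then have "k < m" "n k + - n' k \<noteq> 0" using n[of k] n'[of k] by (cases "k < m", auto)
  from integral_wave_eq_0[OF ab this(1), where n = "\<lambda>k. n k + - n' k"] this(2)
  show ?thesis using False by (simp add: cnj_wave wave_mult)
qed

definition fourier_coeff :: "nat \<Rightarrow> (nat \<Rightarrow> real) \<Rightarrow> (nat \<Rightarrow> real) \<Rightarrow> cfun \<Rightarrow> (nat \<Rightarrow> int) \<Rightarrow> complex" where
  "fourier_coeff m a b v n =
     (\<integral>x. v x * cnj (wave m (period_freq a b) n x) \<partial>leb m (open_box m a b)) /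
     of_real (measure (leb m (open_box m a b)) (open_box m a b))"

lemma continuous_on_wave_sum: "continuous_on S (\<lambda>x. \<Sum>n\<in>F. c n * wave m \<omega> n x)"
  by (intro continuous_intros continuous_on_wave)

text \<open>The Fourier sum is the orthogonal projection of \<open>v\<close>: orthogonality leaves
  only the index \<open>n\<close> in the sum, and the coefficient is divided by the measure of the
  box, the squared norm of a wave.\<close>

lemma integral_fourier_residual_eq_0:
  assumes ab: "\<And>i. i < m \<Longrightarrow> a i < b i" and F: "finite F" "F \<subseteq> {n. \<forall>k\<ge>m. n k = 0}"
    and v: "v \<in> L2_space m (open_box m a b)" and n: "n \<in> F"
  defines "\<omega> \<equiv> period_freq a b"
  shows "(\<integral>x. (v x - (\<Sum>n\<in>F. fourier_coeff m a b v n * wave m \<omega> n x)) * cnj (wave m \<omega> n x)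
      \<partial>leb m (open_box m a b)) = 0"
proof -
  let ?M = "leb m (open_box m a b)" and ?c = "fourier_coeff m a b v"
  let ?V = "measure ?M (open_box m a b)"
  have w: "continuous_on (real_space m) (\<lambda>x. cnj (wave m \<omega> n x))"
    by (intro continuous_intros continuous_on_wave)
  have i: "integrable ?M (\<lambda>x. ?c j * (wave m \<omega> j x * cnj (wave m \<omega> n x)))" for j
    by (intro integrable_leb_continuous continuous_intros continuous_on_wave)
  have "(\<integral>x. (v x - (\<Sum>j\<in>F. ?c j * wave m \<omega> j x)) * cnj (wave m \<omega> n x) \<partial>?M) =
      (\<integral>x. v x * cnj (wave m \<omega> n x) - (\<Sum>j\<in>F. ?c j * (wave m \<omega> j x * cnj (wave m \<omega> n x))) \<partial>?M)"
    by (simp add: left_diff_distrib sum_distrib_right mult.assoc)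
  also have "\<dots> = (\<integral>x. v x * cnj (wave m \<omega> n x) \<partial>?M) -
      (\<integral>x. (\<Sum>j\<in>F. ?c j * (wave m \<omega> j x * cnj (wave m \<omega> n x))) \<partial>?M)"
    by (intro Bochner_Integration.integral_diff integrable_L2_mult_continuous[OF v w]
        Bochner_Integration.integrable_sum i)
  also have "(\<integral>x. (\<Sum>j\<in>F. ?c j * (wave m \<omega> j x * cnj (wave m \<omega> n x))) \<partial>?M) =
      (\<Sum>j\<in>F. \<integral>x. ?c j * (wave m \<omega> j x * cnj (wave m \<omega> n x)) \<partial>?M)"
    by (rule Bochner_Integration.integral_sum[OF i])
  also have "\<dots> = (\<Sum>j\<in>F. ?c j * (if j = n then of_real ?V else 0))"
    unfolding \<omega>_def using F(2) n
    by (intro sum.cong refl) (subst integral_wave_orthogonal[OF ab, symmetric], auto)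
  also have "\<dots> = ?c n * of_real ?V" using F(1) n by (simp add: if_distrib cong: if_cong)
  also have "\<dots> = (\<integral>x. v x * cnj (wave m \<omega> n x) \<partial>?M)"
    using measure_open_box_pos[of m a b, OF ab] unfolding fourier_coeff_def \<omega>_def by simp
  finally show ?thesis by simp
qed

text \<open>A competitor differs from the Fourier sum by a combination \<open>s\<close> of the same
  waves, which is orthogonal to the residual \<open>r\<close>; so the squared norm of r + s is the
  sum of the two squared norms.\<close>

lemma fourier_best_approximation:
  assumes ab: "\<And>i. i < m \<Longrightarrow> a i < b i" and F: "finite F" "F \<subseteq> {n. \<forall>k\<ge>m. n k = 0}"
    and v: "v \<in> L2_space m (open_box m a b)"
  defines "\<omega> \<equiv> period_freq a b"
  shows "sq m (open_box m a b) (\<lambda>x. v x - (\<Sum>n\<in>F. fourier_coeff m a b v n * wave m \<omega> n x)) \<le>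
    sq m (open_box m a b) (\<lambda>x. v x - (\<Sum>n\<in>F. c n * wave m \<omega> n x))"
proof -
  let ?Q = "open_box m a b" and ?M = "leb m (open_box m a b)"
  define r where "r x = v x - (\<Sum>n\<in>F. fourier_coeff m a b v n * wave m \<omega> n x)" for x
  define s where "s x = (\<Sum>n\<in>F. (fourier_coeff m a b v n - c n) * wave m \<omega> n x)" for x
  have cs: "continuous_on (real_space m) s" unfolding s_def[abs_def] by (rule continuous_on_wave_sum)
  have r: "r \<in> L2_space m ?Q" unfolding r_def[abs_def]
    by (intro L2_space_diff v L2_space_continuous continuous_on_wave_sum)
  have s: "s \<in> L2_space m ?Q" by (rule L2_space_continuous[OF cs])
  have cw: "continuous_on (real_space m) (\<lambda>x. cnj (wave m \<omega> n x))" for n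
    by (intro continuous_intros continuous_on_wave)
  have "(\<integral>x. r x * cnj (s x) \<partial>?M) =
      (\<integral>x. (\<Sum>n\<in>F. cnj (fourier_coeff m a b v n - c n) * (r x * cnj (wave m \<omega> n x))) \<partial>?M)"
    unfolding s_def by (simp add: sum_distrib_left mult_ac)
  also have "\<dots> = (\<Sum>n\<in>F. \<integral>x. cnj (fourier_coeff m a b v n - c n) * (r x * cnj (wave m \<omega> n x)) \<partial>?M)"
    by (intro Bochner_Integration.integral_sum integrable_mult_right integrable_L2_mult_continuous r cw)
  also have "\<dots> = (\<Sum>n\<in>F. cnj (fourier_coeff m a b v n - c n) * 0)"
  proof (intro sum.cong refl)
    fix n assume "n \<in> F"
    from integral_fourier_residual_eq_0[OF ab F v this, folded \<omega>_def]
    show "(\<integral>x. cnj (fourier_coeff m a b v n - c n) * (r x * cnj (wave m \<omega> n x)) \<partial>?M) =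
        cnj (fourier_coeff m a b v n - c n) * 0"
      unfolding r_def by (subst integral_mult_right_zero) simp
  qed
  finally have orth: "(\<integral>x. r x * cnj (s x) \<partial>?M) = 0" by simp
  have irs: "integrable ?M (\<lambda>x. r x * cnj (s x))"
    by (intro integrable_L2_mult_continuous[OF r] continuous_intros cs)
  define C where "C x = Re (r x * cnj (s x))" for x
  have iC: "integrable ?M C" unfolding C_def by (rule integrable_Re[OF irs])
  have "sq m ?Q (\<lambda>x. r x + s x) = (\<integral>x. (cmod (r x))\<^sup>2 + (cmod (s x))\<^sup>2 + 2 * C x \<partial>?M)"
    unfolding sq_def
    by (intro Bochner_Integration.integral_cong refl, unfold C_def cmod_power2)
      (simp add: power2_eq_square algebra_simps)
  also have "\<dots> = sq m ?Q r + sq m ?Q s + 2 * (\<integral>x. C x \<partial>?M)"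
    unfolding sq_def using L2_spaceD(2)[OF r] L2_spaceD(2)[OF s] iC by simp
  also have "(\<integral>x. C x \<partial>?M) = Re (\<integral>x. r x * cnj (s x) \<partial>?M)"
    unfolding C_def by (rule integral_bounded_linear[OF bounded_linear_Re irs])
  also have "\<dots> = 0" unfolding orth by simp
  finally have "sq m ?Q r \<le> sq m ?Q (\<lambda>x. r x + s x)" using sq_nonneg[of m ?Q s] by simp
  moreover have "r x + s x = v x - (\<Sum>n\<in>F. c n * wave m \<omega> n x)" for x
    unfolding r_def s_def by (simp add: left_diff_distrib sum_subtractf)
  ultimately show ?thesis unfolding r_def by simp
qed

text \<open>The slices of \<open>u\<close> through a point and through its translate are compared.
  For k different from i they coincide; for k = i they differ by a translation of the parameter,
  whose derivative is 1. Uniqueness of the derivative concludes.\<close>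

lemma periodic_partial:
  assumes u: "periodic m a b u" and d: "has_partial m k u u'" and k: "k < m"
  shows "periodic m a b u'"
  unfolding periodic_def
proof (intro ballI allI impI)
  fix x :: point and i assume x: "x \<in> real_space m" and i: "i < m"
  let ?y = "x(i := x i + (b i - a i))"
  have y: "?y \<in> real_space m" by (rule fun_upd_real_space[OF x i])
  have d1: "((\<lambda>t. u (?y(k := t))) has_vector_derivative u' ?y) (at (?y k))"
    using d y unfolding has_partial_def by blast
  have d2: "((\<lambda>t. u (x(k := t))) has_vector_derivative u' x) (at (x k))"
    using d x unfolding has_partial_def by blast
  have per: "u (z(i := z i + (b i - a i))) = u z" if "z \<in> real_space m" for z
    using u i that unfolding periodic_def by blast
  show "u' ?y = u' x"
  proof (cases "k = i")
    case True
    have "u (?y(k := t)) = u (x(k := t - (b i - a i)))" for t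
      using per[OF fun_upd_real_space[OF x k, of "t - (b i - a i)"]] True by simp
    then have "((\<lambda>t. u (x(k := t - (b i - a i)))) has_vector_derivative u' ?y) (at (x k + (b i - a i)))"
      using d1 True by simp
    moreover have "((\<lambda>t. t - (b i - a i)) has_vector_derivative 1) (at (x k + (b i - a i)))"
      by (auto intro!: derivative_eq_intros)
    then have "(((\<lambda>t. u (x(k := t))) \<circ> (\<lambda>t. t - (b i - a i))) has_vector_derivative 1 *\<^sub>R u' x)
        (at (x k + (b i - a i)))"
      by (rule vector_diff_chain_at) (use d2 in simp)
    ultimately show ?thesis by (auto simp: o_def intro: vector_derivative_unique_at)
  next
    case False
    have "u (?y(k := t)) = u (x(k := t))" for t
      using per[OF fun_upd_real_space[OF x k, of t]] False by (simp add: fun_upd_twist)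
    then show ?thesis using d1 d2 False by (auto intro: vector_derivative_unique_at)
  qed
qed

text \<open>The product of \<open>u\<close> with the conjugate wave has equal values on opposite
  faces, so its \<open>k\<close>-th partial integrates to zero. Differentiating the wave produces
  the factor.\<close>

lemma fourier_coeff_partial:
  assumes ab: "\<And>i. i < m \<Longrightarrow> a i < b i" and k: "k < m"
    and u: "continuous_on (real_space m) u" "periodic m a b u"
    and u': "continuous_on (real_space m) u'" "has_partial m k u u'"
  shows "fourier_coeff m a b u' n = \<i> * of_real (period_freq a b k * of_int (n k)) * fourier_coeff m a b u n"
proof -
  let ?M = "leb m (open_box m a b)" and ?\<omega> = "period_freq a b"
  let ?w = "\<lambda>x. cnj (wave m ?\<omega> n x)" and ?c = "\<i> * of_real (?\<omega> k * of_int (n k))"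
  have cw: "continuous_on (real_space m) ?w" by (intro continuous_intros continuous_on_wave)
  have dw: "has_partial m k ?w (\<lambda>x. cnj (?c * wave m ?\<omega> n x))"
    by (rule has_partial_cnj[OF has_partial_wave[OF k]])
  have "(\<integral>x. u x * cnj (?c * wave m ?\<omega> n x) + u' x * ?w x \<partial>?M) = 0"
  proof (rule integral_partial_eq_0[OF k _ _ has_partial_mult[OF u'(2) dw]])
    show "a k \<le> b k" using ab[OF k] by simp
    show "continuous_on (real_space m) (\<lambda>x. u x * cnj (?c * wave m ?\<omega> n x) + u' x * ?w x)"
      by (intro continuous_intros u u' continuous_on_wave)
    show "u (x(k := a k)) * ?w (x(k := a k)) = u (x(k := b k)) * ?w (x(k := b k))"
      if "x \<in> real_space m" for x
      using periodic_faces[OF u(2) that k] periodic_faces[OF periodic_wave[of m a b, OF ab] that k] by simp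
  qed
  also have "(\<lambda>x. u x * cnj (?c * wave m ?\<omega> n x) + u' x * ?w x) = (\<lambda>x. u' x * ?w x - ?c * (u x * ?w x))"
    by (auto simp: fun_eq_iff algebra_simps)
  also have "(\<integral>x. u' x * ?w x - ?c * (u x * ?w x) \<partial>?M) =
      (\<integral>x. u' x * ?w x \<partial>?M) - (\<integral>x. ?c * (u x * ?w x) \<partial>?M)"
    by (intro Bochner_Integration.integral_diff integrable_leb_continuous continuous_intros u u' cw)
  also have "(\<integral>x. ?c * (u x * ?w x) \<partial>?M) = ?c * (\<integral>x. u x * ?w x \<partial>?M)" by simp
  finally show ?thesis unfolding fourier_coeff_def by simp
qed

lemma sq_le_of_bounded:
  assumes "\<And>x. x \<in> open_box m a b \<Longrightarrow> cmod (f x) \<le> e" "f \<in> L2_space m (open_box m a b)"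
  shows "sq m (open_box m a b) f \<le> e\<^sup>2 * measure (leb m (open_box m a b)) (open_box m a b)"
proof -
  interpret finite_measure "leb m (open_box m a b)" by (rule finite_measure_leb)
  have "sq m (open_box m a b) f \<le> (\<integral>x. e\<^sup>2 \<partial>leb m (open_box m a b))"
    unfolding sq_def using L2_spaceD(2)[OF assms(2)] assms(1)
    by (intro integral_mono) (auto intro!: power_mono)
  then show ?thesis by (simp add: mult.commute)
qed

text \<open>Enlarging the index set keeps the approximating polynomial in the span, so best
  approximation preserves the bound. The claim for all larger sets \<open>G\<close> lets finitely
  many functions share one index set.\<close>

lemma wave_sum_approximation:
  assumes ab: "\<And>i. i < m \<Longrightarrow> a i < b i" and u: "continuous_on (real_space m) u" "periodic m a b u" and "\<epsilon> > 0"
  shows "\<exists>F. finite F \<and> F \<subseteq> {n. \<forall>k\<ge>m. n k = 0} \<and>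
    (\<forall>G. finite G \<longrightarrow> F \<subseteq> G \<longrightarrow> G \<subseteq> {n. \<forall>k\<ge>m. n k = 0} \<longrightarrow>
      sq m (open_box m a b) (\<lambda>x. u x - (\<Sum>n\<in>G. fourier_coeff m a b u n * wave m (period_freq a b) n x)) < \<epsilon>)"
proof -
  let ?V = "measure (leb m (open_box m a b)) (open_box m a b)" and ?\<omega> = "period_freq a b"
  \<comment> \<open>A uniform error of this size contributes at most \<epsilon> / 2 to the squared
    L2 norm.\<close>
  let ?e = "sqrt (\<epsilon> / (2 * ?V))"
  have V: "?V > 0" by (rule measure_open_box_pos[OF ab])
  then have e: "?e > 0" using \<open>\<epsilon> > 0\<close> by simp
  have e2: "?e\<^sup>2 * ?V = \<epsilon> / 2" using V \<open>\<epsilon> > 0\<close> by (simp add: field_simps)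
  obtain p where p: "p \<in> trig_poly m ?\<omega>" "\<And>x. x \<in> open_box m a b \<Longrightarrow> cmod (u x - p x) < ?e"
    using trig_poly_dense[OF ab u e] by blast
  obtain F c where F: "finite F" "F \<subseteq> {n. \<forall>k\<ge>m. n k = 0}" "p = (\<lambda>x. \<Sum>n\<in>F. c n * wave m ?\<omega> n x)"
    using trig_poly_sum_waves[OF p(1)] by blast
  have uL: "u \<in> L2_space m (open_box m a b)" by (rule L2_space_continuous[OF u(1)])
  have "sq m (open_box m a b) (\<lambda>x. u x - (\<Sum>n\<in>G. fourier_coeff m a b u n * wave m ?\<omega> n x)) < \<epsilon>"
    if G: "finite G" "F \<subseteq> G" "G \<subseteq> {n. \<forall>k\<ge>m. n k = 0}" for G
  proof -
    have pG: "p x = (\<Sum>n\<in>G. (if n \<in> F then c n else 0) * wave m ?\<omega> n x)" for x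
      unfolding F(3) using G by (intro sum.mono_neutral_cong_left) auto
    have "sq m (open_box m a b) (\<lambda>x. u x - (\<Sum>n\<in>G. fourier_coeff m a b u n * wave m ?\<omega> n x)) \<le>
        sq m (open_box m a b) (\<lambda>x. u x - p x)"
      unfolding pG by (rule fourier_best_approximation[OF ab G(1,3) uL])
    also have "\<dots> \<le> ?e\<^sup>2 * ?V"
    proof (rule sq_le_of_bounded)
      show "(\<lambda>x. u x - p x) \<in> L2_space m (open_box m a b)"
        unfolding F(3) by (intro L2_space_diff uL L2_space_continuous continuous_on_wave_sum)
    qed (use p(2) in \<open>auto intro: less_imp_le\<close>)
    also have "\<dots> < \<epsilon>" unfolding e2 using \<open>\<epsilon> > 0\<close> by simp
    finally show ?thesis .
  qed
  then show ?thesis using F(1,2) by blast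
qed

lemma has_partial_wave_sum:
  assumes "k < m"
  shows "has_partial m k (\<lambda>x. \<Sum>n\<in>F. c n * wave m \<omega> n x)
    (\<lambda>x. \<Sum>n\<in>F. (\<i> * of_real (\<omega> k * of_int (n k)) * c n) * wave m \<omega> n x)"
proof (induction F rule: infinite_finite_induct)
  case (insert n F)
  have "has_partial m k (\<lambda>x. c n * wave m \<omega> n x) (\<lambda>x. c n * (\<i> * of_real (\<omega> k * of_int (n k)) * wave m \<omega> n x))"
    by (rule has_partial_cmult[OF has_partial_wave[OF assms]])
  from has_partial_add[OF this insert.IH] show ?case using insert.hyps by (simp add: mult_ac)
qed (simp_all add: has_partial_def)

text \<open>Taking Fourier coefficients commutes with differentiation, so a single partial Fourier sum
  approximates a periodic function together with all its first-order derivatives.\<close>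

lemma wave_sum_approximation_energy:
  assumes ab: "\<And>i. i < m \<Longrightarrow> a i < b i" and u: "smooth_fun m u" "periodic m a b u" and "\<epsilon> > 0"
  shows "\<exists>F c P. finite F \<and> sobolev_pair m (open_box m a b) (\<lambda>x. \<Sum>n\<in>F. c n * wave m (period_freq a b) n x) P \<and>
    energy m (open_box m a b) (\<lambda>x. u x - (\<Sum>n\<in>F. c n * wave m (period_freq a b) n x))
      (\<lambda>k x. partial_deriv k u x - P k x) < \<epsilon>"
proof -
  let ?Q = "open_box m a b" and ?\<omega> = "period_freq a b" and ?Z = "{n. \<forall>k\<ge>m. n k = (0::int)}"
  \<comment> \<open>The energy has m + 1 summands.\<close>
  define \<delta> where "\<delta> = \<epsilon> / (real m + 1)"
  have \<delta>: "\<delta> > 0" unfolding \<delta>_def using \<open>\<epsilon> > 0\<close> by simp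
  define good where "good v F \<longleftrightarrow> finite F \<and> F \<subseteq> ?Z \<and> (\<forall>G. finite G \<longrightarrow> F \<subseteq> G \<longrightarrow> G \<subseteq> ?Z \<longrightarrow>
      sq m ?Q (\<lambda>x. v x - (\<Sum>n\<in>G. fourier_coeff m a b v n * wave m ?\<omega> n x)) < \<delta>)" for v F
  have ex: "\<exists>F. good v F" if "continuous_on (real_space m) v" "periodic m a b v" for v
    unfolding good_def by (rule wave_sum_approximation[OF ab that \<delta>])
  have cd: "continuous_on (real_space m) (partial_deriv k u)" if "k < m" for k
    by (intro smooth_fun_continuous smooth_fun_partial_deriv u that)
  obtain F0 where F0: "good u F0" using ex[OF smooth_fun_continuous[OF u(1)] u(2)] by blast
  have "\<forall>k. \<exists>F. k < m \<longrightarrow> good (partial_deriv k u) F"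
    using ex[OF cd periodic_partial[OF u(2) smooth_fun_has_partial[OF u(1)]]] by blast
  from choice[OF this] obtain F1 where F1: "\<forall>k. k < m \<longrightarrow> good (partial_deriv k u) (F1 k)" ..
  \<comment> \<open>The predicate \<open>good\<close> extends to every larger finite set of
    admissible indices, so the union serves \<open>u\<close> and all its partials.\<close>
  define G where "G = F0 \<union> (\<Union>k<m. F1 k)"
  have G: "finite G" "G \<subseteq> ?Z" using F0 F1 unfolding G_def good_def by auto
  let ?c = "fourier_coeff m a b u"
  let ?q = "\<lambda>x. \<Sum>n\<in>G. ?c n * wave m ?\<omega> n x"
  let ?P = "\<lambda>k x. \<Sum>n\<in>G. (\<i> * of_real (?\<omega> k * of_int (n k)) * ?c n) * wave m ?\<omega> n x"
  have pair: "sobolev_pair m ?Q ?q ?P"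
    by (intro sobolev_pair_partial ab continuous_on_wave_sum has_partial_wave_sum)
  have s0: "sq m ?Q (\<lambda>x. u x - ?q x) < \<delta>" using F0 G unfolding good_def G_def by blast
  have s1: "sq m ?Q (\<lambda>x. partial_deriv k u x - ?P k x) < \<delta>" if k: "k < m" for k
  proof -
    have sub: "F1 k \<subseteq> G" using k unfolding G_def by blast
    have fc: "fourier_coeff m a b (partial_deriv k u) n = \<i> * of_real (?\<omega> k * of_int (n k)) * ?c n" for n
      by (rule fourier_coeff_partial[OF ab k smooth_fun_continuous[OF u(1)] u(2) cd[OF k] smooth_fun_has_partial[OF u(1) k]])
    have "sq m ?Q (\<lambda>x. partial_deriv k u x - (\<Sum>n\<in>G. fourier_coeff m a b (partial_deriv k u) n * wave m ?\<omega> n x)) < \<delta>"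
      using F1 k G sub unfolding good_def by blast
    then show ?thesis unfolding fc .
  qed
  have "energy m ?Q (\<lambda>x. u x - ?q x) (\<lambda>k x. partial_deriv k u x - ?P k x) < \<delta> + (\<Sum>k<m. \<delta>)"
    unfolding energy_def using s0 s1 by (intro add_less_le_mono sum_mono less_imp_le) auto
  also have "\<delta> + (\<Sum>k<m. \<delta>) = (real m + 1) * \<delta>" by (simp add: algebra_simps)
  also have "\<dots> = \<epsilon>" unfolding \<delta>_def by simp
  finally show ?thesis using G(1) pair by blast
qed

subsection \<open>Elementary tensors\<close>

lemma total_dim_Suc: "total_dim d (Suc n) = total_dim d n + d n"
  unfolding total_dim_def by simp

lemma total_dim_mono: "j \<le> n \<Longrightarrow> total_dim d j \<le> total_dim d n"
  unfolding total_dim_def by (intro sum_mono2) auto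

lemma total_dim_add_le: "j < n \<Longrightarrow> total_dim d j + d j \<le> total_dim d n"
  using total_dim_mono[of "Suc j" n d] by (simp add: total_dim_Suc)

lemma total_dim_add_less: "j < n \<Longrightarrow> i < d j \<Longrightarrow> total_dim d j + i < total_dim d n"
  using total_dim_add_le[of j n d] by simp

lemma total_dim_cases:
  assumes "k < total_dim d n"
  obtains j i where "j < n" "i < d j" "k = total_dim d j + i"
proof -
  have "\<exists>j<n. \<exists>i<d j. k = total_dim d j + i"
    using assms
  proof (induction n)
    case (Suc n)
    show ?case
    proof (cases "k < total_dim d n")
      case True
      with Suc.IH show ?thesis using less_Suc_eq by blast
    next
      case False
      then have "k - total_dim d n < d n" "k = total_dim d n + (k - total_dim d n)"
        using Suc.prems by (auto simp: total_dim_Suc)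
      then show ?thesis by blast
    qed
  qed (simp add: total_dim_def)
  with that show thesis by blast
qed

lemma total_dim_add_inject:
  assumes "i < d j" "i' < d j'" "total_dim d j + i = total_dim d j' + i'"
  shows "j = j'"
proof (rule ccontr)
  assume "j \<noteq> j'"
  then consider "j < j'" | "j' < j" by linarith
  then show False
    using assms total_dim_add_le[of j j' d] total_dim_add_le[of j' j d] by cases auto
qed

text \<open>Joins the endpoint vectors of the factors into one vector for the product; the least
  such \<open>j\<close> is the block that contains coordinate \<open>k\<close>.\<close>

definition concat_blocks :: "(nat \<Rightarrow> nat) \<Rightarrow> (nat \<Rightarrow> nat \<Rightarrow> real) \<Rightarrow> nat \<Rightarrow> real" where
  "concat_blocks d a k =
     (let j = (LEAST j. k < total_dim d (Suc j)) in a j (k - total_dim d j))"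

lemma concat_blocks_add:
  assumes "i < d j" shows "concat_blocks d a (total_dim d j + i) = a j i"
proof -
  have "(LEAST l. total_dim d j + i < total_dim d (Suc l)) = j"
  proof (rule Least_equality)
    show "total_dim d j + i < total_dim d (Suc j)" using assms by (simp add: total_dim_Suc)
    show "j \<le> l" if "total_dim d j + i < total_dim d (Suc l)" for l
      using that total_dim_mono[of "Suc l" j d] by (cases "j \<le> l") auto
  qed
  then show ?thesis unfolding concat_blocks_def by simp
qed

lemma product_domain_open_box:
  assumes "\<And>j. j < n \<Longrightarrow> \<Omega> j = open_box (d j) (a j) (b j)"
  shows "product_domain d n \<Omega> = open_box (total_dim d n) (concat_blocks d a) (concat_blocks d b)"
    (is "_ = ?Q")
proof (intro set_eqI iffI)
  fix x assume x: "x \<in> product_domain d n \<Omega>"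
  have "concat_blocks d a k < x k \<and> x k < concat_blocks d b k" if "k < total_dim d n" for k
  proof -
    obtain j i where ji: "j < n" "i < d j" "k = total_dim d j + i" by (rule total_dim_cases[OF \<open>k < total_dim d n\<close>])
    have "block d j x \<in> open_box (d j) (a j) (b j)"
      using x ji(1) assms unfolding product_domain_def by auto
    then have "block d j x i \<in> {a j i<..<b j i}" using ji(2) PiE_mem by fastforce
    then show ?thesis using ji(2) unfolding ji(3) by (simp add: concat_blocks_add block_def)
  qed
  then show "x \<in> ?Q" using x unfolding product_domain_def by (simp add: PiE_iff)
next
  fix x assume x: "x \<in> ?Q"
  have "block d j x \<in> \<Omega> j" if j: "j < n" for j
  proof -
    have "block d j x i \<in> {a j i<..<b j i}" if i: "i < d j" for i
    proof -
      have "x (total_dim d j + i) \<in> {concat_blocks d a (total_dim d j + i)<..<concat_blocks d b (total_dim d j + i)}"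
        using PiE_mem[OF x, of "total_dim d j + i"] total_dim_add_less[where d = d, OF j i] by simp
      then show ?thesis using i by (simp add: concat_blocks_add block_def)
    qed
    then show ?thesis unfolding assms[OF j] by (simp add: PiE_iff block_def)
  qed
  then show "x \<in> product_domain d n \<Omega>" using x unfolding product_domain_def by (simp add: PiE_iff)
qed

lemma block_fun_upd:
  assumes "i < d j"
  shows "block d l (x(total_dim d j + i := t)) = (if l = j then (block d j x)(i := t) else block d l x)"
proof (rule ext)
  fix k
  show "block d l (x(total_dim d j + i := t)) k = (if l = j then (block d j x)(i := t) else block d l x) k"
    using total_dim_add_inject[of i d j k l] assms by (auto simp: block_def)
qed

lemma block_real_space: "block d j x \<in> real_space (d j)"
  unfolding block_def by auto

text \<open>On a line in a coordinate of block \<open>j\<close> the tensor is a constant times a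
  slice of the factor \<open>u j\<close>, the shape to which the derivative rule applies.\<close>

lemma elementary_tensor_fun_upd:
  assumes "j < n" "i < d j"
  shows "elementary_tensor d n u (x(total_dim d j + i := t)) =
    (\<Prod>l\<in>{..<n} - {j}. u l (block d l x)) * u j ((block d j x)(i := t))"
proof -
  have "elementary_tensor d n u (x(total_dim d j + i := t)) =
      u j ((block d j x)(i := t)) * (\<Prod>l\<in>{..<n} - {j}. u l (block d l (x(total_dim d j + i := t))))"
    unfolding elementary_tensor_def using assms by (subst prod.remove[of _ j]) (auto simp: block_fun_upd)
  also have "(\<Prod>l\<in>{..<n} - {j}. u l (block d l (x(total_dim d j + i := t)))) =
      (\<Prod>l\<in>{..<n} - {j}. u l (block d l x))"
    using assms by (intro prod.cong) (auto simp: block_fun_upd)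
  finally show ?thesis by (simp only: mult.commute)
qed

lemma elementary_tensor_remove:
  assumes "j < n"
  shows "elementary_tensor d n (u(j := v)) x = (\<Prod>l\<in>{..<n} - {j}. u l (block d l x)) * v (block d j x)"
  unfolding elementary_tensor_def using assms by (subst prod.remove[of _ j]) (auto simp: mult.commute)

lemma has_partial_elementary_tensor:
  assumes j: "j < n" and i: "i < d j" and u: "has_partial (d j) i (u j) v"
  shows "has_partial (total_dim d n) (total_dim d j + i) (elementary_tensor d n u)
    (elementary_tensor d n (u(j := v)))"
  unfolding has_partial_def
proof
  fix x :: point
  have "((\<lambda>t. u j ((block d j x)(i := t))) has_vector_derivative v (block d j x)) (at (block d j x i))"
    using u block_real_space unfolding has_partial_def by blast
  moreover have "block d j x i = x (total_dim d j + i)" using i by (simp add: block_def)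
  ultimately show "((\<lambda>t. elementary_tensor d n u (x(total_dim d j + i := t))) has_vector_derivative
      elementary_tensor d n (u(j := v)) x) (at (x (total_dim d j + i)))"
    unfolding elementary_tensor_fun_upd[where d = d, OF j i] elementary_tensor_remove[OF j]
    by (simp add: has_vector_derivative_mult_right)
qed

lemma smooth_elementary_tensor:
  assumes "\<And>j. j < n \<Longrightarrow> smooth_fun (d j) (u j)"
  shows "smooth_fun (total_dim d n) (elementary_tensor d n u)"
  unfolding elementary_tensor_def[abs_def] block_def
  using assms total_dim_add_le by (intro smooth_fun_prod smooth_fun_block) auto

lemma periodic_elementary_tensor:
  assumes "\<And>j. j < n \<Longrightarrow> periodic (d j) (a j) (b j) (u j)"
  shows "periodic (total_dim d n) (concat_blocks d a) (concat_blocks d b) (elementary_tensor d n u)"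
  unfolding periodic_def
proof (intro ballI allI impI)
  fix x :: point and k assume "k < total_dim d n"
  then obtain j i where ji: "j < n" "i < d j" "k = total_dim d j + i" by (rule total_dim_cases)
  have "x k = block d j x i" using ji by (simp add: block_def)
  then have "u j ((block d j x)(i := x k + (b j i - a j i))) = u j (block d j x)"
    using assms[OF ji(1)] block_real_space ji(2) unfolding periodic_def by simp
  then show "elementary_tensor d n u (x(k := x k + (concat_blocks d b k - concat_blocks d a k))) =
      elementary_tensor d n u x"
    using elementary_tensor_remove[OF ji(1), of d u "u j" x] ji(2)
    unfolding ji(3) elementary_tensor_fun_upd[where d = d, OF ji(1,2)]
    by (simp add: concat_blocks_add)
qed

lemma sum_lessThan_add: "(\<Sum>k<p + q. f k) = (\<Sum>k<p. f k) + (\<Sum>i<q. f (p + i))" for f :: "nat \<Rightarrow> real"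
  by (induction q) (auto simp: add.assoc)

text \<open>The phase is a sum over coordinates and hence over blocks, and \<open>cis\<close> turns
  that sum into a product.\<close>

lemma wave_elementary_tensor:
  "wave (total_dim d n) \<omega> N x =
    elementary_tensor d n (\<lambda>j. wave (d j) (\<lambda>i. \<omega> (total_dim d j + i)) (\<lambda>i. N (total_dim d j + i))) x"
proof (induction n)
  case 0
  then show ?case by (simp add: wave_def elementary_tensor_def total_dim_def)
next
  case (Suc n)
  have "wave (total_dim d (Suc n)) \<omega> N x = wave (total_dim d n) \<omega> N x *
      wave (d n) (\<lambda>i. \<omega> (total_dim d n + i)) (\<lambda>i. N (total_dim d n + i)) (block d n x)"
    unfolding wave_def total_dim_Suc sum_lessThan_add cis_mult by (simp add: block_def)
  then show ?case unfolding Suc.IH by (simp add: elementary_tensor_def)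
qed

section \<open>Splitting the product measure and factorising squared norms\<close>

definition append_point :: "nat \<Rightarrow> nat \<Rightarrow> point \<times> point \<Rightarrow> point" where
  "append_point p q = (\<lambda>(x, y). \<lambda>i\<in>{..<p + q}. if i < p then x i else y (i - p))"

lemma measurable_append_point [measurable]:
  "append_point p q \<in> measurable ((\<Pi>\<^sub>M i\<in>{..<p}. lborel :: real measure) \<Otimes>\<^sub>M (\<Pi>\<^sub>M i\<in>{..<q}. lborel :: real measure))
     (\<Pi>\<^sub>M i\<in>{..<p + q}. lborel)"
proof -
  have "(\<lambda>z. \<lambda>i\<in>{..<p + q}. if i < p then fst z i else snd z (i - p)) \<in>
      measurable ((\<Pi>\<^sub>M i\<in>{..<p}. lborel :: real measure) \<Otimes>\<^sub>M (\<Pi>\<^sub>M i\<in>{..<q}. lborel :: real measure))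
     (\<Pi>\<^sub>M i\<in>{..<p + q}. lborel)"
  proof (rule measurable_restrict)
    fix i assume i: "i \<in> {..<p + q}"
    show "(\<lambda>z. if i < p then fst z i else snd z (i - p)) \<in>
      measurable ((\<Pi>\<^sub>M i\<in>{..<p}. lborel :: real measure) \<Otimes>\<^sub>M (\<Pi>\<^sub>M i\<in>{..<q}. lborel :: real measure)) lborel"
    proof (cases "i < p")
      case True
      then show ?thesis
        using measurable_compose[OF measurable_fst measurable_component_singleton[of i "{..<p}"]] by simp
    next
      case False
      then have "i - p \<in> {..<q}" using i by auto
      then show ?thesis using False
        measurable_compose[OF measurable_snd measurable_component_singleton[of "i - p" "{..<q}"]] by simp
    qed
  qed
  then show ?thesis unfolding append_point_def by (simp add: split_beta')
qed

text \<open>The two measures are compared on products of measurable sets, which determine the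
  product measure. The preimage of such a product is a rectangle whose second side is reindexed by
  the offset \<open>p\<close>.\<close>

lemma distr_append_point:
  "distr ((\<Pi>\<^sub>M i\<in>{..<p}. lborel :: real measure) \<Otimes>\<^sub>M (\<Pi>\<^sub>M i\<in>{..<q}. lborel :: real measure))
     (\<Pi>\<^sub>M i\<in>{..<p + q}. lborel) (append_point p q) = (\<Pi>\<^sub>M i\<in>{..<p + q}. lborel)"
  (is "distr (?P \<Otimes>\<^sub>M ?Q) ?R _ = _")
proof (rule lborel_product.PiM_eqI)
  interpret Q: sigma_finite_measure ?Q by (rule lborel_product.sigma_finite) simp
  fix A :: "nat \<Rightarrow> real set" assume A: "\<And>i. i \<in> {..<p + q} \<Longrightarrow> A i \<in> sets lborel"
  let ?B = "\<lambda>i. A (p + i)"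
  have pre: "append_point p q -` Pi\<^sub>E {..<p + q} A \<inter> space (?P \<Otimes>\<^sub>M ?Q) = Pi\<^sub>E {..<p} A \<times> Pi\<^sub>E {..<q} ?B"
  proof (intro set_eqI iffI)
    fix z assume z: "z \<in> append_point p q -` Pi\<^sub>E {..<p + q} A \<inter> space (?P \<Otimes>\<^sub>M ?Q)"
    obtain x y where xy: "z = (x, y)" by (cases z)
    have e: "append_point p q (x, y) i \<in> A i" if "i < p + q" for i
      using z that unfolding xy by (auto simp: PiE_iff)
    have "x i \<in> A i" if "i < p" for i using e[of i] that by (simp add: append_point_def)
    moreover have "y i \<in> A (p + i)" if "i < q" for i using e[of "p + i"] that by (simp add: append_point_def)
    ultimately show "z \<in> Pi\<^sub>E {..<p} A \<times> Pi\<^sub>E {..<q} ?B"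
      using z unfolding xy by (simp add: space_pair_measure space_PiM PiE_iff)
  next
    fix z assume z: "z \<in> Pi\<^sub>E {..<p} A \<times> Pi\<^sub>E {..<q} ?B"
    obtain x y where xy: "z = (x, y)" by (cases z)
    have x: "x i \<in> A i" if "i < p" for i using z that unfolding xy by (auto simp: PiE_iff)
    have y: "y i \<in> A (p + i)" if "i < q" for i using z that unfolding xy by (auto simp: PiE_iff)
    have "append_point p q (x, y) i \<in> A i" if "i < p + q" for i
      using x[of i] y[of "i - p"] that by (auto simp: append_point_def)
    then show "z \<in> append_point p q -` Pi\<^sub>E {..<p + q} A \<inter> space (?P \<Otimes>\<^sub>M ?Q)"
      using z unfolding xy by (simp add: space_pair_measure space_PiM PiE_iff) (simp add: append_point_def)
  qed
  have "emeasure (distr (?P \<Otimes>\<^sub>M ?Q) ?R (append_point p q)) (Pi\<^sub>E {..<p + q} A) =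
      emeasure (?P \<Otimes>\<^sub>M ?Q) (Pi\<^sub>E {..<p} A \<times> Pi\<^sub>E {..<q} ?B)"
    using A by (subst emeasure_distr) (auto simp: pre intro!: sets_PiM_I_finite)
  also have "\<dots> = emeasure ?P (Pi\<^sub>E {..<p} A) * emeasure ?Q (Pi\<^sub>E {..<q} ?B)"
    using A by (intro Q.emeasure_pair_measure_Times sets_PiM_I_finite) auto
  also have "\<dots> = (\<Prod>i<p. emeasure lborel (A i)) * (\<Prod>i<q. emeasure lborel (A (p + i)))"
    using A by (subst (1 2) lborel_product.emeasure_PiM) auto
  also have "\<dots> = (\<Prod>i<p + q. emeasure lborel (A i))"
    by (induction q) (simp_all flip: mult.assoc)
  finally show "emeasure (distr (?P \<Otimes>\<^sub>M ?Q) ?R (append_point p q)) (Pi\<^sub>E {..<p + q} A) =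
      (\<Prod>i\<in>{..<p + q}. emeasure lborel (A i))" .
qed auto

abbreviation first_part :: "nat \<Rightarrow> point \<Rightarrow> point" where
  "first_part p x \<equiv> (\<lambda>i\<in>{..<p}. x i)"

abbreviation last_part :: "nat \<Rightarrow> nat \<Rightarrow> point \<Rightarrow> point" where
  "last_part p q x \<equiv> (\<lambda>i\<in>{..<q}. x (p + i))"

lemma measurable_first_part:
  "first_part p \<in> measurable (\<Pi>\<^sub>M i\<in>{..<p + q}. lborel :: real measure) (\<Pi>\<^sub>M i\<in>{..<p}. lborel)"
  by (rule measurable_restrict) (rule measurable_component_singleton, simp)

lemma measurable_last_part:
  "last_part p q \<in> measurable (\<Pi>\<^sub>M i\<in>{..<p + q}. lborel :: real measure) (\<Pi>\<^sub>M i\<in>{..<q}. lborel)"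
  by (rule measurable_restrict) (rule measurable_component_singleton, simp)

text \<open>Tonelli's theorem, carried over by \<open>append_point\<close> from pairs of points to
  points in p + q coordinates.\<close>

lemma nn_integral_first_last:
  assumes F[measurable]: "F \<in> borel_measurable (\<Pi>\<^sub>M i\<in>{..<p}. lborel :: real measure)"
    and G[measurable]: "G \<in> borel_measurable (\<Pi>\<^sub>M i\<in>{..<q}. lborel :: real measure)"
  shows "(\<integral>\<^sup>+x. F (first_part p x) * G (last_part p q x) \<partial>(\<Pi>\<^sub>M i\<in>{..<p + q}. lborel :: real measure)) =
    (\<integral>\<^sup>+x. F x \<partial>(\<Pi>\<^sub>M i\<in>{..<p}. lborel)) * (\<integral>\<^sup>+x. G x \<partial>(\<Pi>\<^sub>M i\<in>{..<q}. lborel))"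
proof -
  let ?P = "\<Pi>\<^sub>M i\<in>{..<p}. lborel :: real measure" and ?Q = "\<Pi>\<^sub>M i\<in>{..<q}. lborel :: real measure"
    and ?R = "\<Pi>\<^sub>M i\<in>{..<p + q}. lborel :: real measure"
  interpret Q: sigma_finite_measure ?Q by (rule lborel_product.sigma_finite) simp
  note [measurable] = measurable_first_part measurable_last_part
  have "(\<integral>\<^sup>+x. F (first_part p x) * G (last_part p q x) \<partial>?R) =
      (\<integral>\<^sup>+x. F (first_part p x) * G (last_part p q x) \<partial>distr (?P \<Otimes>\<^sub>M ?Q) ?R (append_point p q))"
    by (simp only: distr_append_point)
  also have "\<dots> = (\<integral>\<^sup>+z. F (first_part p (append_point p q z)) * G (last_part p q (append_point p q z)) \<partial>(?P \<Otimes>\<^sub>M ?Q))"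
    by (rule nn_integral_distr) measurable
  also have "\<dots> = (\<integral>\<^sup>+z. F (fst z) * G (snd z) \<partial>(?P \<Otimes>\<^sub>M ?Q))"
  proof (rule nn_integral_cong)
    fix z assume z: "z \<in> space (?P \<Otimes>\<^sub>M ?Q)"
    have "first_part p (append_point p q z) = fst z" "last_part p q (append_point p q z) = snd z"
      using z by (auto simp: append_point_def split_beta space_pair_measure space_PiM PiE_iff extensional_def fun_eq_iff)
    then show "F (first_part p (append_point p q z)) * G (last_part p q (append_point p q z)) = F (fst z) * G (snd z)"
      by simp
  qed
  also have "\<dots> = (\<integral>\<^sup>+x. (\<integral>\<^sup>+y. F x * G y \<partial>?Q) \<partial>?P)"
    by (subst Q.nn_integral_fst[symmetric]) auto
  also have "\<dots> = (\<integral>\<^sup>+x. F x * (\<integral>\<^sup>+y. G y \<partial>?Q) \<partial>?P)"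
    by (intro nn_integral_cong nn_integral_cmult G)
  also have "\<dots> = (\<integral>\<^sup>+x. F x \<partial>?P) * (\<integral>\<^sup>+x. G x \<partial>?Q)" by (rule nn_integral_multc[OF F])
  finally show ?thesis .
qed

lemma nn_integral_leb_first_last:
  assumes C: "C = {x \<in> real_space (p + q). first_part p x \<in> open_box p a b \<and> last_part p q x \<in> open_box q a' b'}"
    and Cm: "C \<in> sets (\<Pi>\<^sub>M i\<in>{..<p + q}. lborel)"
    and F: "F \<in> borel_measurable (leb p (open_box p a b))"
    and G: "G \<in> borel_measurable (leb q (open_box q a' b'))"
  shows "(\<integral>\<^sup>+x. F (first_part p x) * G (last_part p q x) \<partial>leb (p + q) C) =
    (\<integral>\<^sup>+x. F x \<partial>leb p (open_box p a b)) * (\<integral>\<^sup>+x. (G x :: ennreal) \<partial>leb q (open_box q a' b'))"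
proof -
  let ?A = "open_box p a b" and ?B = "open_box q a' b'"
  have A: "?A \<inter> space (\<Pi>\<^sub>M i\<in>{..<p}. lborel) \<in> sets (\<Pi>\<^sub>M i\<in>{..<p}. lborel)"
    and B: "?B \<inter> space (\<Pi>\<^sub>M i\<in>{..<q}. lborel) \<in> sets (\<Pi>\<^sub>M i\<in>{..<q}. lborel)"
    and C': "C \<inter> space (\<Pi>\<^sub>M i\<in>{..<p + q}. lborel) \<in> sets (\<Pi>\<^sub>M i\<in>{..<p + q}. lborel)"
    using Cm by (auto intro!: sets.Int sets_open_box)
  have "(\<integral>\<^sup>+x. F (first_part p x) * G (last_part p q x) \<partial>leb (p + q) C) =
      (\<integral>\<^sup>+x. F (first_part p x) * G (last_part p q x) * indicator C x \<partial>(\<Pi>\<^sub>M i\<in>{..<p + q}. lborel))"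
    unfolding leb_def by (rule nn_integral_restrict_space[OF C'])
  also have "\<dots> = (\<integral>\<^sup>+x. (F (first_part p x) * indicator ?A (first_part p x)) *
      (G (last_part p q x) * indicator ?B (last_part p q x)) \<partial>(\<Pi>\<^sub>M i\<in>{..<p + q}. lborel))"
  proof (rule nn_integral_cong)
    fix x assume x: "x \<in> space (\<Pi>\<^sub>M i\<in>{..<p + q}. lborel :: real measure)"
    then have "x \<in> C \<longleftrightarrow> first_part p x \<in> ?A \<and> last_part p q x \<in> ?B" unfolding C by (simp add: space_PiM)
    then show "F (first_part p x) * G (last_part p q x) * indicator C x =
      (F (first_part p x) * indicator ?A (first_part p x)) * (G (last_part p q x) * indicator ?B (last_part p q x))"
      by (simp add: indicator_def)
  qed
  also have "\<dots> = (\<integral>\<^sup>+x. F x * indicator ?A x \<partial>(\<Pi>\<^sub>M i\<in>{..<p}. lborel)) *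
      (\<integral>\<^sup>+x. G x * indicator ?B x \<partial>(\<Pi>\<^sub>M i\<in>{..<q}. lborel))"
    using F G unfolding leb_def
      borel_measurable_restrict_space_iff_ennreal[OF A] borel_measurable_restrict_space_iff_ennreal[OF B]
    by (rule nn_integral_first_last)
  also have "\<dots> = (\<integral>\<^sup>+x. F x \<partial>leb p ?A) * (\<integral>\<^sup>+x. G x \<partial>leb q ?B)"
    unfolding leb_def nn_integral_restrict_space[OF A] nn_integral_restrict_space[OF B] ..
  finally show ?thesis .
qed

text \<open>The nonnegative integral of the squared modulus factorises into two finite numbers,
  which gives integrability and the value at once.\<close>

lemma L2_first_last:
  assumes C: "C = {x \<in> real_space (p + q). first_part p x \<in> open_box p a b \<and> last_part p q x \<in> open_box q a' b'}"
    and Cm: "C \<in> sets (\<Pi>\<^sub>M i\<in>{..<p + q}. lborel)"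
    and f: "f \<in> L2_space p (open_box p a b)" and g: "g \<in> L2_space q (open_box q a' b')"
  shows "(\<lambda>x. f (first_part p x) * g (last_part p q x)) \<in> L2_space (p + q) C"
    and "sq (p + q) C (\<lambda>x. f (first_part p x) * g (last_part p q x)) =
      sq p (open_box p a b) f * sq q (open_box q a' b') g"
proof -
  let ?h = "\<lambda>x. f (first_part p x) * g (last_part p q x)"
  have *: "(\<integral>\<^sup>+x. ennreal ((cmod (v x))\<^sup>2) \<partial>leb m Q) = ennreal (sq m Q v)" if "v \<in> L2_space m Q" for v m Q
    unfolding sq_def using L2_spaceD(2)[OF that] by (intro nn_integral_eq_integral) auto
  have sp: "space (leb (p + q) C) = C" by (rule space_leb) (auto simp: C)
  have 1: "first_part p \<in> measurable (leb (p + q) C) (leb p (open_box p a b))"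
    unfolding leb_def by (rule measurable_restrict_space3[OF measurable_first_part]) (auto simp: C)
  have 2: "last_part p q \<in> measurable (leb (p + q) C) (leb q (open_box q a' b'))"
    unfolding leb_def by (rule measurable_restrict_space3[OF measurable_last_part]) (auto simp: C)
  have hm[measurable]: "?h \<in> borel_measurable (leb (p + q) C)"
    using measurable_compose[OF 1 L2_spaceD(1)[OF f]] measurable_compose[OF 2 L2_spaceD(1)[OF g]]
    by (rule borel_measurable_times)
  have "(\<integral>\<^sup>+x. ennreal ((cmod (?h x))\<^sup>2) \<partial>leb (p + q) C) =
     (\<integral>\<^sup>+x. ennreal ((cmod (f (first_part p x)))\<^sup>2) * ennreal ((cmod (g (last_part p q x)))\<^sup>2) \<partial>leb (p + q) C)"
    by (intro nn_integral_cong) (simp add: norm_mult power_mult_distrib ennreal_mult)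
  also have "\<dots> = (\<integral>\<^sup>+x. ennreal ((cmod (f x))\<^sup>2) \<partial>leb p (open_box p a b)) *
      (\<integral>\<^sup>+x. ennreal ((cmod (g x))\<^sup>2) \<partial>leb q (open_box q a' b'))"
  proof (rule nn_integral_leb_first_last[OF C Cm, where F = "\<lambda>x. ennreal ((cmod (f x))\<^sup>2)" and G = "\<lambda>x. ennreal ((cmod (g x))\<^sup>2)"])
    note [measurable] = L2_spaceD(1)[OF f] L2_spaceD(1)[OF g]
    show "(\<lambda>x. ennreal ((cmod (f x))\<^sup>2)) \<in> borel_measurable (leb p (open_box p a b))" by measurable
    show "(\<lambda>x. ennreal ((cmod (g x))\<^sup>2)) \<in> borel_measurable (leb q (open_box q a' b'))" by measurable
  qed
  also have "\<dots> = ennreal (sq p (open_box p a b) f * sq q (open_box q a' b') g)"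
    unfolding *[OF f] *[OF g] by (simp add: ennreal_mult sq_nonneg)
  finally have eq: "(\<integral>\<^sup>+x. ennreal ((cmod (?h x))\<^sup>2) \<partial>leb (p + q) C) =
      ennreal (sq p (open_box p a b) f * sq q (open_box q a' b') g)" .
  then have "integrable (leb (p + q) C) (\<lambda>x. (cmod (?h x))\<^sup>2)"
    by (intro integrableI_nonneg) auto
  then show h: "?h \<in> L2_space (p + q) C" unfolding L2_space_def using hm by simp
  show "sq (p + q) C ?h = sq p (open_box p a b) f * sq q (open_box q a' b') g"
    using eq unfolding *[OF h] by (simp add: sq_nonneg)
qed

lemma product_domain_Suc:
  "product_domain d (Suc n) \<Omega> = {x \<in> real_space (total_dim d n + d n).
     first_part (total_dim d n) x \<in> product_domain d n \<Omega> \<and> last_part (total_dim d n) (d n) x \<in> \<Omega> n}"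
proof -
  have "block d j (first_part (total_dim d n) x) = block d j x" if "j < n" for j x
    using total_dim_add_less[where d = d, OF that] by (auto simp: block_def fun_eq_iff)
  then show ?thesis
    unfolding product_domain_def total_dim_Suc less_Suc_eq by (auto simp: block_def[of d n])
qed

lemma elementary_tensor_Suc:
  "elementary_tensor d (Suc n) f x =
     elementary_tensor d n f (first_part (total_dim d n) x) * f n (last_part (total_dim d n) (d n) x)"
proof -
  have "block d j (first_part (total_dim d n) x) = block d j x" if "j < n" for j
    using total_dim_add_less[where d = d, OF that] by (auto simp: block_def fun_eq_iff)
  then show ?thesis unfolding elementary_tensor_def by (simp add: block_def[of d n])
qed

text \<open>Induction on the number of factors. Square integrability is carried along because the
  factorisation of norms needs it at every stage.\<close>

lemma elementary_tensor_tendsto: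
  assumes "\<And>j. j < n \<Longrightarrow> \<Omega> j = open_box (d j) (a j) (b j)"
    and "\<And>j. j < n \<Longrightarrow> f j \<in> L2_space (d j) (\<Omega> j)"
    and "\<And>j \<nu>. j < n \<Longrightarrow> u \<nu> j \<in> L2_space (d j) (\<Omega> j)"
    and "\<And>j. j < n \<Longrightarrow> (\<lambda>\<nu>. sq (d j) (\<Omega> j) (\<lambda>x. f j x - u \<nu> j x)) \<longlonglongrightarrow> 0"
  shows "elementary_tensor d n f \<in> L2_space (total_dim d n) (product_domain d n \<Omega>) \<and>
    (\<forall>\<nu>. elementary_tensor d n (u \<nu>) \<in> L2_space (total_dim d n) (product_domain d n \<Omega>)) \<and>
    (\<lambda>\<nu>. sq (total_dim d n) (product_domain d n \<Omega>)
      (\<lambda>x. elementary_tensor d n f x - elementary_tensor d n (u \<nu>) x)) \<longlonglongrightarrow> 0"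
  using assms
proof (induction n)
  case 0
  \<comment> \<open>In dimension 0 the domain is a single point and the endpoints of the box are
    immaterial.\<close>
  have "product_domain d 0 \<Omega> = open_box (total_dim d 0) (\<lambda>_. 0) (\<lambda>_. 0)"
    by (auto simp: product_domain_def total_dim_def)
  then have "(\<lambda>x. 1) \<in> L2_space (total_dim d 0) (product_domain d 0 \<Omega>)"
    by (simp only: L2_space_continuous[OF continuous_on_const])
  then show ?case by (simp add: elementary_tensor_def[abs_def] sq_def)
next
  case (Suc n)
  let ?p = "total_dim d n" and ?q = "d n" and ?P = "product_domain d n \<Omega>" and ?C = "product_domain d (Suc n) \<Omega>"
  let ?A = "open_box ?p (concat_blocks d a) (concat_blocks d b)" and ?B = "open_box ?q (a n) (b n)"
  let ?T = "elementary_tensor d n f" and ?U = "\<lambda>\<nu>. elementary_tensor d n (u \<nu>)"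
  have P: "?P = ?A" using Suc.prems(1) by (intro product_domain_open_box) auto
  have B: "\<Omega> n = ?B" using Suc.prems(1) by simp
  have C: "?C = {x \<in> real_space (?p + ?q). first_part ?p x \<in> ?A \<and> last_part ?p ?q x \<in> ?B}"
    unfolding product_domain_Suc P B ..
  have Cm: "?C \<in> sets (\<Pi>\<^sub>M i\<in>{..<?p + ?q}. lborel)"
    using sets_open_box product_domain_open_box[of "Suc n" \<Omega> d a b, OF Suc.prems(1)] by (simp add: total_dim_Suc)
  note split = L2_first_last[OF C Cm]
  have IH: "?T \<in> L2_space ?p ?A" "\<And>\<nu>. ?U \<nu> \<in> L2_space ?p ?A"
    "(\<lambda>\<nu>. sq ?p ?A (\<lambda>x. ?T x - ?U \<nu> x)) \<longlonglongrightarrow> 0"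
    using Suc.IH Suc.prems unfolding P by simp_all
  have f: "f n \<in> L2_space ?q ?B" and u: "\<And>\<nu>. u \<nu> n \<in> L2_space ?q ?B"
    and lim: "(\<lambda>\<nu>. sq ?q ?B (\<lambda>x. f n x - u \<nu> n x)) \<longlonglongrightarrow> 0"
    using Suc.prems unfolding B[symmetric] by simp_all
  let ?bound = "\<lambda>\<nu>. 2 * (sq ?p ?A (\<lambda>x. ?T x - ?U \<nu> x) * sq ?q ?B (f n)) +
      2 * ((2 * sq ?p ?A ?T + 2 * sq ?p ?A (\<lambda>x. ?T x - ?U \<nu> x)) * sq ?q ?B (\<lambda>x. f n x - u \<nu> n x))"
  have le: "sq (?p + ?q) ?C (\<lambda>x. elementary_tensor d (Suc n) f x - elementary_tensor d (Suc n) (u \<nu>) x) \<le> ?bound \<nu>" for \<nu>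
  proof -
    \<comment> \<open>Telescoping: the difference of the two tensors is (T - U) f_n + U (f_n - u_n),
      and each term has one small factor.\<close>
    let ?g = "\<lambda>x. (?T (first_part ?p x) - ?U \<nu> (first_part ?p x)) * f n (last_part ?p ?q x)"
    let ?h = "\<lambda>x. ?U \<nu> (first_part ?p x) * (f n (last_part ?p ?q x) - u \<nu> n (last_part ?p ?q x))"
    note d1 = L2_space_diff[OF IH(1) IH(2)[of \<nu>]] and d2 = L2_space_diff[OF f u[of \<nu>]]
    \<comment> \<open>In the second term the norm of U has to stay bounded; it is controlled by T
      and by an error that tends to 0.\<close>
    have "sq ?p ?A (?U \<nu>) = sq ?p ?A (\<lambda>x. ?T x + (- 1) * (?T x - ?U \<nu> x))" by simp
    also have "\<dots> \<le> 2 * sq ?p ?A ?T + 2 * sq ?p ?A (\<lambda>x. (- 1) * (?T x - ?U \<nu> x))"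
      by (rule sq_add_le[OF IH(1) L2_space_cmult[OF d1]])
    also have "sq ?p ?A (\<lambda>x. (- 1) * (?T x - ?U \<nu> x)) = sq ?p ?A (\<lambda>x. ?T x - ?U \<nu> x)"
      by (subst sq_cmult) simp
    finally have U: "sq ?p ?A (?U \<nu>) \<le> 2 * sq ?p ?A ?T + 2 * sq ?p ?A (\<lambda>x. ?T x - ?U \<nu> x)" .
    have "sq (?p + ?q) ?C (\<lambda>x. elementary_tensor d (Suc n) f x - elementary_tensor d (Suc n) (u \<nu>) x) =
        sq (?p + ?q) ?C (\<lambda>x. ?g x + ?h x)"
    proof (rule sq_cong)
      show "elementary_tensor d (Suc n) f x - elementary_tensor d (Suc n) (u \<nu>) x = ?g x + ?h x" for x
        unfolding elementary_tensor_Suc left_diff_distrib right_diff_distrib by simp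
    qed
    also have "\<dots> \<le> 2 * sq (?p + ?q) ?C ?g + 2 * sq (?p + ?q) ?C ?h"
      by (rule sq_add_le[OF split(1)[OF d1 f] split(1)[OF IH(2) d2]])
    also have "sq (?p + ?q) ?C ?g = sq ?p ?A (\<lambda>x. ?T x - ?U \<nu> x) * sq ?q ?B (f n)"
      by (rule split(2)[OF d1 f])
    also have "sq (?p + ?q) ?C ?h = sq ?p ?A (?U \<nu>) * sq ?q ?B (\<lambda>x. f n x - u \<nu> n x)"
      by (rule split(2)[OF IH(2) d2])
    also have "\<dots> \<le> (2 * sq ?p ?A ?T + 2 * sq ?p ?A (\<lambda>x. ?T x - ?U \<nu> x)) * sq ?q ?B (\<lambda>x. f n x - u \<nu> n x)"
      by (rule mult_right_mono[OF U sq_nonneg])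
    finally show ?thesis by simp
  qed
  have "?bound \<longlonglongrightarrow> 2 * (0 * sq ?q ?B (f n)) + 2 * ((2 * sq ?p ?A ?T + 2 * 0) * 0)"
    by (intro IH(3) lim tendsto_add tendsto_mult tendsto_const)
  then have b0: "?bound \<longlonglongrightarrow> 0" by simp
  have "(\<lambda>\<nu>. sq (?p + ?q) ?C (\<lambda>x. elementary_tensor d (Suc n) f x - elementary_tensor d (Suc n) (u \<nu>) x)) \<longlonglongrightarrow> 0"
    by (rule tendsto_sandwich[OF always_eventually always_eventually tendsto_const b0])
      (use le in \<open>simp_all add: sq_nonneg\<close>)
  moreover have "elementary_tensor d (Suc n) f \<in> L2_space (?p + ?q) ?C"
    using split(1)[OF IH(1) f] unfolding elementary_tensor_Suc[abs_def] .
  moreover have "elementary_tensor d (Suc n) (u \<nu>) \<in> L2_space (?p + ?q) ?C" for \<nu>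
    using split(1)[OF IH(2) u] unfolding elementary_tensor_Suc[abs_def] .
  ultimately show ?case unfolding total_dim_Suc by blast
qed

subsection \<open>Periodic Sobolev spaces\<close>

text \<open>The endpoints of a nonempty interval are its infimum and supremum. This makes the
  existentially quantified endpoints in \<open>smooth_per\<close> canonical.\<close>

lemma open_box_eqD:
  assumes "open_box m a b = open_box m a' b'" "\<And>i. i < m \<Longrightarrow> a i < b i" "\<And>i. i < m \<Longrightarrow> a' i < b' i" "k < m"
  shows "a k = a' k" "b k = b' k"
proof -
  have "{a i<..<b i} \<noteq> {}" "{a' i<..<b' i} \<noteq> {}" if "i \<in> {..<m}" for i
    using assms(2)[of i] assms(3)[of i] that by simp_all
  from PiE_eq_iff_not_empty[OF this, where I = "{..<m}"] assms(1)
  have "\<forall>i\<in>{..<m}. {a i<..<b i} = {a' i<..<b' i}" by simp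
  then have "{a k<..<b k} = {a' k<..<b' k}" using assms(4) by simp
  then show "a k = a' k" "b k = b' k"
    using assms(2)[OF \<open>k < m\<close>] assms(3)[OF \<open>k < m\<close>]
    by (metis cInf_greaterThanLessThan, metis cSup_greaterThanLessThan)
qed

lemma smooth_per_open_box:
  assumes ab: "\<And>i. i < m \<Longrightarrow> a i < b i"
  shows "smooth_per m (open_box m a b) = {restrict u (open_box m a b) |u. smooth_fun m u \<and> periodic m a b u}"
proof (intro set_eqI iffI)
  fix f assume "f \<in> smooth_per m (open_box m a b)"
  then obtain u a' b' where "f = restrict u (open_box m a b) \<and> (\<forall>i<m. a' i < b' i) \<and>
    open_box m a b = open_box m a' b' \<and> smooth_fun m u \<and>
    (\<forall>x\<in>real_space m. \<forall>i<m. u (x(i := x i + (b' i - a' i))) = u x)"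
    unfolding smooth_per_def mem_Collect_eq by (elim exE)
  then have u: "f = restrict u (open_box m a b)" "\<And>i. i < m \<Longrightarrow> a' i < b' i"
    "open_box m a b = open_box m a' b'" "smooth_fun m u"
    "\<And>x i. x \<in> real_space m \<Longrightarrow> i < m \<Longrightarrow> u (x(i := x i + (b' i - a' i))) = u x"
    by simp_all
  have "periodic m a b u"
    unfolding periodic_def using u(5) open_box_eqD[OF u(3) ab u(2)] by simp
  then show "f \<in> {restrict u (open_box m a b) |u. smooth_fun m u \<and> periodic m a b u}" using u by blast
next
  fix f assume "f \<in> {restrict u (open_box m a b) |u. smooth_fun m u \<and> periodic m a b u}"
  then obtain u where "f = restrict u (open_box m a b)" "smooth_fun m u" "periodic m a b u" by blast
  then show "f \<in> smooth_per m (open_box m a b)"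
    unfolding smooth_per_def periodic_def using ab
    by (intro CollectI exI[of _ u] exI[of _ a] exI[of _ b] conjI) auto
qed

lemma smooth_perI:
  assumes "\<And>i. i < m \<Longrightarrow> a i < b i" "smooth_fun m u" "periodic m a b u"
  shows "restrict u (open_box m a b) \<in> smooth_per m (open_box m a b)"
  using assms(2,3) smooth_per_open_box[of m a b] assms(1) by blast

lemma smooth_perE:
  assumes "f \<in> smooth_per m (open_box m a b)" "\<And>i. i < m \<Longrightarrow> a i < b i"
  obtains u where "f = restrict u (open_box m a b)" "smooth_fun m u" "periodic m a b u"
  using assms(1) smooth_per_open_box[of m a b] assms(2) by blast

lemma sobolev_pair_restrict:
  assumes "sobolev_pair m (open_box m a b) u U"
  shows "sobolev_pair m (open_box m a b) (restrict u (open_box m a b)) U"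
  using assms by (rule sobolev_pair_cong) auto

text \<open>\<open>smooth_per\<close> contains restrictions only. A smooth periodic \<open>u\<close>
  differs from its restriction just off the box, so the Sobolev distance between them is 0.\<close>

lemma smooth_periodic_in_H1_per:
  assumes ab: "\<And>i. i < m \<Longrightarrow> a i < b i" and u: "smooth_fun m u" "periodic m a b u"
  shows "u \<in> H1_per m (open_box m a b)"
  unfolding H1_per_def
proof (rule H1_closureI[OF sobolev_pair_smooth[OF ab u(1)]])
  let ?Q = "open_box m a b"
  fix \<epsilon> :: real assume "\<epsilon> > 0"
  have "energy m ?Q (\<lambda>x. u x - restrict u ?Q x) (\<lambda>k x. partial_deriv k u x - partial_deriv k u x) =
      energy m ?Q (\<lambda>x. 0) (\<lambda>k x. 0)"
    by (rule energy_cong) auto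
  also have "\<dots> = 0" by (simp add: energy_def sq_def)
  finally have "energy m ?Q (\<lambda>x. u x - restrict u ?Q x) (\<lambda>k x. partial_deriv k u x - partial_deriv k u x) < \<epsilon>"
    using \<open>\<epsilon> > 0\<close> by simp
  moreover have p: "sobolev_pair m ?Q (restrict u ?Q) (\<lambda>k. partial_deriv k u)"
    by (rule sobolev_pair_restrict[OF sobolev_pair_smooth[OF ab u(1)]])
  moreover have "restrict u ?Q \<in> smooth_per m ?Q" by (rule smooth_perI[OF ab u])
  ultimately show "\<exists>g\<in>smooth_per m ?Q. \<exists>G. sobolev_pair m ?Q g G \<and>
      energy m ?Q (\<lambda>x. u x - g x) (\<lambda>k x. partial_deriv k u x - G k x) < \<epsilon>"
    using p by blast
qed

text \<open>The closure supplies approximants with some weak derivatives. These agree almost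
  everywhere with the classical partials of the underlying smooth periodic functions, in terms of
  which the derivatives of a tensor can be computed.\<close>

lemma H1_per_approx:
  assumes ab: "\<And>i. i < m \<Longrightarrow> a i < b i" and f: "f \<in> H1_per m (open_box m a b)"
    "sobolev_pair m (open_box m a b) f F"
  shows "\<exists>w. (\<forall>\<nu>. smooth_fun m (w \<nu>)) \<and> (\<forall>\<nu>. periodic m a b (w \<nu>)) \<and>
    (\<lambda>\<nu>. sq m (open_box m a b) (\<lambda>x. f x - w \<nu> x)) \<longlonglongrightarrow> 0 \<and>
    (\<forall>k<m. (\<lambda>\<nu>. sq m (open_box m a b) (\<lambda>x. F k x - partial_deriv k (w \<nu>) x)) \<longlonglongrightarrow> 0)"
proof (rule H1_closure_seqD[OF f(1)[unfolded H1_per_def] f(2)])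
  let ?Q = "open_box m a b"
  fix u U assume u: "\<And>\<nu>. u \<nu> \<in> smooth_per m ?Q" "\<And>\<nu>. sobolev_pair m ?Q (u \<nu>) (U \<nu>)"
    "(\<lambda>\<nu>. sq m ?Q (\<lambda>x. f x - u \<nu> x)) \<longlonglongrightarrow> 0"
    "\<And>k. k < m \<Longrightarrow> (\<lambda>\<nu>. sq m ?Q (\<lambda>x. F k x - U \<nu> k x)) \<longlonglongrightarrow> 0"
  have "\<forall>\<nu>. \<exists>w. u \<nu> = restrict w ?Q \<and> smooth_fun m w \<and> periodic m a b w"
  proof
    show "\<exists>w. u \<nu> = restrict w ?Q \<and> smooth_fun m w \<and> periodic m a b w" for \<nu>
      by (rule smooth_perE[OF u(1)[of \<nu>] ab]) blast+
  qed
  from choice[OF this] obtain w where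
    "\<forall>\<nu>. u \<nu> = restrict (w \<nu>) ?Q \<and> smooth_fun m (w \<nu>) \<and> periodic m a b (w \<nu>)" ..
  then have w: "\<And>\<nu>. u \<nu> = restrict (w \<nu>) ?Q" "\<And>\<nu>. smooth_fun m (w \<nu>)" "\<And>\<nu>. periodic m a b (w \<nu>)"
    by simp_all
  have "sq m ?Q (\<lambda>x. f x - w \<nu> x) = sq m ?Q (\<lambda>x. f x - u \<nu> x)" for \<nu>
    by (rule sq_cong) (simp add: w(1))
  moreover have "sq m ?Q (\<lambda>x. F k x - partial_deriv k (w \<nu>) x) = sq m ?Q (\<lambda>x. F k x - U \<nu> k x)"
    if k: "k < m" for k \<nu>
  proof (rule sq_AE_cong)
    have p: "sobolev_pair m ?Q (u \<nu>) (\<lambda>k. partial_deriv k (w \<nu>))"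
      unfolding w(1) by (rule sobolev_pair_restrict[OF sobolev_pair_smooth[OF ab w(2)]])
    show "(\<lambda>x. F k x - partial_deriv k (w \<nu>) x) \<in> L2_space m ?Q" "(\<lambda>x. F k x - U \<nu> k x) \<in> L2_space m ?Q"
      using f(2) p u(2)[of \<nu>] k unfolding sobolev_pair_def by (auto intro!: L2_space_diff)
    have "AE x in leb m ?Q. partial_deriv k (w \<nu>) x = U \<nu> k x"
      using p u(2)[of \<nu>] k unfolding sobolev_pair_def by (intro has_weak_deriv_unique[where f = "u \<nu>"]) auto
    then show "AE x in leb m ?Q. F k x - partial_deriv k (w \<nu>) x = F k x - U \<nu> k x"
      by eventually_elim simp
  qed
  ultimately show ?thesis using u(3,4) w(2,3) by (intro exI[of _ w]) simp
qed

lemma H1_per_add: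
  assumes ab: "\<And>i. i < m \<Longrightarrow> a i < b i"
    and f: "f \<in> H1_per m (open_box m a b)" and g: "g \<in> H1_per m (open_box m a b)"
  shows "(\<lambda>x. f x + g x) \<in> H1_per m (open_box m a b)"
proof -
  let ?Q = "open_box m a b"
  obtain F G where F: "sobolev_pair m ?Q f F" and G: "sobolev_pair m ?Q g G"
    using f g unfolding H1_per_def using H1_closure_subset_H1_space H1_space_iff by blast
  show ?thesis unfolding H1_per_def
  proof (rule H1_closureI[OF sobolev_pair_add[OF F G]])
    fix \<epsilon> :: real assume "\<epsilon> > 0"
    then have e: "\<epsilon> / 4 > 0" by simp
    obtain s S where s: "s \<in> smooth_per m ?Q" "sobolev_pair m ?Q s S"
      "energy m ?Q (\<lambda>x. f x - s x) (\<lambda>k x. F k x - S k x) < \<epsilon> / 4"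
      by (rule H1_closureD[OF f[unfolded H1_per_def] e F])
    obtain t T where t: "t \<in> smooth_per m ?Q" "sobolev_pair m ?Q t T"
      "energy m ?Q (\<lambda>x. g x - t x) (\<lambda>k x. G k x - T k x) < \<epsilon> / 4"
      by (rule H1_closureD[OF g[unfolded H1_per_def] e G])
    obtain u where u: "s = restrict u ?Q" "smooth_fun m u" "periodic m a b u"
      by (rule smooth_perE[OF s(1) ab])
    obtain v where v: "t = restrict v ?Q" "smooth_fun m v" "periodic m a b v"
      by (rule smooth_perE[OF t(1) ab])
    let ?r = "restrict (\<lambda>x. u x + v x) ?Q"
    have per: "periodic m a b (\<lambda>x. u x + v x)" using u(3) v(3) unfolding periodic_def by simp
    have r: "?r \<in> smooth_per m ?Q"
      by (rule smooth_perI[OF ab smooth_fun_add[OF u(2) v(2)] per])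
    have pr: "sobolev_pair m ?Q ?r (\<lambda>k x. S k x + T k x)"
      by (rule sobolev_pair_cong[OF sobolev_pair_add[OF s(2) t(2)]]) (auto simp: u(1) v(1))
    have "energy m ?Q (\<lambda>x. f x + g x - ?r x) (\<lambda>k x. F k x + G k x - (S k x + T k x)) =
        energy m ?Q (\<lambda>x. (f x - s x) + (g x - t x)) (\<lambda>k x. (F k x - S k x) + (G k x - T k x))"
      by (rule energy_cong) (auto simp: u(1) v(1))
    also have "\<dots> < \<epsilon>"
      using energy_add_le[OF sobolev_pair_diff[OF F s(2)] sobolev_pair_diff[OF G t(2)]] s(3) t(3) by simp
    finally show "\<exists>h\<in>smooth_per m ?Q. \<exists>H. sobolev_pair m ?Q h H \<and>
        energy m ?Q (\<lambda>x. f x + g x - h x) (\<lambda>k x. F k x + G k x - H k x) < \<epsilon>"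
      using r pr by (intro bexI[OF _ r] exI[of _ "\<lambda>k x. S k x + T k x"] conjI)
  qed
qed

lemma H1_per_cmult:
  assumes ab: "\<And>i. i < m \<Longrightarrow> a i < b i" and f: "f \<in> H1_per m (open_box m a b)"
  shows "(\<lambda>x. c * f x) \<in> H1_per m (open_box m a b)"
proof -
  let ?Q = "open_box m a b"
  obtain F where F: "sobolev_pair m ?Q f F"
    using f unfolding H1_per_def using H1_closure_subset_H1_space H1_space_iff by blast
  show ?thesis unfolding H1_per_def
  proof (rule H1_closureI[OF sobolev_pair_cmult[OF F]])
    fix \<epsilon> :: real assume "\<epsilon> > 0"
    \<comment> \<open>Adding 1 keeps the denominator positive when c = 0.\<close>
    have c: "(cmod c)\<^sup>2 + 1 > 0" by (simp add: add_nonneg_pos)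
    with \<open>\<epsilon> > 0\<close> have e: "\<epsilon> / ((cmod c)\<^sup>2 + 1) > 0" by simp
    obtain s S where s: "s \<in> smooth_per m ?Q" "sobolev_pair m ?Q s S"
      "energy m ?Q (\<lambda>x. f x - s x) (\<lambda>k x. F k x - S k x) < \<epsilon> / ((cmod c)\<^sup>2 + 1)"
      by (rule H1_closureD[OF f[unfolded H1_per_def] e F])
    obtain u where u: "s = restrict u ?Q" "smooth_fun m u" "periodic m a b u"
      by (rule smooth_perE[OF s(1) ab])
    let ?r = "restrict (\<lambda>x. c * u x) ?Q"
    have per: "periodic m a b (\<lambda>x. c * u x)" using u(3) unfolding periodic_def by simp
    have r: "?r \<in> smooth_per m ?Q"
      by (rule smooth_perI[OF ab smooth_fun_cmult[OF u(2)] per])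
    have pr: "sobolev_pair m ?Q ?r (\<lambda>k x. c * S k x)"
      by (rule sobolev_pair_cong[OF sobolev_pair_cmult[OF s(2)]]) (auto simp: u(1))
    have "energy m ?Q (\<lambda>x. c * f x - ?r x) (\<lambda>k x. c * F k x - c * S k x) =
        energy m ?Q (\<lambda>x. c * (f x - s x)) (\<lambda>k x. c * (F k x - S k x))"
      by (rule energy_cong) (auto simp: u(1) algebra_simps)
    also have "\<dots> = (cmod c)\<^sup>2 * energy m ?Q (\<lambda>x. f x - s x) (\<lambda>k x. F k x - S k x)"
      by (rule energy_cmult)
    also have "\<dots> \<le> ((cmod c)\<^sup>2 + 1) * energy m ?Q (\<lambda>x. f x - s x) (\<lambda>k x. F k x - S k x)"
      by (intro mult_right_mono energy_nonneg) simp
    also have "\<dots> < \<epsilon>" using s(3) c by (simp add: pos_less_divide_eq mult.commute)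
    finally show "\<exists>h\<in>smooth_per m ?Q. \<exists>H. sobolev_pair m ?Q h H \<and>
        energy m ?Q (\<lambda>x. c * f x - h x) (\<lambda>k x. c * F k x - H k x) < \<epsilon>"
      using pr by (intro bexI[OF _ r] exI[of _ "\<lambda>k x. c * S k x"] conjI)
  qed
qed

lemma H1_per_complex_span:
  assumes ab: "\<And>i. i < m \<Longrightarrow> a i < b i" and S: "S \<subseteq> H1_per m (open_box m a b)"
  shows "complex_span S \<subseteq> H1_per m (open_box m a b)"
proof
  fix f assume "f \<in> complex_span S"
  then obtain N :: nat and c v where f: "f = (\<lambda>x. \<Sum>l<N. c l * v l x)" and v: "\<forall>l<N. v l \<in> S"
    unfolding complex_span_def by blast
  have "(\<lambda>x. \<Sum>l<N'. c l * v l x) \<in> H1_per m (open_box m a b)" if "N' \<le> N" for N'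
    using that
  proof (induction N')
    case 0
    show ?case using smooth_periodic_in_H1_per[OF ab smooth_fun_const[of m 0]] by (simp add: periodic_def)
  next
    case (Suc N')
    have "v N' \<in> H1_per m (open_box m a b)" using v S Suc.prems by auto
    from H1_per_add[OF ab Suc.IH H1_per_cmult[OF ab this, of "c N'"]] Suc.prems show ?case by simp
  qed
  then show "f \<in> H1_per m (open_box m a b)" unfolding f by blast
qed

lemma concat_blocks_less:
  assumes ab: "\<And>j i. j < n \<Longrightarrow> i < d j \<Longrightarrow> a j i < b j i" and k: "k < total_dim d n"
  shows "concat_blocks d a k < concat_blocks d b k"
proof -
  obtain j i where "j < n" "i < d j" "k = total_dim d j + i" by (rule total_dim_cases[OF k])
  then show ?thesis using ab by (simp add: concat_blocks_add)
qed

text \<open>For a coordinate in block \<open>j\<close>, the candidate weak derivative replaces the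
  factor \<open>f j\<close> by its own weak derivative. It is an L2 limit of partials of smooth
  periodic tensors, and this makes it an actual weak derivative of the tensor.\<close>

lemma elementary_tensor_in_H1_per:
  assumes \<Omega>: "\<And>j. j < n \<Longrightarrow> \<Omega> j = open_box (d j) (a j) (b j)"
    and ab: "\<And>j i. j < n \<Longrightarrow> i < d j \<Longrightarrow> a j i < b j i"
    and f: "\<And>j. j < n \<Longrightarrow> f j \<in> H1_per (d j) (\<Omega> j)"
  shows "elementary_tensor d n f \<in> H1_per (total_dim d n) (product_domain d n \<Omega>)"
proof -
  let ?D = "total_dim d n"
  let ?Q = "open_box ?D (concat_blocks d a) (concat_blocks d b)"
  have Q: "product_domain d n \<Omega> = ?Q" by (rule product_domain_open_box[OF \<Omega>])
  note AB = concat_blocks_less[of n d a b, OF ab]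
  have "\<forall>j. \<exists>Fw. j < n \<longrightarrow> (sobolev_pair (d j) (\<Omega> j) (f j) (fst Fw) \<and>
      (\<forall>\<nu>. smooth_fun (d j) (snd Fw \<nu>)) \<and> (\<forall>\<nu>. periodic (d j) (a j) (b j) (snd Fw \<nu>)) \<and>
      (\<lambda>\<nu>. sq (d j) (\<Omega> j) (\<lambda>x. f j x - snd Fw \<nu> x)) \<longlonglongrightarrow> 0 \<and>
      (\<forall>i<d j. (\<lambda>\<nu>. sq (d j) (\<Omega> j) (\<lambda>x. fst Fw i x - partial_deriv i (snd Fw \<nu>) x)) \<longlonglongrightarrow> 0))"
    (is "\<forall>j. \<exists>Fw. j < n \<longrightarrow> ?good j Fw")
  proof
    fix j
    show "\<exists>Fw. j < n \<longrightarrow> ?good j Fw"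
    proof (cases "j < n")
      case True
      have fj: "f j \<in> H1_per (d j) (open_box (d j) (a j) (b j))" using f[OF True] \<Omega>[OF True] by simp
      then obtain F where F: "sobolev_pair (d j) (open_box (d j) (a j) (b j)) (f j) F"
        unfolding H1_per_def using H1_closure_subset_H1_space H1_space_iff by blast
      have "\<exists>w. (\<forall>\<nu>. smooth_fun (d j) (w \<nu>)) \<and> (\<forall>\<nu>. periodic (d j) (a j) (b j) (w \<nu>)) \<and>
        (\<lambda>\<nu>. sq (d j) (open_box (d j) (a j) (b j)) (\<lambda>x. f j x - w \<nu> x)) \<longlonglongrightarrow> 0 \<and>
        (\<forall>k<d j. (\<lambda>\<nu>. sq (d j) (open_box (d j) (a j) (b j)) (\<lambda>x. F k x - partial_deriv k (w \<nu>) x)) \<longlonglongrightarrow> 0)"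
        by (rule H1_per_approx[OF ab[OF True] fj F])
      then obtain w where "(\<forall>\<nu>. smooth_fun (d j) (w \<nu>)) \<and> (\<forall>\<nu>. periodic (d j) (a j) (b j) (w \<nu>)) \<and>
        (\<lambda>\<nu>. sq (d j) (open_box (d j) (a j) (b j)) (\<lambda>x. f j x - w \<nu> x)) \<longlonglongrightarrow> 0 \<and>
        (\<forall>k<d j. (\<lambda>\<nu>. sq (d j) (open_box (d j) (a j) (b j)) (\<lambda>x. F k x - partial_deriv k (w \<nu>) x)) \<longlonglongrightarrow> 0)"
        by (elim exE)
      then have "?good j (F, w)" using F unfolding \<Omega>[OF True] by simp
      then show ?thesis by (intro exI impI)
    qed simp
  qed
  from choice[OF this] obtain Fw where Fw: "\<forall>j. j < n \<longrightarrow> ?good j (Fw j)" ..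
  define F where "F j = fst (Fw j)" for j
  define w where "w \<nu> j = snd (Fw j) \<nu>" for \<nu> j
  have F: "sobolev_pair (d j) (\<Omega> j) (f j) (F j)"
    and w: "smooth_fun (d j) (w \<nu> j)" "periodic (d j) (a j) (b j) (w \<nu> j)"
    and lim: "(\<lambda>\<nu>. sq (d j) (\<Omega> j) (\<lambda>x. f j x - w \<nu> j x)) \<longlonglongrightarrow> 0"
      "i < d j \<Longrightarrow> (\<lambda>\<nu>. sq (d j) (\<Omega> j) (\<lambda>x. F j i x - partial_deriv i (w \<nu> j) x)) \<longlonglongrightarrow> 0"
    if "j < n" for j \<nu> i
    using Fw that unfolding F_def w_def by auto
  have wL: "w \<nu> j \<in> L2_space (d j) (\<Omega> j)" if "j < n" for \<nu> j
    unfolding \<Omega>[OF that] by (intro L2_space_continuous smooth_fun_continuous w that)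
  have dL: "partial_deriv i (w \<nu> j) \<in> L2_space (d j) (\<Omega> j)" if "j < n" "i < d j" for \<nu> j i
    unfolding \<Omega>[OF that(1)] by (intro L2_space_continuous smooth_fun_continuous smooth_fun_partial_deriv w that)
  have T0: "elementary_tensor d n f \<in> L2_space ?D ?Q"
    "(\<lambda>\<nu>. sq ?D ?Q (\<lambda>x. elementary_tensor d n f x - elementary_tensor d n (w \<nu>) x)) \<longlonglongrightarrow> 0"
    using elementary_tensor_tendsto[of n \<Omega> d a b f w, OF \<Omega> _ wL lim(1)] F
    unfolding Q sobolev_pair_def by blast+
  \<comment> \<open>The same convergence result as for \<open>T0\<close>, with factor
    \<open>j\<close> and its approximants replaced by their derivatives.\<close>
  have T1: "elementary_tensor d n (f(j := F j i)) \<in> L2_space ?D ?Q \<and>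
    (\<lambda>\<nu>. sq ?D ?Q (\<lambda>x. elementary_tensor d n (f(j := F j i)) x -
       elementary_tensor d n ((w \<nu>)(j := partial_deriv i (w \<nu> j))) x)) \<longlonglongrightarrow> 0"
    if ji: "j < n" "i < d j" for j i
  proof -
    have "(f(j := F j i)) l \<in> L2_space (d l) (\<Omega> l)" if "l < n" for l
      using F[OF that] ji unfolding sobolev_pair_def by auto
    moreover have "((w \<nu>)(j := partial_deriv i (w \<nu> j))) l \<in> L2_space (d l) (\<Omega> l)" if "l < n" for l \<nu>
      using wL[OF that] dL[OF ji] by auto
    moreover have "(\<lambda>\<nu>. sq (d l) (\<Omega> l) (\<lambda>x. (f(j := F j i)) l x - ((w \<nu>)(j := partial_deriv i (w \<nu> j))) l x)) \<longlonglongrightarrow> 0"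
      if "l < n" for l
      using lim(1)[OF that] lim(2)[OF ji] by (cases "l = j") auto
    ultimately show ?thesis
      using elementary_tensor_tendsto[of n \<Omega> d a b "f(j := F j i)" "\<lambda>\<nu>. (w \<nu>)(j := partial_deriv i (w \<nu> j))", OF \<Omega>]
      unfolding Q by blast
  qed
  \<comment> \<open>Each coordinate is decoded into its block and its position there, so that the
    candidate derivatives can be indexed by \<open>k\<close>.\<close>
  have "\<forall>k. \<exists>ji. k < ?D \<longrightarrow> fst ji < n \<and> snd ji < d (fst ji) \<and> k = total_dim d (fst ji) + snd ji"
    using total_dim_cases[of _ d n] by (metis fst_conv snd_conv)
  from choice[OF this] obtain p where
    p: "\<forall>k. k < ?D \<longrightarrow> fst (p k) < n \<and> snd (p k) < d (fst (p k)) \<and> k = total_dim d (fst (p k)) + snd (p k)" ..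
  define G where "G k = elementary_tensor d n (f(fst (p k) := F (fst (p k)) (snd (p k))))" for k
  define U where "U \<nu> k = elementary_tensor d n ((w \<nu>)(fst (p k) := partial_deriv (snd (p k)) (w \<nu> (fst (p k)))))" for \<nu> k
  have sm: "smooth_fun ?D (elementary_tensor d n (w \<nu>))" for \<nu>
    by (rule smooth_elementary_tensor[OF w(1)])
  have Upair: "sobolev_pair ?D ?Q (elementary_tensor d n (w \<nu>)) (U \<nu>)" for \<nu>
  proof (rule sobolev_pair_partial[OF AB smooth_fun_continuous[OF sm]])
    fix k assume k: "k < ?D"
    then have pk: "fst (p k) < n" "snd (p k) < d (fst (p k))" "k = total_dim d (fst (p k)) + snd (p k)"
      using p by blast+
    have "smooth_fun (d j) (((w \<nu>)(fst (p k) := partial_deriv (snd (p k)) (w \<nu> (fst (p k))))) j)" if "j < n" for j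
      using w(1)[OF that] smooth_fun_partial_deriv[OF w(1)[OF pk(1)] pk(2)] by simp
    then show "continuous_on (real_space ?D) (U \<nu> k)"
      unfolding U_def by (intro smooth_fun_continuous smooth_elementary_tensor)
    show "has_partial ?D k (elementary_tensor d n (w \<nu>)) (U \<nu> k)"
      unfolding U_def
      using has_partial_elementary_tensor[of "fst (p k)" n "snd (p k)" d "w \<nu>",
          OF pk(1,2) smooth_fun_has_partial[OF w(1)[OF pk(1)] pk(2)]] pk(3) by simp
  qed
  have "elementary_tensor d n f \<in> H1_closure ?D ?Q (smooth_per ?D ?Q)"
  proof (rule H1_closure_seqI[where F = G and U = U and u = "\<lambda>\<nu>. restrict (elementary_tensor d n (w \<nu>)) ?Q"])
    show "elementary_tensor d n f \<in> L2_space ?D ?Q" by (rule T0)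
    show "restrict (elementary_tensor d n (w \<nu>)) ?Q \<in> smooth_per ?D ?Q" for \<nu>
      by (rule smooth_perI[OF AB sm periodic_elementary_tensor[OF w(2)]])
    show "sobolev_pair ?D ?Q (restrict (elementary_tensor d n (w \<nu>)) ?Q) (U \<nu>)" for \<nu>
      by (rule sobolev_pair_restrict[OF Upair])
    have "sq ?D ?Q (\<lambda>x. elementary_tensor d n f x - restrict (elementary_tensor d n (w \<nu>)) ?Q x) =
        sq ?D ?Q (\<lambda>x. elementary_tensor d n f x - elementary_tensor d n (w \<nu>) x)" for \<nu>
      by (rule sq_cong) simp
    then show "(\<lambda>\<nu>. sq ?D ?Q (\<lambda>x. elementary_tensor d n f x - restrict (elementary_tensor d n (w \<nu>)) ?Q x)) \<longlonglongrightarrow> 0"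
      using T0(2) by simp
    fix k assume "k < ?D"
    then have pk: "fst (p k) < n" "snd (p k) < d (fst (p k))" using p by blast+
    show "G k \<in> L2_space ?D ?Q" "(\<lambda>\<nu>. sq ?D ?Q (\<lambda>x. G k x - U \<nu> k x)) \<longlonglongrightarrow> 0"
      using T1[OF pk] unfolding G_def U_def by blast+
  qed
  then show ?thesis unfolding H1_per_def Q .
qed

text \<open>\<open>complex_span\<close> numbers its summands by an initial segment, so the finite
  index set has to be enumerated.\<close>

lemma sum_in_complex_span:
  assumes "finite F" "\<And>n. n \<in> F \<Longrightarrow> v n \<in> S"
  shows "(\<lambda>x. \<Sum>n\<in>F. c n * v n x) \<in> complex_span S"
proof -
  obtain h where h: "bij_betw h {..<card F} F"
    using ex_bij_betw_nat_finite[OF assms(1)] by (auto simp: atLeast0LessThan)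
  have "(\<lambda>x. \<Sum>n\<in>F. c n * v n x) = (\<lambda>x. \<Sum>l<card F. c (h l) * v (h l) x)"
    by (intro ext sum.reindex_bij_betw[OF h, symmetric])
  moreover have "\<forall>l<card F. v (h l) \<in> S" using h assms(2) by (auto simp: bij_betw_def)
  ultimately show ?thesis unfolding complex_span_def
    by (intro CollectI exI[of _ "card F"] exI[of _ "\<lambda>l. c (h l)"] exI[of _ "\<lambda>l. v (h l)"] conjI)
qed

lemma H1_per_product_eq_tensor_space:
  assumes \<Omega>: "\<And>j. j < n \<Longrightarrow> \<Omega> j = open_box (d j) (a j) (b j)"
    and ab: "\<And>j i. j < n \<Longrightarrow> i < d j \<Longrightarrow> a j i < b j i"
  shows "H1_per (total_dim d n) (product_domain d n \<Omega>) = tensor_space d n \<Omega> (\<lambda>j. H1_per (d j) (\<Omega> j))"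
proof -
  let ?D = "total_dim d n" and ?A = "concat_blocks d a" and ?B = "concat_blocks d b"
  let ?Q = "open_box ?D ?A ?B"
  let ?E = "{elementary_tensor d n f |f. \<forall>j<n. f j \<in> H1_per (d j) (\<Omega> j)}"
  have Q: "product_domain d n \<Omega> = ?Q" by (rule product_domain_open_box[OF \<Omega>])
  note AB = concat_blocks_less[of n d a b, OF ab]
  have "?E \<subseteq> H1_per ?D ?Q"
    using elementary_tensor_in_H1_per[of n \<Omega> d a b, OF \<Omega> ab] unfolding Q by blast
  then have "complex_span ?E \<subseteq> H1_per ?D ?Q" by (intro H1_per_complex_span AB)
  then have 1: "H1_closure ?D ?Q (complex_span ?E) \<subseteq> H1_per ?D ?Q"
    unfolding H1_per_def[of ?D ?Q] by (intro H1_closure_mono_closure) blast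
  \<comment> \<open>The frequency in a coordinate depends only on the length of the box in that
    coordinate, so each block factor of a wave has the periods of its own box.\<close>
  have wave_in: "wave ?D (period_freq ?A ?B) N \<in> ?E" for N
  proof -
    let ?f = "\<lambda>j. wave (d j) (period_freq (a j) (b j)) (\<lambda>i. N (total_dim d j + i))"
    have "wave ?D (period_freq ?A ?B) N x = elementary_tensor d n ?f x" for x
    proof -
      have "wave (d j) (\<lambda>i. period_freq ?A ?B (total_dim d j + i)) (\<lambda>i. N (total_dim d j + i)) (block d j x) =
          ?f j (block d j x)" for j
        unfolding wave_def period_freq_def by (simp add: concat_blocks_add)
      then show ?thesis unfolding wave_elementary_tensor by (simp add: elementary_tensor_def)
    qed
    then have "wave ?D (period_freq ?A ?B) N = elementary_tensor d n ?f" by (rule ext)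
    moreover have "?f j \<in> H1_per (d j) (\<Omega> j)" if j: "j < n" for j
      unfolding \<Omega>[OF j] by (intro smooth_periodic_in_H1_per smooth_fun_wave periodic_wave ab j)
    ultimately show ?thesis by blast
  qed
  \<comment> \<open>By idempotence of the closure it is enough to approximate smooth periodic
    functions.\<close>
  have 2: "H1_per ?D ?Q \<subseteq> H1_closure ?D ?Q (complex_span ?E)"
    unfolding H1_per_def[of ?D ?Q]
  proof (rule H1_closure_mono_closure, rule subsetI)
    fix s assume "s \<in> smooth_per ?D ?Q \<inter> H1_space ?D ?Q"
    then have "s \<in> smooth_per ?D ?Q" by simp
    then obtain u where u: "s = restrict u ?Q" "smooth_fun ?D u" "periodic ?D ?A ?B u"
      by (rule smooth_perE[OF _ AB])
    show "s \<in> H1_closure ?D ?Q (complex_span ?E)"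
      unfolding u(1)
    proof (rule H1_closureI[OF sobolev_pair_restrict[OF sobolev_pair_smooth[OF AB u(2)]]])
      fix \<epsilon> :: real assume "\<epsilon> > 0"
      obtain F c P where F: "finite F"
        "sobolev_pair ?D ?Q (\<lambda>x. \<Sum>n\<in>F. c n * wave ?D (period_freq ?A ?B) n x) P"
        "energy ?D ?Q (\<lambda>x. u x - (\<Sum>n\<in>F. c n * wave ?D (period_freq ?A ?B) n x))
          (\<lambda>k x. partial_deriv k u x - P k x) < \<epsilon>"
        using wave_sum_approximation_energy[OF AB u(2,3) \<open>\<epsilon> > 0\<close>] by blast
      let ?q = "\<lambda>x. \<Sum>n\<in>F. c n * wave ?D (period_freq ?A ?B) n x"
      have q: "?q \<in> complex_span ?E" by (rule sum_in_complex_span[OF F(1) wave_in])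
      have "energy ?D ?Q (\<lambda>x. restrict u ?Q x - ?q x) (\<lambda>k x. partial_deriv k u x - P k x) =
          energy ?D ?Q (\<lambda>x. u x - ?q x) (\<lambda>k x. partial_deriv k u x - P k x)"
        by (rule energy_cong) auto
      with F(3) have "energy ?D ?Q (\<lambda>x. restrict u ?Q x - ?q x) (\<lambda>k x. partial_deriv k u x - P k x) < \<epsilon>"
        by simp
      with F(2) show "\<exists>g\<in>complex_span ?E. \<exists>G. sobolev_pair ?D ?Q g G \<and>
          energy ?D ?Q (\<lambda>x. restrict u ?Q x - g x) (\<lambda>k x. partial_deriv k u x - G k x) < \<epsilon>"
        by (intro bexI[OF _ q] exI[of _ P] conjI)
    qed
  qed
  from 1 2 show ?thesis unfolding tensor_space_def Q by (rule equalityI[rotated])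
qed

section \<open>Uniqueness of the operator associated with a form\<close>

lemma L2_inner_cnj: "L2_inner m Q f g = cnj (L2_inner m Q g f)"
  unfolding L2_inner_def Bochner_Integration.integral_cnj[symmetric] by (simp add: mult.commute)

lemma dirichlet_form_cnj: "dirichlet_form m Q f g = cnj (dirichlet_form m Q g f)"
  unfolding dirichlet_form_def cnj_sum by (intro sum.cong refl L2_inner_cnj)

text \<open>For (f, h) in T and (g, k) in T', Hermitian symmetry of the form t gives <k, f> =
  t[g, f] = cnj t[f, g] = cnj <h, g> = <g, h>. Hence (f, h) lies in the adjoint of T', which is T'
  itself.\<close>

lemma form_operator_subset:
  assumes T: "form_operator m Q V T" and T': "form_operator m Q V T'"
  shows "T \<subseteq> T'"
proof (rule subrelI)
  fix f h assume fh: "(f, h) \<in> T"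
  have f: "f \<in> V" using T fh unfolding form_operator_def by blast
  have "T \<subseteq> L2_space m Q \<times> L2_space m Q"
    using T unfolding form_operator_def self_adjoint_op_def linear_operator_def by blast
  then have L2: "f \<in> L2_space m Q" "h \<in> L2_space m Q" using fh by blast+
  have "L2_inner m Q k f = L2_inner m Q g h" if gk: "(g, k) \<in> T'" for g k
  proof -
    have "g \<in> V" using T' gk unfolding form_operator_def by blast
    then have "dirichlet_form m Q f g = L2_inner m Q h g"
      using T fh unfolding form_operator_def by blast
    moreover have "dirichlet_form m Q g f = L2_inner m Q k f"
      using T' gk f unfolding form_operator_def by blast
    ultimately show ?thesis by (metis dirichlet_form_cnj L2_inner_cnj)
  qed
  then have "(f, h) \<in> adjoint_op m Q T'" using L2 unfolding adjoint_op_def by blast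
  then show "(f, h) \<in> T'" using T' unfolding form_operator_def self_adjoint_op_def by blast
qed

theorem proposition3p3:
  fixes n :: nat and d :: "nat \<Rightarrow> nat" and \<Omega>\<^sub>j :: "nat \<Rightarrow> point set"
    and D :: nat and \<Omega> :: "point set"
  assumes "n \<ge> 2"
    and "\<And>j. j < n \<Longrightarrow> d j \<ge> 1"
    and "\<And>j. j < n \<Longrightarrow> hyperrectangle (d j) (\<Omega>\<^sub>j j)"
  defines "D \<equiv> total_dim d n"
    and "\<Omega> \<equiv> product_domain d n \<Omega>\<^sub>j"
  shows "(\<forall>T \<Delta>. form_operator D \<Omega> (tensor_space d n \<Omega>\<^sub>j (\<lambda>j. H1_per (d j) (\<Omega>\<^sub>j j))) T \<longrightarrow>
                 periodic_laplacian D \<Omega> \<Delta> \<longrightarrow> T = uminus_op \<Delta>) \<and>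
         H1_per D \<Omega> = tensor_space d n \<Omega>\<^sub>j (\<lambda>j. H1_per (d j) (\<Omega>\<^sub>j j))"
proof -
  have "\<forall>j. \<exists>a b. j < n \<longrightarrow> (\<forall>i<d j. a i < b i) \<and> \<Omega>\<^sub>j j = open_box (d j) a b"
    using assms(3) unfolding hyperrectangle_def by blast
  from choice[OF this] obtain a where
    "\<forall>j. \<exists>b. j < n \<longrightarrow> (\<forall>i<d j. a j i < b i) \<and> \<Omega>\<^sub>j j = open_box (d j) (a j) b" ..
  from choice[OF this] obtain b where
    ab: "\<forall>j. j < n \<longrightarrow> (\<forall>i<d j. a j i < b j i) \<and> \<Omega>\<^sub>j j = open_box (d j) (a j) (b j)" ..
  have eq: "H1_per D \<Omega> = tensor_space d n \<Omega>\<^sub>j (\<lambda>j. H1_per (d j) (\<Omega>\<^sub>j j))"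
    unfolding D_def \<Omega>_def using H1_per_product_eq_tensor_space[of n \<Omega>\<^sub>j d a b] ab by blast
  \<comment> \<open>After rewriting with \<open>eq\<close>, both operators belong to the same form
    domain, and the inclusion is applied in both directions.\<close>
  have "T = uminus_op \<Delta>"
    if "form_operator D \<Omega> (tensor_space d n \<Omega>\<^sub>j (\<lambda>j. H1_per (d j) (\<Omega>\<^sub>j j))) T"
      "periodic_laplacian D \<Omega> \<Delta>" for T \<Delta>
    using that form_operator_subset unfolding periodic_laplacian_def eq by blast
  with eq show ?thesis by blast
qed

end
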